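(* Let $g$ satisfy the standing assumptions in the context. For $\alpha>\alpha_*$, let $\mathrm{Pow}_o(\alpha)$ be the limit of power (as $n\to\infty$) of procedure $\mathcal{P}_o$ with control parameter $\alpha$, and $\mathrm{Pow}(\alpha)$ that of procedure $\mathcal{P}$ with control parameter $\alpha$, where $\mathcal{P}_o$ and $\mathcal{P}$ are defined in the context. Then $\mathrm{Pow}_o(\alpha)/\mathrm{Pow}(\alpha)\to1$ as $\alpha\downarrow\alpha_*$. Moreover, let $\mathcal{V}_o$ and $\mathcal{D}_o$ be the sets of true nulls and false nulls, respectively, that are rejected by $\mathcal{P}_o$, and $\mathcal{V}$ and $\mathcal{D}$ those rejected by $\mathcal{P}$. Let $r_D(\alpha)$ be the in-probability limit of $|\mathcal{D}_o\triangle\mathcal{D}|/|\mathcal{D}_o\cap\mathcal{D}|$ and $r_V(\alpha)$ that of $|\mathcal{V}_o\triangle\mathcal{V}|/|\mathcal{V}_o\cap\mathcal{V}|$ as $n\to\infty$. Then $r_D(\alpha)\to0$ and $r_V(\alpha)\to0$ as $\alpha\downarrow\alpha_*$.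
   Context: $\ell$ is Lebesgue measure; $x\vee y=\max(x,y)$; $\boldsymbol{x}^\varepsilon=(x_1^\varepsilon,\dots,x_K^\varepsilon)'$; $\triangle$ is symmetric difference and $|\cdot|$ of a set its cardinality. Random effects model: $H_1,\dots,H_n$ are nulls, $\theta_i=\mathbf{1}\{H_i\text{ is false}\}$, $\boldsymbol{\xi}_i\in[0,1]^K$ the multivariate $p$-value of $H_i$; $(\theta_i,\boldsymbol{\xi}_i)$ are i.i.d., $P(\theta_i=1)=a\in(0,1)$; given $\theta_i=0$, the coordinates of $\boldsymbol{\xi}_i$ are i.i.d. $\mathrm{Unif}(0,1)$; given $\theta_i=1$, $\boldsymbol{\xi}_i\sim G$ with density $g$. Standing assumptions on $g$: $g\in C([0,1]^K)$ and $g(\boldsymbol{x})<g(\mathbf{0})<\infty$ for all $\boldsymbol{x}\ne\mathbf{0}$; for some $\varepsilon>0$ and $\boldsymbol{\gamma}=(\gamma_1,\dots,\gamma_K)'$ with all $\gamma_k>0$, $g(\boldsymbol{x})=g(\mathbf{0})(1-\boldsymbol{\gamma}'\boldsymbol{x}^\varepsilon+r(\boldsymbol{x}))$ with $r(\boldsymbol{x})=o(|\boldsymbol{x}|^\varepsilon)$ as $|\boldsymbol{x}|\to0$; and $u\mapsto\ell(\Gamma_u)$ is continuous, where $\Gamma_u=\{\boldsymbol{x}\in[0,1]^K:g(\boldsymbol{x})\ge u\}$, $0\le u<\infty$. Let $\alpha_*=1/(1-a+ag(\mathbf{0}))$. Procedure $\mathcal{P}_o$ (control parameter $\alpha\in(0,1)$):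 let $h_o^*(t)=\inf\{u\ge0:\ell(\Gamma_u)\le t\}$ and $D_t=\Gamma_{h_o^*(t)}$, $t\in[0,1]$; reject $H_i$ iff $\boldsymbol{\xi}_i\in D_\tau$, where $\tau=\sup\{t\in[0,1]:t/\alpha\le(\#\{i:\boldsymbol{\xi}_i\in D_t\}\vee1)/n\}$. Procedure $\mathcal{P}$ (control parameter $\alpha\in(0,1)$): apply the BH procedure to $s_i=h(\boldsymbol{\gamma}'\boldsymbol{\xi}_i^\varepsilon;\boldsymbol{\gamma})$, where $h(u;\boldsymbol{\gamma})=\ell(\{\boldsymbol{x}\in[0,1]^K:\boldsymbol{\gamma}'\boldsymbol{x}^\varepsilon\le u\})$; i.e. reject $H_i$ iff $s_i\le\sup\{t\in[0,1]:t/\alpha\le(\#\{j:s_j\le t\}\vee1)/n\}$. With $R$, $V$, $N$ the numbers of rejected nulls, rejected true nulls, and true nulls, $\mathrm{power}=E[(R-V)/((n-N)\vee1)]$. *)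

theory Defs
  imports "HOL-Probability.Probability" "HOL-Library.Landau_Symbols"
begin

text \<open>The dimension $K$ is \<open>CARD('k)\<close>; points of $[0,1]^K$ live in \<open>real ^ 'k\<close>.\<close>

abbreviation unit_cube :: "(real ^ 'k) set" where
  "unit_cube \<equiv> cbox 0 1"

definition powr_vec :: "real \<Rightarrow> real ^ 'k \<Rightarrow> real ^ 'k" where
  "powr_vec \<epsilon> x = (\<chi> k. x $ k powr \<epsilon>)"

definition upper_level :: "(real ^ 'k \<Rightarrow> real) \<Rightarrow> real \<Rightarrow> (real ^ 'k) set" where
  "upper_level g u = {x \<in> unit_cube. g x \<ge> u}"

definition standing_assumptions ::
    "(real ^ 'k \<Rightarrow> real) \<Rightarrow> real \<Rightarrow> real ^ 'k \<Rightarrow> bool" where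
  "standing_assumptions g \<epsilon> \<gamma> \<longleftrightarrow>
     (\<forall>x\<in>unit_cube. 0 \<le> g x) \<and> (g has_integral 1) unit_cube \<and>
     continuous_on unit_cube g \<and>
     (\<forall>x\<in>unit_cube. x \<noteq> 0 \<longrightarrow> g x < g 0) \<and>
     0 < \<epsilon> \<and> (\<forall>k. 0 < \<gamma> $ k) \<and>
     (\<exists>r :: real ^ 'k \<Rightarrow> real.
        (\<forall>x\<in>unit_cube. g x = g 0 * (1 - \<gamma> \<bullet> powr_vec \<epsilon> x + r x)) \<and>
        r \<in> o[at 0 within unit_cube](\<lambda>x. norm x powr \<epsilon>)) \<and>
     continuous_on {0..} (\<lambda>u. measure lborel (upper_level g u))"

definition alpha_star :: "real \<Rightarrow> (real ^ 'k \<Rightarrow> real) \<Rightarrow> real" where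
  "alpha_star a g = 1 / (1 - a + a * g 0)"

text \<open>\<open>\<theta> i \<omega>\<close> says that the \<open>i\<close>-th null is false. \<open>uniform_measure M A\<close> is the conditional
  law of \<open>M\<close> given \<open>A\<close>. The pairs \<open>(\<theta> i, \<xi> i)\<close> are identically distributed because the four
  distributional assumptions determine a joint law that does not depend on \<open>i\<close>.\<close>

locale random_effects = prob_space M for M :: "'w measure" +
  fixes a :: real and g :: "real ^ 'k \<Rightarrow> real"
    and \<theta> :: "nat \<Rightarrow> 'w \<Rightarrow> bool" and \<xi> :: "nat \<Rightarrow> 'w \<Rightarrow> real ^ 'k"
  assumes a_range: "0 < a" "a < 1"
    and in_cube: "\<And>i \<omega>. \<omega> \<in> space M \<Longrightarrow> \<xi> i \<omega> \<in> unit_cube"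
    and indep_pairs: "indep_vars (\<lambda>_. count_space UNIV \<Otimes>\<^sub>M borel) (\<lambda>i \<omega>. (\<theta> i \<omega>, \<xi> i \<omega>)) UNIV"
    and prob_false: "\<And>i. prob {\<omega> \<in> space M. \<theta> i \<omega>} = a"
    and null_indep: "\<And>i. prob_space.indep_vars (uniform_measure M {\<omega> \<in> space M. \<not> \<theta> i \<omega>})
          (\<lambda>_. borel) (\<lambda>k \<omega>. \<xi> i \<omega> $ k) UNIV"
    and null_unif: "\<And>i k. distr (uniform_measure M {\<omega> \<in> space M. \<not> \<theta> i \<omega>}) lborel (\<lambda>\<omega>. \<xi> i \<omega> $ k)
          = uniform_measure lborel {0..1}"
    and alt_density: "\<And>i. distributed (uniform_measure M {\<omega> \<in> space M. \<theta> i \<omega>}) lborel (\<xi> i)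
          (\<lambda>x. ennreal (g x) * indicator unit_cube x)"

text \<open>The nulls $H_1,\dots,H_n$ are indexed by \<open>{..<n}\<close>; a realisation of the multivariate
  p-values is a function \<open>x :: nat \<Rightarrow> real ^ 'k\<close>, and a procedure maps \<open>n\<close> and \<open>x\<close> to the set of
  rejected indices.\<close>

definition threshold :: "real \<Rightarrow> nat \<Rightarrow> (real \<Rightarrow> nat set) \<Rightarrow> real" where
  "threshold \<alpha> n S = Sup {t \<in> {0..1}. t / \<alpha> \<le> real (max (card (S t)) 1) / real n}"

definition h_o :: "(real ^ 'k \<Rightarrow> real) \<Rightarrow> real \<Rightarrow> real" where
  "h_o g t = Inf {u. 0 \<le> u \<and> measure lborel (upper_level g u) \<le> t}"

definition D_o :: "(real ^ 'k \<Rightarrow> real) \<Rightarrow> real \<Rightarrow> (real ^ 'k) set" where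
  "D_o g t = upper_level g (h_o g t)"

definition reject_o ::
    "(real ^ 'k \<Rightarrow> real) \<Rightarrow> real \<Rightarrow> nat \<Rightarrow> (nat \<Rightarrow> real ^ 'k) \<Rightarrow> nat set" where
  "reject_o g \<alpha> n x =
     (let \<tau> = threshold \<alpha> n (\<lambda>t. {i. i < n \<and> x i \<in> D_o g t})
      in {i. i < n \<and> x i \<in> D_o g \<tau>})"

definition reject_BH :: "real \<Rightarrow> nat \<Rightarrow> (nat \<Rightarrow> real) \<Rightarrow> nat set" where
  "reject_BH \<alpha> n s =
     {i. i < n \<and> s i \<le> threshold \<alpha> n (\<lambda>t. {j. j < n \<and> s j \<le> t})}"

definition h_gamma :: "real \<Rightarrow> real ^ 'k \<Rightarrow> real \<Rightarrow> real" where
  "h_gamma \<epsilon> \<gamma> u = measure lborel {x \<in> unit_cube. \<gamma> \<bullet> powr_vec \<epsilon> x \<le> u}"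

definition reject ::
    "real \<Rightarrow> real ^ 'k \<Rightarrow> real \<Rightarrow> nat \<Rightarrow> (nat \<Rightarrow> real ^ 'k) \<Rightarrow> nat set" where
  "reject \<epsilon> \<gamma> \<alpha> n x = reject_BH \<alpha> n (\<lambda>i. h_gamma \<epsilon> \<gamma> (\<gamma> \<bullet> powr_vec \<epsilon> (x i)))"

text \<open>In the following, \<open>rej n x\<close> is a procedure and \<open>\<theta>\<close>, \<open>\<xi>\<close> come from the model.\<close>

definition true_rej ::
    "(nat \<Rightarrow> (nat \<Rightarrow> real ^ 'k) \<Rightarrow> nat set) \<Rightarrow> (nat \<Rightarrow> 'w \<Rightarrow> bool) \<Rightarrow> (nat \<Rightarrow> 'w \<Rightarrow> real ^ 'k)
      \<Rightarrow> nat \<Rightarrow> 'w \<Rightarrow> nat set" where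
  "true_rej rej \<theta> \<xi> n \<omega> = {i \<in> rej n (\<lambda>j. \<xi> j \<omega>). \<not> \<theta> i \<omega>}"

definition false_rej ::
    "(nat \<Rightarrow> (nat \<Rightarrow> real ^ 'k) \<Rightarrow> nat set) \<Rightarrow> (nat \<Rightarrow> 'w \<Rightarrow> bool) \<Rightarrow> (nat \<Rightarrow> 'w \<Rightarrow> real ^ 'k)
      \<Rightarrow> nat \<Rightarrow> 'w \<Rightarrow> nat set" where
  "false_rej rej \<theta> \<xi> n \<omega> = {i \<in> rej n (\<lambda>j. \<xi> j \<omega>). \<theta> i \<omega>}"

definition avg_power ::
    "'w measure \<Rightarrow> (nat \<Rightarrow> (nat \<Rightarrow> real ^ 'k) \<Rightarrow> nat set) \<Rightarrow> (nat \<Rightarrow> 'w \<Rightarrow> bool)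
      \<Rightarrow> (nat \<Rightarrow> 'w \<Rightarrow> real ^ 'k) \<Rightarrow> nat \<Rightarrow> real" where
  "avg_power M rej \<theta> \<xi> n =
     (\<integral>\<omega>. (let R = real (card (rej n (\<lambda>j. \<xi> j \<omega>)));
               V = real (card (true_rej rej \<theta> \<xi> n \<omega>));
               N = real (card {i. i < n \<and> \<not> \<theta> i \<omega>})
           in (R - V) / max (real n - N) 1) \<partial>M)"

text \<open>The value $x/0=0$ taken when the intersection is empty has no influence on the limits in
  probability: below, the probability of that event tends to $0$ as $n\to\infty$.\<close>

definition diff_ratio :: "'a set \<Rightarrow> 'a set \<Rightarrow> real" where
  "diff_ratio A B = real (card (sym_diff A B)) / real (card (A \<inter> B))"

definition tendsto_in_prob :: "'w measure \<Rightarrow> (nat \<Rightarrow> 'w \<Rightarrow> real) \<Rightarrow> real \<Rightarrow> bool" where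
  "tendsto_in_prob M X c \<longleftrightarrow>
     (\<forall>n. X n \<in> borel_measurable M) \<and>
     (\<forall>e>0. (\<lambda>n. measure M {\<omega> \<in> space M. \<bar>X n \<omega> - c\<bar> > e}) \<longlonglongrightarrow> 0)"

end

theory Submission
  imports Defs
begin

text \<open>Write $f(x)=\gamma'x^\varepsilon$ and $\varphi(x)=1-g(x)/g(0)$ for the relative deficit of the
density below its peak. For a function $\psi$ that vanishes only at the origin, let the score of
$x$ be the volume of the part of the cube where $\psi$ is at most $\psi(x)$. Both procedures are
the BH procedure applied to such scores, $\mathcal P_o$ with $\psi=\varphi$ and $\mathcal P$ with
$\psi=f$ (\<open>reject_o_eq\<close>, \<open>reject_eq\<close>). A score is uniform on the cube, so the region where it
is at most $t$ has volume $t$.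

The law of large numbers turns the step-up rule into a deterministic equation. The expected
proportion of observations in the region of volume $t$ exceeds $t/\alpha$ if and only if the mean
of $\varphi$ over the region lies below the level
$b(\alpha)=(1/\alpha_*-1/\alpha)/(ag(0))$, which is positive for $\alpha>\alpha_*$ and tends to $0$
as $\alpha\downarrow\alpha_*$ (\<open>coverage_minus_line\<close>). Where the mean deficit passes this level
once, from below to above, the rejected set is squeezed between the observations in slightly
smaller and slightly larger regions, and all rejection counts, divided by $n$, converge to the
masses of the crossing regions (\<open>joint_frequency_tendsto\<close>). For $\varphi$ itself the mean deficit is
strictly increasing, so there is one crossing $s$ for every $\alpha\in(\alpha_*,1)$. For $f$ it is
only known to increase near $0$; away from $0$ it dominates the mean deficit over the
$\varphi$-regions, since sublevel sets of $\varphi$ minimise the integral of $\varphi$ at given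
volume. This is enough for one crossing $t\le s$ when $\alpha$ is near $\alpha_*$.

As $\alpha\downarrow\alpha_*$ both crossings tend to $0$. The sublevel sets of $f$ shrink to the
origin by dilation: $\{f\le u\}$ has volume $Cu^m$ with $m=K/\varepsilon$, and the mean of $f$ on it
is $\kappa u$ with $0<\kappa<1$. Since $(1-\eta)f\le\varphi\le(1+\eta)f$ near the origin, the two
families of regions are interleaved up to a factor $(1-\eta)/(1+\eta)$ in $u$, and equality of the
mean deficits at $s$ and $t$ forces $s/t\to1$ and the volume of the intersection of the two regions
to be asymptotically $t$ (\<open>regions_asymptotically_equal\<close>). There $g$ is nearly constant, so the same
holds for the masses under the alternative, and the three limits follow
(\<open>critical_masses\<close>).\<close>

section \<open>Convergence in probability as convergence along a filter\<close>

text \<open>The sets of pairs $(n,\omega)$ whose complement has, at stage $n$, a probability tending to $0$ form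
a filter. Convergence in probability is convergence along it, which makes the limit laws for sums,
quotients and maxima, and the order criteria for limits, available without subsequences. The sets
\<open>B n\<close> allow for properties that are not measurable.\<close>

definition whp :: "'w measure \<Rightarrow> (nat \<times> 'w) filter" where
  "whp M = Abs_filter (\<lambda>P. \<exists>B. range B \<subseteq> sets M \<and>
     (\<forall>n. {\<omega> \<in> space M. \<not> P (n, \<omega>)} \<subseteq> B n) \<and> (\<lambda>n. measure M (B n)) \<longlonglongrightarrow> 0)"

context prob_space
begin

lemma eventually_whp:
  "eventually P (whp M) \<longleftrightarrow> (\<exists>B. range B \<subseteq> events \<and>
     (\<forall>n. {\<omega> \<in> space M. \<not> P (n, \<omega>)} \<subseteq> B n) \<and> (\<lambda>n. prob (B n)) \<longlonglongrightarrow> 0)"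
  unfolding whp_def
proof (subst eventually_Abs_filter)
  show "is_filter (\<lambda>P. \<exists>B. range B \<subseteq> events \<and>
     (\<forall>n. {\<omega> \<in> space M. \<not> P (n, \<omega>)} \<subseteq> B n) \<and> (\<lambda>n. prob (B n)) \<longlonglongrightarrow> 0)"
  proof (standard, goal_cases)
    case 1
    show ?case by (rule exI[of _ "\<lambda>_. {}"]) auto
  next
    case (2 P Q)
    then obtain B C where B: "range B \<subseteq> events" "\<And>n. {\<omega> \<in> space M. \<not> P (n, \<omega>)} \<subseteq> B n"
        "(\<lambda>n. prob (B n)) \<longlonglongrightarrow> 0"
      and C: "range C \<subseteq> events" "\<And>n. {\<omega> \<in> space M. \<not> Q (n, \<omega>)} \<subseteq> C n"
        "(\<lambda>n. prob (C n)) \<longlonglongrightarrow> 0" by blast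
    have "(\<lambda>n. prob (B n \<union> C n)) \<longlonglongrightarrow> 0"
    proof (rule tendsto_sandwich[OF _ _ tendsto_const])
      show "(\<lambda>n. prob (B n) + prob (C n)) \<longlonglongrightarrow> 0"
        using tendsto_add[OF B(3) C(3)] by simp
      show "\<forall>\<^sub>F n in sequentially. prob (B n \<union> C n) \<le> prob (B n) + prob (C n)"
        using B(1) C(1) by (intro always_eventually allI measure_Un_le) auto
    qed auto
    then show ?case
      using B(1,2) C(1,2) by (intro exI[of _ "\<lambda>n. B n \<union> C n"] conjI allI) blast+
  next
    case (3 P Q)
    then show ?case by blast
  qed
qed auto

lemma eventually_whp_of_sequentially:
  assumes "eventually Q sequentially"
  shows "\<forall>\<^sub>F (n, \<omega>) in whp M. Q n"
  unfolding eventually_whp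
proof (rule exI[of _ "\<lambda>n. if Q n then {} else space M"], intro conjI)
  show "(\<lambda>n. prob (if Q n then {} else space M)) \<longlonglongrightarrow> 0"
    by (rule tendsto_eventually) (use assms in eventually_elim, auto)
qed auto

lemma eventually_whp_space: "\<forall>\<^sub>F (n, \<omega>) in whp M. \<omega> \<in> space M"
  unfolding eventually_whp by (rule exI[of _ "\<lambda>_. {}"]) auto

lemma tendsto_whp_of_sequentially:
  fixes f :: "nat \<Rightarrow> 'b::topological_space"
  assumes "f \<longlonglongrightarrow> l"
  shows "((\<lambda>(n, \<omega>). f n) \<longlongrightarrow> l) (whp M)"
proof (rule topological_tendstoI)
  fix S assume "open S" "l \<in> S"
  then have "\<forall>\<^sub>F n in sequentially. f n \<in> S" using assms by (rule topological_tendstoD[rotated])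
  from eventually_whp_of_sequentially[OF this]
  show "\<forall>\<^sub>F x in whp M. (case x of (n, \<omega>) \<Rightarrow> f n) \<in> S" by (simp add: split_def)
qed

lemma prob_tendsto_0_of_whp:
  assumes "eventually P (whp M)"
    and "\<And>n. {\<omega> \<in> space M. \<not> P (n, \<omega>)} \<in> events"
  shows "(\<lambda>n. prob {\<omega> \<in> space M. \<not> P (n, \<omega>)}) \<longlonglongrightarrow> 0"
proof -
  from assms(1) obtain B where B: "range B \<subseteq> events"
      "\<And>n. {\<omega> \<in> space M. \<not> P (n, \<omega>)} \<subseteq> B n" "(\<lambda>n. prob (B n)) \<longlonglongrightarrow> 0"
    unfolding eventually_whp by blast
  show ?thesis
    by (rule tendsto_sandwich[OF _ _ tendsto_const B(3)])
       (use B assms(2) in \<open>auto intro!: always_eventually finite_measure_mono\<close>)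
qed

lemma tendsto_in_prob_whp:
  assumes "\<And>n. X n \<in> borel_measurable M"
    and lim: "((\<lambda>(n, \<omega>). X n \<omega>) \<longlongrightarrow> c) (whp M)"
  shows "tendsto_in_prob M X c"
  unfolding tendsto_in_prob_def
proof (intro conjI allI impI)
  fix e :: real assume e: "0 < e"
  have "\<forall>\<^sub>F (n, \<omega>) in whp M. \<not> \<bar>X n \<omega> - c\<bar> > e"
    using tendstoD[OF lim e] by eventually_elim (auto simp: dist_real_def)
  from prob_tendsto_0_of_whp[OF this]
  show "(\<lambda>n. prob {\<omega> \<in> space M. \<bar>X n \<omega> - c\<bar> > e}) \<longlonglongrightarrow> 0"
    using assms(1) by simp
qed (use assms in auto)

text \<open>The bounded convergence theorem for convergence in probability; it passes from rejection
proportions to power.\<close>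

lemma integral_tendsto_whp:
  fixes X :: "nat \<Rightarrow> 'a \<Rightarrow> real"
  assumes meas: "\<And>n. X n \<in> borel_measurable M"
    and bounds: "\<And>n \<omega>. \<omega> \<in> space M \<Longrightarrow> 0 \<le> X n \<omega> \<and> X n \<omega> \<le> 1"
    and c: "0 \<le> c" "c \<le> 1"
    and lim: "((\<lambda>(n, \<omega>). X n \<omega>) \<longlongrightarrow> c) (whp M)"
  shows "(\<lambda>n. \<integral>\<omega>. X n \<omega> \<partial>M) \<longlonglongrightarrow> c"
proof (rule LIMSEQ_I)
  fix e :: real assume e: "0 < e"
  let ?B = "\<lambda>n. {\<omega> \<in> space M. \<bar>X n \<omega> - c\<bar> > e/3}"
  note meas[measurable]
  have int: "integrable M (X n)" for n
    by (rule integrable_const_bound[where B=1]) (use bounds in \<open>auto intro!: AE_I2\<close>)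
  have "(\<lambda>n. prob (?B n)) \<longlonglongrightarrow> 0"
    using tendsto_in_prob_whp[OF meas lim] e unfolding tendsto_in_prob_def
    by (meson divide_pos_pos zero_less_numeral)
  from LIMSEQ_D[OF this, of "e/3"] e obtain N where N: "\<And>n. n \<ge> N \<Longrightarrow> prob (?B n) < e/3"
    by auto
  show "\<exists>no. \<forall>n\<ge>no. norm ((\<integral>\<omega>. X n \<omega> \<partial>M) - c) < e"
  proof (intro exI allI impI)
    fix n assume n: "n \<ge> N"
    have "(\<integral>\<omega>. X n \<omega> \<partial>M) - c = (\<integral>\<omega>. X n \<omega> - c \<partial>M)"
      by (simp add: int prob_space)
    also have "norm \<dots> \<le> (\<integral>\<omega>. \<bar>X n \<omega> - c\<bar> \<partial>M)"
      using integral_norm_bound[of M "\<lambda>\<omega>. X n \<omega> - c"] by simp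
    also have "\<dots> \<le> (\<integral>\<omega>. e/3 + indicator (?B n) \<omega> \<partial>M)"
    proof (rule integral_mono)
      fix \<omega> assume "\<omega> \<in> space M"
      with bounds[OF this, of n] c show "\<bar>X n \<omega> - c\<bar> \<le> e/3 + indicator (?B n) \<omega>"
        using e by (auto simp: indicator_def)
    next
      have "?B n \<in> events" by measurable
      then show "integrable M (\<lambda>\<omega>. e/3 + indicator (?B n) \<omega>)"
        by (intro Bochner_Integration.integrable_add integrable_const integrable_real_indicator)
           (auto simp: emeasure_eq_measure simp del: divide_less_eq)
    qed (use int in auto)
    also have "\<dots> = e/3 + prob (?B n)"
    proof -
      have "?B n \<in> events" by measurable
      then show ?thesis
        by (subst Bochner_Integration.integral_add)
           (auto simp: prob_space emeasure_eq_measure simp del: divide_less_eq intro!: integrable_real_indicator)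
    qed
    also have "\<dots> < e" using N[OF n] e by simp
    finally show "norm ((\<integral>\<omega>. X n \<omega> \<partial>M) - c) < e" .
  qed
qed

end

section \<open>The Benjamini--Hochberg step-up rule\<close>

definition passing :: "real \<Rightarrow> nat \<Rightarrow> (nat \<Rightarrow> real) \<Rightarrow> real set" where
  "passing \<alpha> n s = {t \<in> {0..1}. t / \<alpha> \<le> real (max (card {j. j < n \<and> s j \<le> t}) 1) / real n}"

lemma threshold_eq_Sup_passing:
  "threshold \<alpha> n (\<lambda>t. {j. j < n \<and> s j \<le> t}) = Sup (passing \<alpha> n s)"
  by (simp add: threshold_def passing_def)

lemma zero_in_passing: "0 \<in> passing \<alpha> n s"
  by (auto simp: passing_def)

lemma passing_nonempty: "passing \<alpha> n s \<noteq> {}"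
  using zero_in_passing by blast

lemma passing_bounded: "bdd_above (passing \<alpha> n s)"
  by (rule bdd_aboveI[of _ 1]) (auto simp: passing_def)

lemma threshold_bounds:
  "threshold \<alpha> n (\<lambda>t. {j. j < n \<and> s j \<le> t}) \<in> {0..1}"
proof -
  have "Sup (passing \<alpha> n s) \<le> 1"
    by (rule cSup_least[OF passing_nonempty]) (simp add: passing_def)
  then show ?thesis
    using cSup_upper[OF zero_in_passing passing_bounded]
    by (simp add: threshold_eq_Sup_passing)
qed

lemma card_below_mono:
  "(s::real) \<le> t \<Longrightarrow> card {j. j < n \<and> x j \<le> s} \<le> card {j. j < (n::nat) \<and> x j \<le> t}"
  by (rule card_mono) auto

text \<open>The count of scores up to $t$ is nondecreasing, so the condition survives passage to the supremum.
Once it holds at $\tau$ with count $m$ (or $m=1$) it also holds at $\alpha m/n$, which is therefore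
$\tau$: the threshold lies on a finite grid.\<close>

lemma threshold_in_passing:
  fixes s :: "nat \<Rightarrow> real"
  assumes "0 < \<alpha>" "\<alpha> < 1" "0 < n"
  defines "\<tau> \<equiv> Sup (passing \<alpha> n s)"
  shows "\<tau> \<in> passing \<alpha> n s" "\<exists>m\<in>{1..n}. \<tau> = \<alpha> * m / n"
proof -
  let ?N = "\<lambda>t. real (max (card {j. j < n \<and> s j \<le> t}) 1)"
  have \<tau>01: "\<tau> \<in> {0..1}"
    using threshold_bounds[of \<alpha> n s] by (simp add: threshold_eq_Sup_passing \<tau>_def)
  have "t \<le> \<alpha> * ?N \<tau> / n" if "t \<in> passing \<alpha> n s" for t
  proof -
    have "t \<le> \<tau>" unfolding \<tau>_def by (rule cSup_upper[OF that passing_bounded])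
    then have "?N t \<le> ?N \<tau>" using card_below_mono[of t \<tau> n s] by simp
    moreover have "t / \<alpha> \<le> ?N t / n" using that by (simp add: passing_def)
    ultimately have "t / \<alpha> \<le> ?N \<tau> / n"
      by (meson divide_right_mono of_nat_0_le_iff order_trans)
    then show ?thesis using assms(1) by (simp add: divide_le_eq mult.commute)
  qed
  then have le: "\<tau> \<le> \<alpha> * ?N \<tau> / n"
    unfolding \<tau>_def by (rule cSup_least[OF passing_nonempty])
  then have "\<tau> / \<alpha> \<le> ?N \<tau> / n"
    using assms(1) by (simp add: divide_le_eq mult.commute)
  then show pass: "\<tau> \<in> passing \<alpha> n s"
    using \<tau>01 by (simp add: passing_def)
  define m where "m = max (card {j. j < n \<and> s j \<le> \<tau>}) 1"
  have m: "m \<in> {1..n}"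
    using card_mono[of "{..<n}" "{j. j < n \<and> s j \<le> \<tau>}"] assms by (auto simp: m_def)
  let ?t = "\<alpha> * m / n"
  have t01: "?t \<in> {0..1}"
  proof -
    have "\<alpha> * m \<le> 1 * real n" using m assms by (intro mult_mono) auto
    then show ?thesis using assms by simp
  qed
  have "\<tau> \<le> ?t" using le by (simp add: m_def)
  then have "real m \<le> ?N ?t" using card_below_mono[of \<tau> ?t n s] by (simp add: m_def)
  then have "real m / n \<le> ?N ?t / n" by (intro divide_right_mono) auto
  then have "?t / \<alpha> \<le> ?N ?t / n" using assms(1) by simp
  then have "?t \<in> passing \<alpha> n s" using t01 by (simp add: passing_def)
  then have "?t \<le> \<tau>" unfolding \<tau>_def by (rule cSup_upper[OF _ passing_bounded])
  with \<open>\<tau> \<le> ?t\<close> have "\<tau> = ?t" by (rule order_antisym)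
  with m show "\<exists>m\<in>{1..n}. \<tau> = \<alpha> * m / n" by blast
qed

text \<open>A description of rejection by finitely many comparisons, which makes the rejected set measurable.\<close>

lemma reject_BH_iff:
  assumes "0 < \<alpha>" "\<alpha> < 1"
  shows "i \<in> reject_BH \<alpha> n s \<longleftrightarrow> i < n \<and> (\<exists>m\<in>{1..n}. s i \<le> \<alpha> * m / n \<and>
           real m \<le> real (max (card {j. j < n \<and> s j \<le> \<alpha> * m / n}) 1))"
proof (cases "i < n")
  case True
  then have n: "0 < n" by simp
  have pass_iff: "\<alpha> * m / n \<in> passing \<alpha> n s \<longleftrightarrow>
      real m \<le> real (max (card {j. j < n \<and> s j \<le> \<alpha> * m / n}) 1)" if "m \<in> {1..n}" for m
  proof -
    have "\<alpha> * m \<le> 1 * real n" using that assms by (intro mult_mono) auto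
    then have "\<alpha> * m / n \<in> {0..1}" using assms n by simp
    moreover have "\<alpha> * m / n / \<alpha> = m / n" using assms(1) by simp
    ultimately show ?thesis using n
      unfolding passing_def by (simp add: divide_le_cancel)
  qed
  have "i \<in> reject_BH \<alpha> n s \<longleftrightarrow> s i \<le> Sup (passing \<alpha> n s)"
    using True by (simp add: reject_BH_def threshold_eq_Sup_passing)
  also have "\<dots> \<longleftrightarrow> (\<exists>m\<in>{1..n}. s i \<le> \<alpha> * m / n \<and> \<alpha> * m / n \<in> passing \<alpha> n s)"
    using threshold_in_passing[OF assms n, of s] cSup_upper[OF _ passing_bounded, of _ \<alpha> n s]
    by (metis (no_types, lifting) order_trans)
  also have "\<dots> \<longleftrightarrow> (\<exists>m\<in>{1..n}. s i \<le> \<alpha> * m / n \<and>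
      real m \<le> real (max (card {j. j < n \<and> s j \<le> \<alpha> * m / n}) 1))"
    by (intro bex_cong refl conj_cong pass_iff)
  finally show ?thesis using True by blast
qed (auto simp: reject_BH_def)

lemma reject_BH_superset:
  assumes "t \<in> {0..1}" "t / \<alpha> \<le> card {j. j < n \<and> s j \<le> t} / n"
  shows "{i. i < n \<and> s i \<le> t} \<subseteq> reject_BH \<alpha> n s"
proof -
  have "card {j. j < n \<and> s j \<le> t} / n \<le> real (max (card {j. j < n \<and> s j \<le> t}) 1) / n"
    by (intro divide_right_mono) auto
  with assms have "t \<in> passing \<alpha> n s" by (simp add: passing_def)
  then have "t \<le> Sup (passing \<alpha> n s)" by (rule cSup_upper[OF _ passing_bounded])
  then show ?thesis by (auto simp: reject_BH_def threshold_eq_Sup_passing)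
qed

lemma reject_BH_subset:
  assumes "\<And>t'. t < t' \<Longrightarrow> t' \<le> 1 \<Longrightarrow>
      real (max (card {j. j < n \<and> s j \<le> t'}) 1) / n < t' / \<alpha>"
  shows "reject_BH \<alpha> n s \<subseteq> {i. i < n \<and> s i \<le> t}"
proof -
  have "t' \<le> t" if "t' \<in> passing \<alpha> n s" for t'
    using assms[of t'] that by (force simp: passing_def)
  then have "Sup (passing \<alpha> n s) \<le> t"
    by (rule cSup_least[OF passing_nonempty])
  then show ?thesis by (auto simp: reject_BH_def threshold_eq_Sup_passing)
qed

section \<open>The law of a single observation\<close>

text \<open>Boxes generate the Borel sets, so this product formula identifies the law of independent uniform
coordinates with the uniform law on the cube.\<close>

lemma content_unit_cube_Int_box:
  fixes l u :: "real ^ 'k"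
  shows "measure lborel (unit_cube \<inter> {l..u}) = (\<Prod>k\<in>UNIV. measure lborel ({0..1} \<inter> {l $ k..u $ k}))"
proof -
  have eq: "unit_cube \<inter> {l..u} = cbox (\<chi> k. max 0 (l $ k)) (\<chi> k. min 1 (u $ k))"
    by (auto simp: cbox_interval less_eq_vec_def)
  have side: "{0..1} \<inter> {l $ k..u $ k} = {max 0 (l $ k)..min 1 (u $ k)}" for k by auto
  show ?thesis
  proof (cases "\<forall>k. max 0 (l $ k) \<le> min 1 (u $ k)")
    case True
    then have "cbox (\<chi> k. max 0 (l $ k)) (\<chi> k. min 1 (u $ k)) \<noteq> {}"
      by (subst interval_ne_empty_cart) simp
    from content_cbox_cart[OF this]
    have "measure lborel (unit_cube \<inter> {l..u}) = (\<Prod>k\<in>UNIV. min 1 (u $ k) - max 0 (l $ k))"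
      by (simp add: eq)
    also have "\<dots> = (\<Prod>k\<in>UNIV. measure lborel ({0..1} \<inter> {l $ k..u $ k}))"
      unfolding side using True by (intro prod.cong refl measure_lborel_Icc[symmetric]) blast
    finally show ?thesis .
  next
    case False
    then obtain k where k: "\<not> max 0 (l $ k) \<le> min 1 (u $ k)" by blast
    then have "cbox (\<chi> k. max 0 (l $ k)) (\<chi> k. min 1 (u $ k)) = {}"
      by (subst interval_eq_empty_cart) (auto intro!: exI[of _ k])
    moreover have "measure lborel ({0..1} \<inter> {l $ k..u $ k}) = 0"
      using k by (simp add: side)
    then have "(\<Prod>k\<in>UNIV. measure lborel ({0..1} \<inter> {l $ k..u $ k})) = 0"
      by (intro prod_zero bexI[of _ k]) auto
    ultimately show ?thesis unfolding eq by simp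
  qed
qed

lemma emeasure_unit_cube: "emeasure lborel (unit_cube :: (real ^ 'k) set) = 1"
proof -
  have "measure lborel (unit_cube :: (real ^ 'k) set) = 1"
    using content_unit_cube_Int_box[of "0 :: real ^ 'k" 1] by (simp add: cbox_interval)
  moreover have "emeasure lborel (unit_cube :: (real ^ 'k) set) \<noteq> top"
    using emeasure_lborel_cbox_finite[of "0 :: real ^ 'k" 1] by simp
  ultimately show ?thesis
    by (simp add: emeasure_eq_ennreal_measure)
qed

lemma (in prob_space) distr_uniform_cube:
  fixes X :: "'a \<Rightarrow> real ^ 'k"
  assumes X[measurable]: "X \<in> borel_measurable M"
    and indep: "indep_vars (\<lambda>_. borel) (\<lambda>k \<omega>. X \<omega> $ k) UNIV"
    and unif: "\<And>k. distr M lborel (\<lambda>\<omega>. X \<omega> $ k) = uniform_measure lborel {0..1}"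
  shows "distr M borel X = uniform_measure lborel unit_cube"
proof (rule measure_eqI_generator_eq[where \<Omega>=UNIV and E="range (\<lambda>(a, b). {a..b})"
      and A="\<lambda>n. {- real n *\<^sub>R One .. real n *\<^sub>R One}"])
  show "Int_stable (range (\<lambda>(a, b). {a..b :: real ^ 'k}))"
  proof (rule Int_stableI_image)
    fix p q :: "(real ^ 'k) \<times> (real ^ 'k)"
    show "\<exists>r\<in>UNIV. (case p of (a, b) \<Rightarrow> {a..b}) \<inter> (case q of (a, b) \<Rightarrow> {a..b}) = (case r of (a, b) \<Rightarrow> {a..b})"
      by (cases p; cases q) (simp, metis Int_interval_cart cbox_interval)
  qed
  show "sets (distr M borel X) = sigma_sets UNIV (range (\<lambda>(a, b). {a..b}))"
    using arg_cong[OF borel_eq_atLeastAtMost, of sets] by simp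
  show "sets (uniform_measure lborel unit_cube) = sigma_sets UNIV (range (\<lambda>(a, b). {a..b :: real ^ 'k}))"
    using arg_cong[OF borel_eq_atLeastAtMost, of sets] by simp
  show "(\<Union>n. {- real n *\<^sub>R One .. real n *\<^sub>R One}) = (UNIV :: (real ^ 'k) set)"
  proof -
    have "(\<Union>n. box (- (real n *\<^sub>R One)) (real n *\<^sub>R One))
        \<subseteq> (\<Union>n. cbox (- (real n *\<^sub>R One)) (real n *\<^sub>R One :: real ^ 'k))"
      by (intro UN_mono order_refl box_subset_cbox)
    then show ?thesis by (simp add: UN_box_eq_UNIV cbox_interval top_unique)
  qed
  show "emeasure (distr M borel X) {- real n *\<^sub>R One .. real n *\<^sub>R One} \<noteq> \<infinity>" for n
    by (simp add: emeasure_distr)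
  fix B :: "(real ^ 'k) set" assume "B \<in> range (\<lambda>(a, b). {a..b})"
  then obtain l u where B: "B = {l..u}" by auto
  have [measurable]: "(\<lambda>\<omega>. X \<omega> $ k) \<in> borel_measurable M" for k
    using indep by (auto simp: indep_vars_def)
  have one: "prob ((\<lambda>\<omega>. X \<omega> $ k) -` {l $ k..u $ k} \<inter> space M)
      = measure lborel ({0..1} \<inter> {l $ k..u $ k})" for k
  proof -
    have "prob ((\<lambda>\<omega>. X \<omega> $ k) -` {l $ k..u $ k} \<inter> space M)
        = measure (distr M lborel (\<lambda>\<omega>. X \<omega> $ k)) {l $ k..u $ k}"
      by (subst measure_distr) auto
    then show ?thesis by (simp add: unif)
  qed
  have "emeasure (distr M borel X) B = prob (X -` {l..u} \<inter> space M)"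
    by (simp add: B emeasure_distr emeasure_eq_measure)
  also have "X -` {l..u} \<inter> space M = (\<Inter>k. (\<lambda>\<omega>. X \<omega> $ k) -` {l $ k..u $ k} \<inter> space M)"
    by (auto simp: less_eq_vec_def)
  also have "prob \<dots> = (\<Prod>k\<in>UNIV. measure lborel ({0..1} \<inter> {l $ k..u $ k}))"
    by (subst indep_varsD_finite[OF indep]) (auto simp: one)
  also have "\<dots> = measure lborel (unit_cube \<inter> B)"
    by (simp add: content_unit_cube_Int_box B)
  also have "ennreal \<dots> = emeasure lborel (unit_cube \<inter> B)"
  proof (rule emeasure_eq_ennreal_measure[symmetric])
    have "emeasure lborel (unit_cube \<inter> B) \<le> emeasure lborel (unit_cube :: (real ^ 'k) set)"
      by (rule emeasure_mono) auto
    then show "emeasure lborel (unit_cube \<inter> B) \<noteq> top"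
      by (auto simp: emeasure_unit_cube top_unique)
  qed
  also have "\<dots> = emeasure (uniform_measure lborel unit_cube) B"
    by (simp add: B emeasure_unit_cube divide_ennreal_def)
  finally show "emeasure (distr M borel X) B = emeasure (uniform_measure lborel unit_cube) B" .
qed auto

context random_effects
begin

lemma pair_measurable: "(\<lambda>\<omega>. (\<theta> i \<omega>, \<xi> i \<omega>)) \<in> M \<rightarrow>\<^sub>M count_space UNIV \<Otimes>\<^sub>M borel"
  using indep_pairs by (auto simp: indep_vars_def)

lemma \<theta>_measurable[measurable]: "\<theta> i \<in> M \<rightarrow>\<^sub>M count_space UNIV"
  using measurable_compose[OF pair_measurable measurable_fst, of i] by simp

lemma \<xi>_measurable[measurable]: "\<xi> i \<in> M \<rightarrow>\<^sub>M borel"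
  using measurable_compose[OF pair_measurable measurable_snd, of i] by simp

lemma prob_true_null: "prob {\<omega> \<in> space M. \<not> \<theta> i \<omega>} = 1 - a"
  using prob_neg[of "\<theta> i"] prob_false[of i] by simp

lemma prob_null_region:
  assumes "A \<in> sets borel" "A \<subseteq> unit_cube"
  shows "prob {\<omega> \<in> space M. \<not> \<theta> i \<omega> \<and> \<xi> i \<omega> \<in> A} = (1 - a) * measure lborel A"
proof -
  let ?T = "{\<omega> \<in> space M. \<not> \<theta> i \<omega>}"
  let ?N = "uniform_measure M ?T"
  note assms(1)[measurable]
  have T: "emeasure M ?T \<noteq> 0" "emeasure M ?T \<noteq> \<infinity>"
    using prob_true_null[of i] a_range by (auto simp: emeasure_eq_measure)
  interpret N: prob_space ?N by (rule prob_space_uniform_measure[OF T])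
  have "distr ?N borel (\<xi> i) = uniform_measure lborel unit_cube"
    by (rule N.distr_uniform_cube[OF _ null_indep null_unif]) simp
  then have "measure (distr ?N borel (\<xi> i)) A = measure (uniform_measure lborel unit_cube) A"
    by simp
  also have "\<dots> = measure lborel A"
    using assms by (subst measure_uniform_measure)
      (auto simp: emeasure_unit_cube measure_def Int_absorb1)
  also have "measure (distr ?N borel (\<xi> i)) A = prob (?T \<inter> (\<xi> i -` A \<inter> space M)) / prob ?T"
    using T by (subst measure_distr) (auto simp del: measure_uniform_measure intro!: measure_uniform_measure)
  also have "?T \<inter> (\<xi> i -` A \<inter> space M) = {\<omega> \<in> space M. \<not> \<theta> i \<omega> \<and> \<xi> i \<omega> \<in> A}" by auto
  finally show ?thesis
    using a_range by (simp add: prob_true_null field_simps)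
qed

lemma prob_alt_region:
  assumes "A \<in> sets borel" "A \<subseteq> unit_cube"
    and "\<And>x. x \<in> unit_cube \<Longrightarrow> 0 \<le> g x" "set_integrable lborel A g"
  shows "prob {\<omega> \<in> space M. \<theta> i \<omega> \<and> \<xi> i \<omega> \<in> A} = a * (LINT x:A|lborel. g x)"
proof -
  let ?T = "{\<omega> \<in> space M. \<theta> i \<omega>}"
  let ?N = "uniform_measure M ?T"
  note assms(1)[measurable]
  have T: "emeasure M ?T \<noteq> 0" "emeasure M ?T \<noteq> \<infinity>"
    using prob_false[of i] a_range by (auto simp: emeasure_eq_measure)
  have "emeasure ?N (\<xi> i -` A \<inter> space ?N)
      = (\<integral>\<^sup>+x. ennreal (g x) * indicator unit_cube x * indicator A x \<partial>lborel)"
    using assms(1) by (intro distributed_emeasure[OF alt_density]) simp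
  also have "\<dots> = (\<integral>\<^sup>+x. ennreal (indicator A x *\<^sub>R g x) \<partial>lborel)"
    using assms(2) by (intro nn_integral_cong) (auto simp: indicator_def)
  also have "\<dots> = ennreal (LINT x:A|lborel. g x)"
    unfolding set_lebesgue_integral_def
    using assms by (intro nn_integral_eq_integral) (auto simp: set_integrable_def indicator_def intro!: AE_I2)
  finally have "measure ?N (\<xi> i -` A \<inter> space ?N) = (LINT x:A|lborel. g x)"
    using assms unfolding set_lebesgue_integral_def
    by (subst measure_eq_emeasure_eq_ennreal)
       (auto intro!: Bochner_Integration.integral_nonneg simp: indicator_def)
  also have "measure ?N (\<xi> i -` A \<inter> space ?N) = prob (?T \<inter> (\<xi> i -` A \<inter> space M)) / prob ?T"
    using T by (subst measure_uniform_measure) auto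
  also have "?T \<inter> (\<xi> i -` A \<inter> space M) = {\<omega> \<in> space M. \<theta> i \<omega> \<and> \<xi> i \<omega> \<in> A}" by auto
  finally show ?thesis
    using a_range by (simp add: prob_false field_simps)
qed

definition hits :: "bool \<Rightarrow> (real ^ 'k) set \<Rightarrow> nat \<Rightarrow> 'w \<Rightarrow> nat set" where
  "hits b A n \<omega> = {i. i < n \<and> \<theta> i \<omega> = b \<and> \<xi> i \<omega> \<in> A}"

lemma finite_hits[simp]: "finite (hits b A n \<omega>)"
  by (rule finite_subset[of _ "{..<n}"]) (auto simp: hits_def)

text \<open>The weak law of large numbers for the indicators, from Hoeffding's inequality.\<close>

lemma hits_frequency_tendsto:
  assumes A: "A \<in> sets borel"
    and p: "\<And>i. prob {\<omega> \<in> space M. \<theta> i \<omega> = b \<and> \<xi> i \<omega> \<in> A} = p"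
  shows "((\<lambda>(n, \<omega>). real (card (hits b A n \<omega>)) / real n) \<longlongrightarrow> p) (whp M)"
proof (rule tendstoI)
  fix e :: real assume e: "0 < e"
  define X where "X i \<omega> = (indicator ({b} \<times> A) (\<theta> i \<omega>, \<xi> i \<omega>) :: real)" for i \<omega>
  note A[measurable]
  have "indep_vars (\<lambda>_. borel) (\<lambda>i \<omega>. indicator ({b} \<times> A) ((\<lambda>\<omega>. (\<theta> i \<omega>, \<xi> i \<omega>)) \<omega>) :: real) UNIV"
    by (rule indep_vars_compose2[OF indep_pairs]) measurable
  then have indep: "indep_vars (\<lambda>_. borel) X UNIV"
    by (simp add: X_def [abs_def])
  have X_meas[measurable]: "X i \<in> borel_measurable M" for i
    using indep by (auto simp: indep_vars_def)
  have EX: "expectation (X i) = p" for i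
  proof -
    have "expectation (X i) = expectation (indicator {\<omega> \<in> space M. \<theta> i \<omega> = b \<and> \<xi> i \<omega> \<in> A})"
      by (intro Bochner_Integration.integral_cong) (auto simp: X_def indicator_def)
    then show ?thesis by (simp add: p)
  qed
  have card: "real (card (hits b A n \<omega>)) = (\<Sum>i<n. X i \<omega>)" for n \<omega>
  proof -
    have "(\<Sum>i<n. X i \<omega>) = (\<Sum>i<n. if \<theta> i \<omega> = b \<and> \<xi> i \<omega> \<in> A then 1 else 0)"
      by (intro sum.cong) (auto simp: X_def indicator_def)
    also have "\<dots> = real (card {i \<in> {..<n}. \<theta> i \<omega> = b \<and> \<xi> i \<omega> \<in> A})"
      by (subst sum.inter_filter[symmetric]) auto
    finally show ?thesis by (simp add: hits_def)
  qed
  let ?B = "\<lambda>n. {\<omega> \<in> space M. \<bar>(\<Sum>i<n. X i \<omega>) - n * p\<bar> \<ge> n * e}"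
  have bound: "prob (?B n) \<le> 2 * exp (- 2 * e\<^sup>2 * n)" if n: "n > 0" for n
  proof -
    interpret Hoeffding_ineq M "{..<n}" X "\<lambda>_. 0" "\<lambda>_. 1" "n * p"
    proof unfold_locales
      show "indep_vars (\<lambda>_. borel) X {..<n}" by (rule indep_vars_subset[OF indep]) auto
    qed (auto simp: EX X_def indicator_def)
    have "prob (?B n) \<le> 2 * exp (- 2 * (n * e)\<^sup>2 / (\<Sum>i\<in>{..<n}. (1 - 0)\<^sup>2))"
      by (rule Hoeffding_ineq_abs_ge) (use n e in auto)
    also have "- 2 * (n * e)\<^sup>2 / (\<Sum>i\<in>{..<n}. (1 - 0)\<^sup>2) = - 2 * e\<^sup>2 * n"
      using n by (simp add: power2_eq_square)
    finally show ?thesis .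
  qed
  have lim: "(\<lambda>n. prob (?B n)) \<longlonglongrightarrow> 0"
  proof (rule tendsto_sandwich[OF _ _ tendsto_const])
    show "\<forall>\<^sub>F n in sequentially. prob (?B n) \<le> 2 * exp (- 2 * e\<^sup>2 * n)"
      using eventually_gt_at_top[of 0] by eventually_elim (rule bound)
    have "filterlim (\<lambda>n. - 2 * e\<^sup>2 * real n) at_bot sequentially"
      using e by (intro filterlim_tendsto_neg_mult_at_bot[OF tendsto_const _ filterlim_real_sequentially]) auto
    from tendsto_mult_right_zero[OF filterlim_compose[OF exp_at_bot this], of 2]
    show "(\<lambda>n. 2 * exp (- 2 * e\<^sup>2 * n)) \<longlonglongrightarrow> 0" by simp
  qed auto
  have "\<forall>\<^sub>F x in whp M. \<bar>(\<Sum>i<fst x. X i (snd x)) - fst x * p\<bar> < fst x * e"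
    unfolding eventually_whp
    by (intro exI[of _ ?B] conjI lim) auto
  moreover have "\<forall>\<^sub>F x in whp M. 0 < fst x"
    using eventually_whp_of_sequentially[OF eventually_gt_at_top[of 0]] by (simp add: split_def)
  ultimately show "\<forall>\<^sub>F x in whp M. dist (case x of (n, \<omega>) \<Rightarrow> real (card (hits b A n \<omega>)) / real n) p < e"
  proof eventually_elim
    case (elim x)
    obtain n \<omega> where x: "x = (n, \<omega>)" by fastforce
    have "\<bar>(\<Sum>i<n. X i \<omega>) / n - p\<bar> = \<bar>(\<Sum>i<n. X i \<omega>) - n * p\<bar> / n"
    proof -
      have "(\<Sum>i<n. X i \<omega>) / n - p = ((\<Sum>i<n. X i \<omega>) - n * p) / n"
        using elim by (simp add: x diff_divide_distrib)
      then show ?thesis by simp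
    qed
    also have "\<dots> < e" using elim by (simp add: x divide_less_eq mult.commute)
    finally show ?case by (simp add: x dist_real_def card)
  qed
qed

end

section \<open>Scores and their level regions\<close>

definition sublevel :: "(real ^ 'k \<Rightarrow> real) \<Rightarrow> real \<Rightarrow> (real ^ 'k) set" where
  "sublevel \<phi> v = {x \<in> unit_cube. \<phi> x \<le> v}"

definition vol :: "(real ^ 'k \<Rightarrow> real) \<Rightarrow> real \<Rightarrow> real" where
  "vol \<phi> v = measure lborel (sublevel \<phi> v)"

definition score :: "(real ^ 'k \<Rightarrow> real) \<Rightarrow> real ^ 'k \<Rightarrow> real" where
  "score \<phi> x = vol \<phi> (\<phi> x)"

definition region :: "(real ^ 'k \<Rightarrow> real) \<Rightarrow> real \<Rightarrow> (real ^ 'k) set" where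
  "region \<phi> t = {x \<in> unit_cube. score \<phi> x \<le> t}"

lemma sublevel_subset_cube: "sublevel \<phi> v \<subseteq> unit_cube"
  by (auto simp: sublevel_def)

lemma sublevel_mono: "v \<le> w \<Longrightarrow> sublevel \<phi> v \<subseteq> sublevel \<phi> w"
  by (auto simp: sublevel_def)

lemma region_subset_cube: "region \<phi> t \<subseteq> unit_cube"
  by (auto simp: region_def)

lemma region_mono: "s \<le> t \<Longrightarrow> region \<phi> s \<subseteq> region \<phi> t"
  by (auto simp: region_def)

subsection \<open>Integrals over subsets of the cube\<close>

lemma zero_in_cube: "(0 :: real ^ 'k) \<in> unit_cube"
  by (simp add: mem_box_cart)

lemma fmeasurable_in_cube:
  fixes A :: "(real ^ 'k) set"
  assumes "A \<in> sets borel" "A \<subseteq> unit_cube"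
  shows "A \<in> fmeasurable lborel"
  by (rule fmeasurableI2[OF fmeasurable_cbox(1)[of 0 1] assms(2)]) (use assms(1) in simp)

lemma measure_mono_cube:
  fixes A :: "(real ^ 'k) set"
  assumes "A \<in> sets borel" "B \<in> sets borel" "A \<subseteq> B" "B \<subseteq> unit_cube"
  shows "measure lborel A \<le> measure lborel B"
  using assms by (intro measure_mono_fmeasurable fmeasurable_in_cube) auto

lemma measure_Diff_cube:
  fixes A :: "(real ^ 'k) set"
  assumes "A \<in> sets borel" "B \<in> sets borel" "A \<subseteq> B" "B \<subseteq> unit_cube"
  shows "measure lborel (B - A) = measure lborel B - measure lborel A"
  using assms by (intro measurable_measure_Diff fmeasurable_in_cube) auto

lemma set_integrable_const_cube:
  fixes A :: "(real ^ 'k) set"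
  assumes "A \<in> sets borel" "A \<subseteq> unit_cube"
  shows "set_integrable lborel A (\<lambda>_. c :: real)"
  using fmeasurable_in_cube[OF assms]
  by (simp add: set_integrable_def fmeasurable_def integrable_mult_left integrable_real_indicator)

context
  fixes f :: "real ^ 'k \<Rightarrow> real"
  assumes cont: "continuous_on unit_cube f"
begin

lemma set_integrable_cube:
  assumes "A \<in> sets borel" "A \<subseteq> unit_cube"
  shows "set_integrable lborel A f"
  by (rule set_integrable_subset[of _ unit_cube])
     (use assms borel_integrable_compact[OF compact_cbox cont] in \<open>auto simp: set_integrable_def\<close>)

lemma integral_le_const_cube:
  assumes "A \<in> sets borel" "A \<subseteq> unit_cube" "\<And>x. x \<in> A \<Longrightarrow> f x \<le> c"
  shows "(LINT x:A|lborel. f x) \<le> c * measure lborel A"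
proof -
  have "(LINT x:A|lborel. f x) \<le> (LINT x:A|lborel. c)"
    using assms by (intro set_integral_mono set_integrable_cube set_integrable_const_cube)
  then show ?thesis using assms fmeasurable_in_cube[OF assms(1,2)]
    by (simp add: set_lebesgue_integral_def fmeasurable_def mult.commute)
qed

lemma integral_ge_const_cube:
  assumes "A \<in> sets borel" "A \<subseteq> unit_cube" "\<And>x. x \<in> A \<Longrightarrow> c \<le> f x"
  shows "c * measure lborel A \<le> (LINT x:A|lborel. f x)"
proof -
  have "(LINT x:A|lborel. c) \<le> (LINT x:A|lborel. f x)"
    using assms by (intro set_integral_mono set_integrable_cube set_integrable_const_cube)
  then show ?thesis using assms fmeasurable_in_cube[OF assms(1,2)]
    by (simp add: set_lebesgue_integral_def fmeasurable_def mult.commute)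
qed

lemma integral_split_cube:
  assumes "A \<in> sets borel" "B \<in> sets borel" "A \<subseteq> B" "B \<subseteq> unit_cube"
  shows "(LINT x:B|lborel. f x) = (LINT x:A|lborel. f x) + (LINT x:B - A|lborel. f x)"
proof -
  have "B = A \<union> (B - A)" using assms by blast
  then show ?thesis
    using assms by (subst (1) \<open>B = A \<union> (B - A)\<close>) (intro set_integral_Un set_integrable_cube, auto)
qed

end

subsection \<open>Depth functions\<close>

text \<open>The common setting of the two procedures: $\varphi=1-g/g(0)$ and $f=\gamma'x^\varepsilon$ are both
depth functions. Continuity of the volume of sublevel sets makes the score uniformly distributed.\<close>

locale depth_function =
  fixes \<phi> :: "real ^ 'k \<Rightarrow> real" and V :: real
  assumes cont: "continuous_on unit_cube \<phi>"
    and at_zero: "\<phi> 0 = 0"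
    and pos: "\<And>x. x \<in> unit_cube \<Longrightarrow> x \<noteq> 0 \<Longrightarrow> 0 < \<phi> x"
    and bound: "\<And>x. x \<in> unit_cube \<Longrightarrow> \<phi> x \<le> V"
    and cont_vol: "continuous_on {0..V} (vol \<phi>)"
begin

lemma nonneg: "x \<in> unit_cube \<Longrightarrow> 0 \<le> \<phi> x"
  using pos[of x] at_zero by (cases "x = 0") auto

lemma sublevel_borel[measurable]: "sublevel \<phi> v \<in> sets borel"
  unfolding sublevel_def
  by (intro borel_closed continuous_on_closed_Collect_le cont continuous_on_const closed_cbox)

lemma vol_mono: "v \<le> w \<Longrightarrow> vol \<phi> v \<le> vol \<phi> w"
  unfolding vol_def by (intro measure_mono_cube sublevel_mono sublevel_subset_cube sublevel_borel)

lemma vol_0: "vol \<phi> 0 = 0"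
proof -
  have "sublevel \<phi> 0 = {0}"
    using pos at_zero zero_in_cube by (force simp: sublevel_def)
  then show ?thesis by (simp add: vol_def measure_def)
qed

lemma vol_V: "vol \<phi> V = 1"
proof -
  have "sublevel \<phi> V = unit_cube" using bound by (auto simp: sublevel_def)
  then show ?thesis by (simp add: vol_def measure_def emeasure_unit_cube)
qed

lemma V_pos: "0 < V"
  using vol_0 vol_V bound[OF zero_in_cube] at_zero by (cases "V = 0") auto

lemma vol_pos:
  assumes "0 < v"
  shows "0 < vol \<phi> v"
proof -
  have "\<exists>d>0. \<forall>x\<in>unit_cube. dist x 0 < d \<longrightarrow> dist (\<phi> x) (\<phi> 0) < v"
    using cont zero_in_cube assms unfolding continuous_on_iff by blast
  then obtain d where "0 < d" "\<forall>x\<in>unit_cube. norm x < d \<longrightarrow> \<bar>\<phi> x\<bar> < v"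
    by (simp add: at_zero dist_real_def) blast
  then have d: "0 < d" "\<And>x. x \<in> unit_cube \<Longrightarrow> norm x < d \<Longrightarrow> \<phi> x < v"
    using abs_less_iff by blast+
  define e where "e = min 1 (d / (2 * CARD('k)))"
  have e: "0 < e" "e \<le> 1" "CARD('k) * e < d"
    using d(1) by (auto simp: e_def min_def field_simps)
  let ?C = "cbox 0 (\<chi> k. e) :: (real ^ 'k) set"
  have "?C \<subseteq> sublevel \<phi> v"
  proof
    fix x :: "real ^ 'k" assume x: "x \<in> ?C"
    then have xk: "0 \<le> x $ k" "x $ k \<le> e" for k by (simp_all add: mem_box_cart)
    have "x \<in> unit_cube" using xk e by (auto simp: mem_box_cart intro: order_trans)
    moreover have "norm x \<le> (\<Sum>k\<in>(UNIV :: 'k set). e)"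
      using norm_le_l1_cart[of x] sum_mono[of UNIV "\<lambda>k. \<bar>x $ k\<bar>" "\<lambda>_. e"] xk by simp
    then have "norm x < d" using e by simp
    ultimately show "x \<in> sublevel \<phi> v" using d(2) by (auto simp: sublevel_def less_imp_le)
  qed
  then have "measure lborel ?C \<le> vol \<phi> v"
    unfolding vol_def by (intro measure_mono_cube sublevel_subset_cube) auto
  moreover have "?C \<noteq> {}" using e by (subst interval_ne_empty_cart) auto
  then have "measure lborel ?C = e ^ CARD('k)"
    by (simp add: content_cbox_cart)
  ultimately show ?thesis using e by (metis less_le_trans zero_less_power)
qed

text \<open>The volume of sublevel sets may be constant on an interval. The largest $v$ of volume at most $t$ is
the one whose sublevel set consists of the points of score at most $t$.\<close>

lemma region_is_sublevel:
  assumes t: "0 \<le> t" "t \<le> 1"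
  shows "\<exists>v. 0 \<le> v \<and> v \<le> V \<and> vol \<phi> v = t \<and> region \<phi> t = sublevel \<phi> v"
proof -
  \<comment> \<open>The bound \<open>V\<close> keeps \<open>S\<close> bounded when $t=1$.\<close>
  define S where "S = {v \<in> {0..V}. vol \<phi> v \<le> t}"
  have S0: "0 \<in> S" using V_pos vol_0 t by (simp add: S_def)
  have bdd: "bdd_above S" by (rule bdd_aboveI[of _ V]) (simp add: S_def)
  have "closed S" unfolding S_def
    by (intro continuous_on_closed_Collect_le cont_vol continuous_on_const) simp
  then have Sup: "Sup S \<in> S" using S0 bdd by (intro closed_contains_Sup) auto
  have "\<exists>w\<ge>0. w \<le> V \<and> vol \<phi> w = t"
    using t V_pos vol_0 vol_V by (intro IVT' cont_vol) auto
  then obtain w where w: "0 \<le> w" "w \<le> V" "vol \<phi> w = t" by blast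
  then have "w \<in> S" by (simp add: S_def)
  then have "w \<le> Sup S" using bdd by (rule cSup_upper)
  from vol_mono[OF this] w Sup have vol: "vol \<phi> (Sup S) = t" by (simp add: S_def)
  have "score \<phi> x \<le> t \<longleftrightarrow> \<phi> x \<le> Sup S" if "x \<in> unit_cube" for x
  proof
    assume "score \<phi> x \<le> t"
    then have "\<phi> x \<in> S" using that nonneg bound by (simp add: S_def score_def)
    then show "\<phi> x \<le> Sup S" using bdd by (rule cSup_upper)
  next
    assume "\<phi> x \<le> Sup S"
    then show "score \<phi> x \<le> t" using vol_mono vol by (auto simp: score_def)
  qed
  then have "region \<phi> t = sublevel \<phi> (Sup S)" by (auto simp: region_def sublevel_def)
  with vol Sup show ?thesis by (auto simp: S_def)
qed

lemma region_borel[measurable]: "0 \<le> t \<Longrightarrow> t \<le> 1 \<Longrightarrow> region \<phi> t \<in> sets borel"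
  by (metis region_is_sublevel sublevel_borel)

lemma measure_region: "0 \<le> t \<Longrightarrow> t \<le> 1 \<Longrightarrow> measure lborel (region \<phi> t) = t"
  by (metis region_is_sublevel vol_def)

lemma measure_region_Diff:
  "0 \<le> s \<Longrightarrow> s \<le> t \<Longrightarrow> t \<le> 1 \<Longrightarrow> measure lborel (region \<phi> t - region \<phi> s) = t - s"
  by (subst measure_Diff_cube) (auto simp: measure_region region_mono region_subset_cube)

lemma region_subset_sublevel:
  assumes "0 \<le> t" "t \<le> 1" "t < vol \<phi> v"
  shows "region \<phi> t \<subseteq> sublevel \<phi> v"
proof -
  obtain w where w: "vol \<phi> w = t" "region \<phi> t = sublevel \<phi> w"
    using region_is_sublevel assms by blast
  then have "w \<le> v" using vol_mono[of v w] assms by fastforce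
  then show ?thesis by (simp add: w sublevel_mono)
qed

lemma integral_region_Lipschitz:
  assumes "0 \<le> s" "s \<le> t" "t \<le> 1" and f: "continuous_on unit_cube f"
    and "\<And>x. x \<in> unit_cube \<Longrightarrow> 0 \<le> f x" "\<And>x. x \<in> unit_cube \<Longrightarrow> f x \<le> c"
  shows "(LINT x:region \<phi> s|lborel. f x) \<le> (LINT x:region \<phi> t|lborel. f x)"
    and "(LINT x:region \<phi> t|lborel. f x) \<le> (LINT x:region \<phi> s|lborel. f x) + c * (t - s)"
proof -
  have D: "region \<phi> t - region \<phi> s \<in> sets borel" "region \<phi> t - region \<phi> s \<subseteq> unit_cube"
    using assms(1-3) region_subset_cube[of \<phi> t] by (intro sets.Diff region_borel; linarith | blast)+
  have le: "0 * measure lborel (region \<phi> t - region \<phi> s) \<le> (LINT x:region \<phi> t - region \<phi> s|lborel. f x)"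
    using D(2) by (intro integral_ge_const_cube[OF f D] assms(5)) blast
  have ge: "(LINT x:region \<phi> t - region \<phi> s|lborel. f x) \<le> c * measure lborel (region \<phi> t - region \<phi> s)"
    using D(2) by (intro integral_le_const_cube[OF f D] assms(6)) blast
  have split: "(LINT x:region \<phi> t|lborel. f x)
      = (LINT x:region \<phi> s|lborel. f x) + (LINT x:region \<phi> t - region \<phi> s|lborel. f x)"
    using assms(1-3) by (intro integral_split_cube[OF f] region_borel region_mono region_subset_cube) auto
  show "(LINT x:region \<phi> s|lborel. f x) \<le> (LINT x:region \<phi> t|lborel. f x)"
    using le split by simp
  show "(LINT x:region \<phi> t|lborel. f x) \<le> (LINT x:region \<phi> s|lborel. f x) + c * (t - s)"
    using ge split by (simp add: measure_region_Diff[OF assms(1-3)])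
qed

text \<open>The Neyman--Pearson argument: off the intersection, the region carries values at most $v$ and the
competitor values at least $v$, on sets of equal volume.\<close>

lemma region_minimises_integral:
  assumes t: "0 \<le> t" "t \<le> 1"
    and B: "B \<in> sets borel" "B \<subseteq> unit_cube" "measure lborel B = t"
  shows "(LINT x:region \<phi> t|lborel. \<phi> x) \<le> (LINT x:B|lborel. \<phi> x)"
proof -
  let ?A = "region \<phi> t"
  obtain v where v: "?A = sublevel \<phi> v" using region_is_sublevel t by blast
  note A = region_borel[OF t] region_subset_cube[of \<phi> t]
  have I: "?A \<inter> B \<in> sets borel" using A B by auto
  have splitA: "(LINT x:?A|lborel. \<phi> x) = (LINT x:?A \<inter> B|lborel. \<phi> x) + (LINT x:?A - ?A \<inter> B|lborel. \<phi> x)"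
    using A I by (intro integral_split_cube[OF cont]) auto
  have splitB: "(LINT x:B|lborel. \<phi> x) = (LINT x:?A \<inter> B|lborel. \<phi> x) + (LINT x:B - ?A \<inter> B|lborel. \<phi> x)"
    using B I by (intro integral_split_cube[OF cont]) auto
  have "(LINT x:?A - ?A \<inter> B|lborel. \<phi> x) \<le> v * measure lborel (?A - ?A \<inter> B)"
    using A B by (intro integral_le_const_cube[OF cont]) (auto simp: v sublevel_def)
  also have "measure lborel (?A - ?A \<inter> B) = measure lborel (B - ?A \<inter> B)"
    using A B I by (simp add: measure_Diff_cube measure_region t)
  also have "v * measure lborel (B - ?A \<inter> B) \<le> (LINT x:B - ?A \<inter> B|lborel. \<phi> x)"
    using A B by (intro integral_ge_const_cube[OF cont]) (auto simp: v sublevel_def)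
  finally show ?thesis using splitA splitB by simp
qed

end

section \<open>Weighted power sums\<close>

lemma lborel_integral_scaleR:
  fixes F :: "'a::euclidean_space \<Rightarrow> real"
  assumes [measurable]: "F \<in> borel_measurable borel" and c: "0 < c"
  shows "(LINT x|lborel. F x) = c ^ DIM('a) * (LINT x|lborel. F (c *\<^sub>R x))"
proof -
  have "(lborel :: 'a measure) = density (distr lborel borel (\<lambda>x. c *\<^sub>R x)) (\<lambda>_. ennreal (c ^ DIM('a)))"
    using lborel_affine[of c "0::'a"] c by (simp add: ennreal_power)
  then have "(LINT x|lborel. F x)
      = (LINT x|density (distr lborel borel (\<lambda>x. c *\<^sub>R x)) (\<lambda>_. ennreal (c ^ DIM('a))). F x)"
    by simp
  also have "\<dots> = (LINT x|distr lborel borel (\<lambda>x. c *\<^sub>R x). c ^ DIM('a) *\<^sub>R F x)"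
    using c by (intro integral_density) auto
  also have "\<dots> = (LINT x|lborel. c ^ DIM('a) * F (c *\<^sub>R x))"
    by (subst integral_distr) auto
  finally show ?thesis by simp
qed

locale power_sum =
  fixes \<epsilon> :: real and \<gamma> :: "real ^ 'k"
  assumes \<epsilon>_pos: "0 < \<epsilon>" and \<gamma>_pos: "\<And>k. 0 < \<gamma> $ k"
begin

definition f :: "real ^ 'k \<Rightarrow> real" where
  "f x = \<gamma> \<bullet> powr_vec \<epsilon> x"

text \<open>The degree of homogeneity of the volume of \<open>sublevel f u\<close> in $u$.\<close>

definition m :: real where
  "m = CARD('k) / \<epsilon>"

text \<open>For $u$ up to the least weight, the condition $f(x)\le u$ already forces $x_k\le1$, so the sublevel set
does not feel the upper faces of the cube and scales exactly.\<close>

definition u1 :: real where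
  "u1 = Min (range (\<lambda>k. \<gamma> $ k))"

lemma f_sum: "f x = (\<Sum>k\<in>UNIV. \<gamma> $ k * x $ k powr \<epsilon>)"
  by (simp add: f_def inner_vec_def powr_vec_def)

lemma m_pos: "0 < m"
  using \<epsilon>_pos by (simp add: m_def)

lemma u1_pos: "0 < u1"
  using \<gamma>_pos by (simp add: u1_def)

lemma u1_le: "u1 \<le> \<gamma> $ k"
  by (simp add: u1_def)

lemma f_measurable[measurable]: "f \<in> borel_measurable borel"
  unfolding f_sum[abs_def] by measurable

lemma f_cont: "continuous_on unit_cube f"
  unfolding f_sum[abs_def] using \<epsilon>_pos
  by (intro continuous_on_sum continuous_on_mult continuous_on_const continuous_on_powr'
       continuous_on_component continuous_on_id) (auto simp: mem_box_cart)

lemma f_scaleR: "f (c *\<^sub>R x) = c powr \<epsilon> * f x"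
  by (simp add: f_sum powr_mult sum_distrib_left mult_ac)

lemma f_ge_component: "\<gamma> $ k * x $ k powr \<epsilon> \<le> f x"
  unfolding f_sum by (intro member_le_sum) (auto intro!: mult_nonneg_nonneg less_imp_le[OF \<gamma>_pos])

lemma f_zero: "f 0 = 0"
  by (simp add: f_sum)

lemma f_pos: assumes "x \<in> unit_cube" "x \<noteq> 0" shows "0 < f x"
proof -
  obtain k where "x $ k \<noteq> 0" using assms(2) by (auto simp: vec_eq_iff)
  moreover have "0 \<le> x $ k" using assms(1) by (simp add: mem_box_cart)
  ultimately have "0 < \<gamma> $ k * x $ k powr \<epsilon>" using \<gamma>_pos by simp
  then show ?thesis using f_ge_component[of k x] by linarith
qed

lemma f_nonneg: "0 \<le> f x"
  unfolding f_sum using \<gamma>_pos by (intro sum_nonneg mult_nonneg_nonneg) (auto intro!: less_imp_le)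

lemma f_le: assumes "x \<in> unit_cube" shows "f x \<le> (\<Sum>k\<in>UNIV. \<gamma> $ k)"
  unfolding f_sum
proof (rule sum_mono)
  fix k
  have "x $ k powr \<epsilon> \<le> 1" using assms \<epsilon>_pos by (intro powr_le1) (auto simp: mem_box_cart)
  then show "\<gamma> $ k * x $ k powr \<epsilon> \<le> \<gamma> $ k"
    using \<gamma>_pos[of k] by (simp add: mult_left_le)
qed

lemma sublevel_f_borel[measurable]: "sublevel f v \<in> sets borel"
  unfolding sublevel_def
  by (intro borel_closed continuous_on_closed_Collect_le f_cont continuous_on_const closed_cbox)

lemma vol_f_mono: "v \<le> w \<Longrightarrow> vol f v \<le> vol f w"
  unfolding vol_def by (intro measure_mono_cube sublevel_mono sublevel_subset_cube sublevel_f_borel)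

text \<open>Multiplying $f$ by $l$ amounts to multiplying $x$ by $l^{1/\varepsilon}$. Contracting never leaves the
cube; expanding stays inside as long as the target level is at most $u_1$.\<close>

lemma dilation:
  assumes l: "1 \<le> l"
  defines "c \<equiv> l powr (1 / \<epsilon>)"
  shows "1 \<le> c" "f (c *\<^sub>R x) = l * f x" "c ^ CARD('k) = l powr m"
    and "c *\<^sub>R x \<in> sublevel f (l * u) \<Longrightarrow> x \<in> sublevel f u"
    and "l * u \<le> u1 \<Longrightarrow> x \<in> sublevel f u \<Longrightarrow> c *\<^sub>R x \<in> sublevel f (l * u)"
proof -
  show c: "1 \<le> c" unfolding c_def using l \<epsilon>_pos by (intro ge_one_powr_ge_zero) auto
  have ce: "c powr \<epsilon> = l" using l \<epsilon>_pos by (simp add: c_def powr_powr)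
  then show fc: "f (c *\<^sub>R x) = l * f x" for x by (simp add: f_scaleR)
  show "c ^ CARD('k) = l powr m"
    using l by (simp add: c_def m_def powr_power)
  show "x \<in> sublevel f u" if "c *\<^sub>R x \<in> sublevel f (l * u)"
  proof -
    have "x \<in> unit_cube"
      unfolding mem_box_cart
    proof
      fix k
      have "0 \<le> c * x $ k" "c * x $ k \<le> 1"
        using that by (auto simp: sublevel_def mem_box_cart)
      moreover from this have "0 \<le> x $ k" using c by (simp add: zero_le_mult_iff)
      moreover from this have "x $ k \<le> c * x $ k" using c by (simp add: mult_le_cancel_right1)
      ultimately show "0 $ k \<le> x $ k \<and> x $ k \<le> 1 $ k" by simp
    qed
    moreover have "f x \<le> u" using that l by (simp add: sublevel_def fc)
    ultimately show ?thesis by (simp add: sublevel_def)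
  qed
  show "c *\<^sub>R x \<in> sublevel f (l * u)" if "l * u \<le> u1" "x \<in> sublevel f u"
  proof -
    have le: "f (c *\<^sub>R x) \<le> l * u" using that l by (simp add: sublevel_def fc)
    have "c *\<^sub>R x \<in> unit_cube"
      unfolding mem_box_cart
    proof
      fix k
      have x: "0 \<le> x $ k" using that by (simp add: sublevel_def mem_box_cart)
      have "\<gamma> $ k * (c * x $ k) powr \<epsilon> \<le> \<gamma> $ k"
        using f_ge_component[of k "c *\<^sub>R x"] le that u1_le[of k] by simp
      then have "(c * x $ k) powr \<epsilon> \<le> 1 powr \<epsilon>" using \<gamma>_pos[of k] by simp
      then have "c * x $ k \<le> 1"
        using powr_less_mono2[OF \<epsilon>_pos zero_le_one, of "c * x $ k"] by linarith
      then show "0 $ k \<le> (c *\<^sub>R x) $ k \<and> (c *\<^sub>R x) $ k \<le> 1 $ k"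
        using x c by simp
    qed
    with le show ?thesis by (simp add: sublevel_def)
  qed
qed

lemma vol_f_dilate_le:
  assumes l: "1 \<le> l"
  shows "vol f (l * u) \<le> l powr m * vol f u"
proof -
  define c where "c = l powr (1 / \<epsilon>)"
  note d = dilation[OF l, folded c_def]
  let ?P = "{x. c *\<^sub>R x \<in> sublevel f (l * u)}"
  have P: "?P \<in> sets borel"
    by measurable
  have "vol f (l * u) = (LINT x|lborel. indicator (sublevel f (l * u)) x)"
    by (simp add: vol_def)
  also have "\<dots> = l powr m * (LINT x|lborel. indicator (sublevel f (l * u)) (c *\<^sub>R x))"
    using d by (subst lborel_integral_scaleR[of _ c]) auto
  also have "(\<lambda>x. indicator (sublevel f (l * u)) (c *\<^sub>R x) :: real) = indicator ?P"
    by (auto simp: indicator_def)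
  also have "(LINT x|lborel. indicator ?P x) = measure lborel ?P" by simp
  also have "l powr m * measure lborel ?P \<le> l powr m * vol f u"
    unfolding vol_def using P d(4)
    by (intro mult_left_mono measure_mono_cube sublevel_subset_cube) auto
  finally show ?thesis .
qed

lemma vol_f_dilate:
  assumes l: "1 \<le> l" "l * u \<le> u1"
  shows "vol f (l * u) = l powr m * vol f u"
proof -
  define c where "c = l powr (1 / \<epsilon>)"
  note d = dilation[OF l(1), folded c_def]
  have "vol f (l * u) = (LINT x|lborel. indicator (sublevel f (l * u)) x)"
    by (simp add: vol_def)
  also have "\<dots> = l powr m * (LINT x|lborel. indicator (sublevel f (l * u)) (c *\<^sub>R x))"
    using d by (subst lborel_integral_scaleR[of _ c]) auto
  also have "(\<lambda>x. indicator (sublevel f (l * u)) (c *\<^sub>R x) :: real) = indicator (sublevel f u)"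
    using d(4) d(5)[OF l(2)] by (intro ext) (auto simp: indicator_def)
  finally show ?thesis by (simp add: vol_def)
qed

lemma integral_f_dilate:
  assumes l: "1 \<le> l" "l * u \<le> u1"
  shows "(LINT x:sublevel f (l * u)|lborel. f x) = l * l powr m * (LINT x:sublevel f u|lborel. f x)"
proof -
  define c where "c = l powr (1 / \<epsilon>)"
  note d = dilation[OF l(1), folded c_def]
  have "(LINT x:sublevel f (l * u)|lborel. f x)
      = l powr m * (LINT x|lborel. indicator (sublevel f (l * u)) (c *\<^sub>R x) * f (c *\<^sub>R x))"
    unfolding set_lebesgue_integral_def
    using d by (subst lborel_integral_scaleR[of _ c]) auto
  also have "(\<lambda>x. indicator (sublevel f (l * u)) (c *\<^sub>R x) * f (c *\<^sub>R x))
      = (\<lambda>x. l * (indicator (sublevel f u) x * f x))"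
    using d(2,4) d(5)[OF l(2)] by (auto simp: indicator_def fun_eq_iff)
  finally show ?thesis by (simp add: set_lebesgue_integral_def)
qed

text \<open>For $w\ge u$ the volume at $w$ lies between that at $u$ and $(w/u)^m$ times it, and symmetrically for
$w\le u$. This gives continuity of the volume without showing that level sets of $f$ are null sets.\<close>

lemma vol_f_tendsto:
  assumes u: "0 < u"
  shows "(vol f \<longlongrightarrow> vol f u) (at u within S)"
proof (rule tendsto_sandwich)
  let ?q = "\<lambda>w. (w / u) powr m"
  have q: "(?q \<longlongrightarrow> 1) (at u within S)"
    using u by (auto intro!: tendsto_eq_intros)
  show "((\<lambda>w. vol f u * min 1 (?q w)) \<longlongrightarrow> vol f u) (at u within S)"
    using tendsto_mult[OF tendsto_const[of "vol f u"] tendsto_min[OF tendsto_const[of 1] q]] by simp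
  show "((\<lambda>w. vol f u * max 1 (?q w)) \<longlongrightarrow> vol f u) (at u within S)"
    using tendsto_mult[OF tendsto_const[of "vol f u"] tendsto_max[OF tendsto_const[of 1] q]] by simp
  have ev: "\<forall>\<^sub>F w in at u within S. 0 < w"
    using order_tendstoD(1)[OF tendsto_ident_at u] .
  have v0: "0 \<le> vol f u" by (simp add: vol_def)
  have bounds: "vol f u * min 1 (?q w) \<le> vol f w \<and> vol f w \<le> vol f u * max 1 (?q w)" if w: "0 < w" for w
  proof (cases "u \<le> w")
    case True
    then have q1: "1 \<le> ?q w" using u m_pos by (intro ge_one_powr_ge_zero) auto
    have "vol f w \<le> ?q w * vol f u"
      using vol_f_dilate_le[of "w / u" u] True u by simp
    then show ?thesis using vol_f_mono[OF True] q1 by (simp add: mult.commute)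
  next
    case False
    then have q1: "?q w \<le> 1" using u w m_pos by (intro powr_le1) auto
    have "vol f u \<le> (u / w) powr m * vol f w"
      using vol_f_dilate_le[of "u / w" w] False w by simp
    then have "?q w * vol f u \<le> ?q w * ((u / w) powr m * vol f w)"
      by (intro mult_left_mono) auto
    also have "?q w * (u / w) powr m = 1"
      using u w by (simp flip: powr_mult)
    then have "?q w * ((u / w) powr m * vol f w) = vol f w"
      by (metis mult.assoc mult_1)
    finally show ?thesis using vol_f_mono[of w u] False q1 v0 by (simp add: mult.commute)
  qed
  show "\<forall>\<^sub>F w in at u within S. vol f u * min 1 (?q w) \<le> vol f w"
    using ev by eventually_elim (use bounds in blast)
  show "\<forall>\<^sub>F w in at u within S. vol f w \<le> vol f u * max 1 (?q w)"
    using ev by eventually_elim (use bounds in blast)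
qed

lemma vol_f_power_law:
  assumes "0 < u" "u \<le> u1"
  shows "vol f u = (u / u1) powr m * vol f u1"
proof -
  have "vol f u1 = (u1 / u) powr m * vol f u"
    using vol_f_dilate[of "u1 / u" u] assms by simp
  moreover have "(u / u1) powr m * (u1 / u) powr m = 1"
    using assms u1_pos by (simp flip: powr_mult)
  ultimately show ?thesis by (metis mult.assoc mult_1)
qed

lemma vol_f_tendsto_0: "(vol f \<longlongrightarrow> 0) (at_right 0)"
proof (rule tendsto_sandwich[OF _ _ tendsto_const])
  have "((\<lambda>w. (w / u1) powr m) \<longlongrightarrow> 0) (at_right 0)"
    using m_pos u1_pos
    by (intro tendsto_zero_powrI[where b=m]) (auto intro!: tendsto_eq_intros simp: eventually_at_filter)
  from tendsto_mult_left_zero[OF this, of "vol f u1"]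
  show "((\<lambda>w. (w / u1) powr m * vol f u1) \<longlongrightarrow> 0) (at_right 0)" .
  have "\<forall>\<^sub>F w in at_right 0. w < u1"
    using order_tendstoD(2)[OF tendsto_ident_at u1_pos] .
  moreover have "\<forall>\<^sub>F w in at_right (0::real). 0 < w"
    by (auto simp: eventually_at_filter)
  ultimately show "\<forall>\<^sub>F w in at_right 0. vol f w \<le> (w / u1) powr m * vol f u1"
    by eventually_elim (rule eq_refl, rule vol_f_power_law, simp_all)
qed (simp add: vol_def)

sublocale depth: depth_function f "\<Sum>k\<in>UNIV. \<gamma> $ k"
proof
  show "continuous_on {0..\<Sum>k\<in>UNIV. \<gamma> $ k} (vol f)"
    unfolding continuous_on_def
  proof
    fix u assume u: "u \<in> {0..\<Sum>k\<in>UNIV. \<gamma> $ k}"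
    show "(vol f \<longlongrightarrow> vol f u) (at u within {0..\<Sum>k\<in>UNIV. \<gamma> $ k})"
    proof (cases "u = 0")
      case True
      have "vol f 0 \<le> 0"
        by (rule tendsto_lowerbound[OF vol_f_tendsto_0])
           (auto simp: eventually_at_filter intro!: always_eventually vol_f_mono)
      then have "vol f 0 = 0" by (simp add: vol_def measure_le_0_iff)
      then show ?thesis
        using vol_f_tendsto_0 True sum_pos[of UNIV "\<lambda>k. \<gamma> $ k"] \<gamma>_pos
        by (simp add: at_within_Icc_at_right)
    qed (use u vol_f_tendsto in auto)
  qed
qed (simp_all add: f_cont f_zero f_pos f_le)

text \<open>The ratio of the mean of $f$ over \<open>sublevel f u\<close> to the largest value $u$, which by dilation does not
depend on $u\le u_1$.\<close>

definition \<kappa> :: real where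
  "\<kappa> = (LINT x:sublevel f u1|lborel. f x) / (u1 * vol f u1)"

lemma integral_f_proportional:
  assumes "0 < u" "u \<le> u1"
  shows "(LINT x:sublevel f u|lborel. f x) = \<kappa> * u * vol f u"
proof -
  let ?I = "\<lambda>u. (LINT x:sublevel f u|lborel. f x)"
  let ?l = "u1 / u"
  have I: "?I u1 = ?l * ?l powr m * ?I u"
    using integral_f_dilate[of ?l u] assms by simp
  have v: "vol f u1 = ?l powr m * vol f u"
    using vol_f_dilate[of ?l u] assms by simp
  have pos: "0 < vol f u" "0 < ?l powr m"
    using depth.vol_pos assms u1_pos by auto
  show ?thesis
    unfolding \<kappa>_def I v using pos assms u1_pos by (simp add: field_simps)
qed

text \<open>The mean lies strictly between $0$ and the maximum, since both halves $f\le u_1/2$ and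
$u_1/2<f\le u_1$ have positive volume.\<close>

lemma \<kappa>_bounds: "0 < \<kappa>" "\<kappa> < 1"
proof -
  let ?I = "\<lambda>A. (LINT x:A|lborel. f x)"
  let ?A = "sublevel f (u1 / 2)" and ?B = "sublevel f u1"
  have AB: "?A \<subseteq> ?B" using u1_pos by (intro sublevel_mono) simp
  have D: "?B - ?A \<in> sets borel" "?B - ?A \<subseteq> unit_cube"
    using sublevel_subset_cube[of f u1] by auto
  have split: "?I ?B = ?I ?A + ?I (?B - ?A)"
    by (intro integral_split_cube[OF f_cont] AB sublevel_subset_cube) auto
  have mD: "measure lborel (?B - ?A) = vol f u1 - vol f (u1 / 2)"
    unfolding vol_def by (intro measure_Diff_cube AB sublevel_subset_cube) auto
  have v2: "0 < vol f (u1 / 2)" "0 < vol f u1" using depth.vol_pos u1_pos by auto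
  have lt: "vol f (u1 / 2) < vol f u1"
  proof -
    have "(1 / 2 :: real) powr m < 1 powr m" using m_pos by (intro powr_less_mono2) auto
    then show ?thesis using vol_f_power_law[of "u1 / 2"] u1_pos v2 by simp
  qed
  have "0 * measure lborel ?A \<le> ?I ?A"
    by (intro integral_ge_const_cube[OF f_cont] f_nonneg sublevel_subset_cube) auto
  moreover have "u1 / 2 * measure lborel (?B - ?A) \<le> ?I (?B - ?A)"
    by (intro integral_ge_const_cube[OF f_cont] D) (auto simp: sublevel_def)
  moreover have "0 < u1 / 2 * measure lborel (?B - ?A)" using u1_pos lt by (simp add: mD)
  ultimately have "0 < ?I ?B" unfolding split by linarith
  then show "0 < \<kappa>" using u1_pos v2 by (simp add: \<kappa>_def)
  have "?I ?A \<le> u1 / 2 * vol f (u1 / 2)"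
    unfolding vol_def by (intro integral_le_const_cube[OF f_cont] sublevel_subset_cube) (auto simp: sublevel_def)
  moreover have "?I (?B - ?A) \<le> u1 * measure lborel (?B - ?A)"
    by (intro integral_le_const_cube[OF f_cont] D) (auto simp: sublevel_def)
  moreover have "u1 / 2 * vol f (u1 / 2) + u1 * (vol f u1 - vol f (u1 / 2)) < u1 * vol f u1"
    using v2 u1_pos by (simp add: field_simps)
  ultimately have "?I ?B < u1 * vol f u1" unfolding split mD by linarith
  then show "\<kappa> < 1" using u1_pos v2 by (simp add: \<kappa>_def)
qed

text \<open>Converts the remainder $o(|x|^\varepsilon)$ into $o(f(x))$.\<close>

lemma norm_powr_le_f:
  assumes "x \<in> unit_cube"
  shows "norm x powr \<epsilon> \<le> CARD('k) powr \<epsilon> / u1 * f x"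
proof -
  have "Max (range (\<lambda>j. x $ j)) \<in> range (\<lambda>j. x $ j)" by (intro Max_in) auto
  then obtain k where "Max (range (\<lambda>j. x $ j)) = x $ k" by blast
  then have k: "x $ j \<le> x $ k" for j
    using Max_ge[of "range (\<lambda>j. x $ j)" "x $ j"] by simp
  have x: "0 \<le> x $ j" for j using assms by (simp add: mem_box_cart)
  have "norm x \<le> (\<Sum>j\<in>UNIV. \<bar>x $ j\<bar>)" by (rule norm_le_l1_cart)
  also have "\<dots> \<le> (\<Sum>j\<in>(UNIV :: 'k set). x $ k)" using k x by (intro sum_mono) simp
  finally have "norm x \<le> CARD('k) * x $ k" by simp
  then have "norm x powr \<epsilon> \<le> CARD('k) powr \<epsilon> * x $ k powr \<epsilon>"
    using \<epsilon>_pos by (subst powr_mult[symmetric]) (intro powr_mono2, auto)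
  also have "x $ k powr \<epsilon> \<le> f x / u1"
  proof -
    have "u1 * x $ k powr \<epsilon> \<le> \<gamma> $ k * x $ k powr \<epsilon>" using u1_le by (intro mult_right_mono) auto
    also have "\<dots> \<le> f x" by (rule f_ge_component)
    finally show ?thesis using u1_pos by (simp add: field_simps)
  qed
  finally show ?thesis by (simp add: mult_left_mono)
qed

lemma vol_f_strict_mono:
  assumes "0 \<le> v" "v < w" "w \<le> u1"
  shows "vol f v < vol f w"
proof (cases "v = 0")
  case False
  have "(v / u1) powr m < (w / u1) powr m"
    using assms m_pos u1_pos by (intro powr_less_mono2 divide_strict_right_mono) auto
  then show ?thesis
    using vol_f_power_law[of v] vol_f_power_law[of w] depth.vol_pos[OF u1_pos] assms False by simp
qed (use assms depth.vol_pos depth.vol_0 in simp)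

text \<open>The dilation bound read downwards; it measures how much volume is lost when the level is reduced by a
factor $q$.\<close>

lemma vol_f_shrink:
  assumes "0 < q" "q \<le> 1"
  shows "q powr m * vol f u \<le> vol f (q * u)"
proof -
  have "vol f u \<le> (1 / q) powr m * vol f (q * u)"
    using vol_f_dilate_le[of "1 / q" "q * u"] assms by simp
  then have "q powr m * vol f u \<le> q powr m * ((1 / q) powr m * vol f (q * u))"
    by (intro mult_left_mono) auto
  also have "\<dots> = (q powr m * (1 / q) powr m) * vol f (q * u)" by (simp add: mult.assoc)
  also have "q powr m * (1 / q) powr m = 1" using assms by (simp flip: powr_mult)
  finally show ?thesis by simp
qed

lemma region_f_small:
  assumes "0 < t" "t < vol f u0" "t \<le> 1"
  shows "\<exists>u. 0 < u \<and> u < u0 \<and> vol f u = t \<and> region f t = sublevel f u"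
proof -
  obtain u where u: "0 \<le> u" "vol f u = t" "region f t = sublevel f u"
    using depth.region_is_sublevel[of t] assms by auto
  have "u \<noteq> 0" using u assms depth.vol_0 by auto
  moreover have "u < u0" using vol_f_mono[of u0 u] u assms by (cases "u < u0") auto
  ultimately show ?thesis using u by (intro exI[of _ u]) auto
qed

end

section \<open>Densities with a power-type peak at the origin\<close>

locale peaked_density =
  fixes g :: "real ^ 'k \<Rightarrow> real" and \<epsilon> :: real and \<gamma> :: "real ^ 'k"
  assumes standing: "standing_assumptions g \<epsilon> \<gamma>"
begin

sublocale power_sum \<epsilon> \<gamma>
  using standing by unfold_locales (auto simp: standing_assumptions_def)

lemma g_nonneg: "x \<in> unit_cube \<Longrightarrow> 0 \<le> g x"
  and g_cont: "continuous_on unit_cube g"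
  and g_less: "x \<in> unit_cube \<Longrightarrow> x \<noteq> 0 \<Longrightarrow> g x < g 0"
  and g_integral: "(g has_integral 1) unit_cube"
  and upper_level_cont: "continuous_on {0..} (\<lambda>u. measure lborel (upper_level g u))"
  using standing by (auto simp: standing_assumptions_def)

lemma g0_pos: "0 < g 0"
proof -
  have "(1 :: real ^ 'k) \<in> unit_cube" by (simp add: mem_box_cart)
  moreover have "(1 :: real ^ 'k) \<noteq> 0" by (simp add: vec_eq_iff)
  ultimately show ?thesis using g_nonneg g_less by fastforce
qed

definition deficit :: "real ^ 'k \<Rightarrow> real" where
  "deficit x = 1 - g x / g 0"

lemma g_eq_deficit: "g x = g 0 * (1 - deficit x)"
  using g0_pos by (simp add: deficit_def)

lemma deficit_cont: "continuous_on unit_cube deficit"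
  unfolding deficit_def using g0_pos by (intro continuous_intros g_cont) auto

lemma sublevel_deficit: "sublevel deficit v = upper_level g (g 0 * (1 - v))"
  using g0_pos by (auto simp: sublevel_def upper_level_def deficit_def field_simps)

sublocale deficit: depth_function deficit 1
proof
  show "continuous_on {0..1} (vol deficit)"
    unfolding vol_def sublevel_deficit using g0_pos
    by (intro continuous_on_compose2[OF upper_level_cont] continuous_intros) auto
  show "0 < deficit x" if "x \<in> unit_cube" "x \<noteq> 0" for x
    using g_less[OF that] g0_pos by (simp add: deficit_def)
  show "deficit x \<le> 1" if "x \<in> unit_cube" for x
    using g_nonneg[OF that] g0_pos by (simp add: deficit_def)
  show "deficit 0 = 0" using g0_pos by (simp add: deficit_def)
qed (rule deficit_cont)

text \<open>By continuity the infimum defining $h_o^*(t)$ is attained, so $g(x)\ge h_o^*(t)$ if and only if the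
upper level set of $g$ at height $g(x)$, which is a sublevel set of the deficit, has volume at most $t$.\<close>

lemma D_o_eq_region:
  assumes t: "0 \<le> t" "t \<le> 1"
  shows "D_o g t = region deficit t"
proof -
  define U where "U = {u. 0 \<le> u \<and> measure lborel (upper_level g u) \<le> t}"
  have U_eq: "U = {u \<in> {0..}. measure lborel (upper_level g u) \<le> t}" by (auto simp: U_def)
  have "closed U" unfolding U_eq
    by (intro continuous_on_closed_Collect_le upper_level_cont continuous_on_const) simp
  moreover have "measure lborel (upper_level g (g 0)) = 0"
    using deficit.vol_0 by (simp add: vol_def sublevel_deficit)
  then have "g 0 \<in> U" using g0_pos t by (simp add: U_def)
  moreover have bdd: "bdd_below U" by (rule bdd_belowI[of _ 0]) (simp add: U_def)
  ultimately have Inf: "Inf U \<in> U" by (intro closed_contains_Inf) auto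
  have h: "h_o g t = Inf U" by (simp add: h_o_def U_def)
  have anti: "measure lborel (upper_level g w) \<le> measure lborel (upper_level g u)" if "u \<le> w" for u w
  proof -
    have "upper_level g v = sublevel deficit (1 - v / g 0)" for v
      using g0_pos by (simp add: sublevel_deficit)
    moreover have "1 - w / g 0 \<le> 1 - u / g 0"
      using that g0_pos by (simp add: divide_right_mono)
    ultimately show ?thesis using deficit.vol_mono by (simp add: vol_def)
  qed
  have score: "score deficit x = measure lborel (upper_level g (g x))" for x
    using g_eq_deficit[of x] by (simp add: score_def vol_def sublevel_deficit)
  have "h_o g t \<le> g x \<longleftrightarrow> score deficit x \<le> t" if x: "x \<in> unit_cube" for x
  proof
    assume "h_o g t \<le> g x"
    then have "score deficit x \<le> measure lborel (upper_level g (Inf U))"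
      unfolding score h by (rule anti)
    then show "score deficit x \<le> t" using Inf by (simp add: U_def)
  next
    assume "score deficit x \<le> t"
    then have "g x \<in> U" using g_nonneg[OF x] by (simp add: U_def score)
    then show "h_o g t \<le> g x" unfolding h by (rule cInf_lower[OF _ bdd])
  qed
  then show ?thesis by (auto simp: D_o_def upper_level_def region_def)
qed

lemma deficit_near_f:
  assumes "0 < \<eta>"
  shows "\<exists>u0>0. \<forall>x\<in>unit_cube. f x \<le> u0 \<longrightarrow> \<bar>deficit x - f x\<bar> \<le> \<eta> * f x"
proof -
  obtain r where r: "\<And>x. x \<in> unit_cube \<Longrightarrow> g x = g 0 * (1 - f x + r x)"
      and o: "r \<in> o[at 0 within unit_cube](\<lambda>x. norm x powr \<epsilon>)"
    using standing by (auto simp: standing_assumptions_def f_def)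
  define C where "C = CARD('k) powr \<epsilon> / u1"
  have C: "0 < C" using u1_pos by (simp add: C_def)
  have "\<forall>\<^sub>F x in at 0 within unit_cube. norm (r x) \<le> \<eta> / C * norm (norm x powr \<epsilon>)"
    using assms C by (intro landau_o.smallD[OF o]) simp
  then obtain d where d: "0 < d"
    "\<And>x. x \<in> unit_cube \<Longrightarrow> x \<noteq> 0 \<Longrightarrow> norm x < d \<Longrightarrow> \<bar>r x\<bar> \<le> \<eta> / C * norm x powr \<epsilon>"
    by (auto simp: eventually_at dist_norm)
  define u0 where "u0 = d powr \<epsilon> / C / 2"
  have u0: "0 < u0" "C * u0 < d powr \<epsilon>" using C d(1) by (simp_all add: u0_def)
  have "\<bar>deficit x - f x\<bar> \<le> \<eta> * f x" if x: "x \<in> unit_cube" and small: "f x \<le> u0" for x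
  proof (cases "x = 0")
    case False
    have le: "norm x powr \<epsilon> \<le> C * f x" using norm_powr_le_f[OF x] by (simp add: C_def)
    also have "\<dots> \<le> C * u0" using C small by simp
    finally have "norm x powr \<epsilon> < d powr \<epsilon>" using u0 by linarith
    then have "norm x < d"
      using powr_mono2[of \<epsilon> d "norm x"] \<epsilon>_pos d(1) by fastforce
    then have "\<bar>r x\<bar> \<le> \<eta> / C * norm x powr \<epsilon>" using d(2) x False by blast
    also have "\<dots> \<le> \<eta> / C * (C * f x)" using le assms C by (intro mult_left_mono) auto
    also have "\<dots> = \<eta> * f x" using C by simp
    also have "r x = f x - deficit x" using r[OF x] g0_pos by (simp add: deficit_def)
    finally show ?thesis by (simp add: abs_minus_commute)
  qed (simp add: f_zero deficit.at_zero)
  with u0 show ?thesis by blast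
qed

text \<open>A compactness argument: the peak at the origin is strict, so the deficit is bounded away from $0$ where
$f\ge u_0$.\<close>

lemma deficit_small_imp_f_small:
  assumes "0 < u0"
  shows "\<exists>v0>0. \<forall>x\<in>unit_cube. deficit x \<le> v0 \<longrightarrow> f x \<le> u0"
proof -
  define K where "K = {x \<in> unit_cube. u0 \<le> f x}"
  show ?thesis
  proof (cases "K = {}")
    case True
    then show ?thesis by (intro exI[of _ 1]) (auto simp: K_def not_le less_imp_le)
  next
    case False
    have "closed K" unfolding K_def
      by (intro continuous_on_closed_Collect_le f_cont continuous_on_const closed_cbox)
    moreover have K: "K \<subseteq> unit_cube" by (auto simp: K_def)
    ultimately have "compact K"
      using compact_Int_closed[OF compact_cbox, of K 0 1] by (simp add: Int_absorb1)
    then obtain y where y: "y \<in> K" "\<And>x. x \<in> K \<Longrightarrow> deficit y \<le> deficit x"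
      using continuous_attains_inf[OF _ False continuous_on_subset[OF deficit_cont K]] by blast
    have "y \<noteq> 0" using y(1) assms f_zero by (auto simp: K_def)
    then have "0 < deficit y" using deficit.pos y(1) K by blast
    moreover have "f x \<le> u0" if "x \<in> unit_cube" "deficit x \<le> deficit y / 2" for x
    proof (rule ccontr)
      assume "\<not> f x \<le> u0"
      then have "x \<in> K" using that by (simp add: K_def)
      from y(2)[OF this] that \<open>0 < deficit y\<close> show False by simp
    qed
    ultimately show ?thesis by (intro exI[of _ "deficit y / 2"]) auto
  qed
qed

lemma regions_shrink:
  assumes "0 < u0"
  shows "\<exists>t0. 0 < t0 \<and> t0 < 1 \<and> (\<forall>t. 0 \<le> t \<and> t \<le> t0 \<longrightarrow>
           region f t \<subseteq> sublevel f u0 \<and> region deficit t \<subseteq> sublevel f u0)"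
proof -
  obtain v0 where v0: "0 < v0" "\<And>x. x \<in> unit_cube \<Longrightarrow> deficit x \<le> v0 \<Longrightarrow> f x \<le> u0"
    using deficit_small_imp_f_small[OF assms] by blast
  define t0 where "t0 = min (1/2) (min (vol f u0) (vol deficit v0) / 2)"
  have pos: "0 < vol f u0" "0 < vol deficit v0"
    using depth.vol_pos deficit.vol_pos assms v0(1) by auto
  have t0: "0 < t0" "t0 < 1" "t0 < vol f u0" "t0 < vol deficit v0"
    using pos by (auto simp: t0_def min_def)
  have "region f t \<subseteq> sublevel f u0 \<and> region deficit t \<subseteq> sublevel f u0" if t: "0 \<le> t" "t \<le> t0" for t
  proof
    show "region f t \<subseteq> sublevel f u0" using t t0 by (intro depth.region_subset_sublevel) auto
    have "region deficit t \<subseteq> sublevel deficit v0" using t t0 by (intro deficit.region_subset_sublevel) auto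
    then show "region deficit t \<subseteq> sublevel f u0" using v0(2) by (auto simp: sublevel_def)
  qed
  with t0 show ?thesis by blast
qed

subsection \<open>The mean deficit over a region\<close>

definition mean_deficit :: "(real ^ 'k \<Rightarrow> real) \<Rightarrow> real \<Rightarrow> real" where
  "mean_deficit \<psi> t = (LINT x:region \<psi> t|lborel. deficit x) / t"

lemma mean_deficit_continuous:
  assumes "depth_function \<psi> V"
  shows "continuous_on {0<..1} (mean_deficit \<psi>)"
proof -
  interpret \<psi>: depth_function \<psi> V by fact
  let ?I = "\<lambda>t. LINT x:region \<psi> t|lborel. deficit x"
  have diff: "dist (?I t) (?I s) \<le> 1 * dist t s" if "s \<in> {0..1}" "t \<in> {0..1}" "s \<le> t" for s t
    using \<psi>.integral_region_Lipschitz[OF _ that(3) _ deficit_cont deficit.nonneg deficit.bound] that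
    by (simp add: dist_real_def)
  have "1-lipschitz_on {0..1} ?I"
  proof (rule lipschitz_onI)
    fix s t :: real assume "s \<in> {0..1}" "t \<in> {0..1}"
    then show "dist (?I s) (?I t) \<le> 1 * dist s t"
      using diff[of s t] diff[of t s] by (cases "s \<le> t") (auto simp: dist_commute)
  qed simp
  then have "continuous_on {0<..1} ?I"
    by (rule continuous_on_subset[OF lipschitz_on_continuous_on]) auto
  then show ?thesis
    unfolding mean_deficit_def[abs_def] by (intro continuous_intros) auto
qed

lemma mean_deficit_le:
  assumes "0 < t" "t \<le> 1"
  shows "mean_deficit deficit t \<le> mean_deficit f t"
  unfolding mean_deficit_def
  using assms deficit.region_minimises_integral[of t "region f t"]
  by (intro divide_right_mono) (auto simp: depth.measure_region region_subset_cube)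

text \<open>Enlarging the region adds points whose deficit exceeds the maximum over the old region. Strictness
comes from the outer half of the added part, where the deficit exceeds that maximum by a fixed amount.\<close>

lemma mean_deficit_deficit_strict_mono:
  assumes s: "0 < s" "s < t" and t: "t \<le> 1"
  shows "mean_deficit deficit s < mean_deficit deficit t"
proof -
  let ?I = "\<lambda>A. LINT x:A|lborel. deficit x"
  define r where "r = (s + t) / 2"
  have r: "s < r" "r < t" using s by (simp_all add: r_def)
  obtain vs where vs: "vol deficit vs = s" "region deficit s = sublevel deficit vs"
    using deficit.region_is_sublevel[of s] s t by auto
  obtain vr where vr: "vol deficit vr = r" "region deficit r = sublevel deficit vr"
    using deficit.region_is_sublevel[of r] r s t by auto
  have v: "vs < vr" using deficit.vol_mono[of vr vs] r vs(1) vr(1) by (cases "vs < vr") auto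
  have sb: "region deficit s \<in> sets borel" "region deficit r \<in> sets borel" "region deficit t \<in> sets borel"
    using s r t by auto
  have split1: "?I (region deficit r) = ?I (region deficit s) + ?I (region deficit r - region deficit s)"
    using r by (intro integral_split_cube[OF deficit_cont] sb region_mono region_subset_cube) simp
  have split2: "?I (region deficit t) = ?I (region deficit r) + ?I (region deficit t - region deficit r)"
    using r by (intro integral_split_cube[OF deficit_cont] sb region_mono region_subset_cube) simp
  have "?I (region deficit s) \<le> vs * measure lborel (region deficit s)"
    using sb by (intro integral_le_const_cube[OF deficit_cont] region_subset_cube) (auto simp: vs sublevel_def)
  then have Is: "?I (region deficit s) \<le> vs * s" using s t by (simp add: deficit.measure_region)
  have "vs * measure lborel (region deficit r - region deficit s) \<le> ?I (region deficit r - region deficit s)"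
    using sb region_subset_cube[of deficit r]
    by (intro integral_ge_const_cube[OF deficit_cont]) (auto simp: vs vr sublevel_def)
  then have Ir: "vs * (r - s) \<le> ?I (region deficit r - region deficit s)"
    using deficit.measure_region_Diff[of s r] r s t by simp
  have "vr \<le> deficit x" if "x \<in> region deficit t - region deficit r" for x
    using that region_subset_cube[of deficit t] unfolding vr(2) by (auto simp: sublevel_def)
  then have "vr * measure lborel (region deficit t - region deficit r) \<le> ?I (region deficit t - region deficit r)"
    using sb region_subset_cube[of deficit t] by (intro integral_ge_const_cube[OF deficit_cont]) auto
  then have It: "vr * (t - r) \<le> ?I (region deficit t - region deficit r)"
    using deficit.measure_region_Diff[of r t] r s t by simp
  have "vs * (t - r) < vr * (t - r)" using v r by simp
  then have gain: "?I (region deficit s) + vs * (t - s) < ?I (region deficit t)"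
    using Ir It split1 split2 by (simp add: algebra_simps)
  have "?I (region deficit s) * t = ?I (region deficit s) * s + ?I (region deficit s) * (t - s)"
    by (simp add: algebra_simps)
  also have "\<dots> \<le> ?I (region deficit s) * s + (vs * s) * (t - s)"
    using Is s by (intro add_left_mono mult_right_mono) auto
  also have "\<dots> = (?I (region deficit s) + vs * (t - s)) * s" by (simp add: algebra_simps)
  also have "\<dots> < ?I (region deficit t) * s" using gain s by simp
  finally show ?thesis using s by (simp add: mean_deficit_def divide_less_eq less_divide_eq mult_ac)
qed

text \<open>The comparison of the two families of regions near the origin. For given $t$ let $u$ be the level with
\<open>vol f u = t\<close>. All facts follow from $(1-\eta)f\le\varphi\le(1+\eta)f$, from the mean $\kappa u$ of
$f$ over its own region and from the minimality of that region.\<close>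

lemma small_scale:
  assumes \<eta>: "0 < \<eta>" "\<eta> < 1" and c: "0 < c"
  shows "\<exists>t0. 0 < t0 \<and> t0 < 1 \<and> (\<forall>t. 0 < t \<and> t \<le> t0 \<longrightarrow>
     (\<exists>u. 0 < u \<and> u \<le> u1 \<and> vol f u = t \<and> region f t = sublevel f u
        \<and> (1 - \<eta>) * \<kappa> * u \<le> mean_deficit deficit t
        \<and> mean_deficit f t \<le> (1 + \<eta>) * \<kappa> * u
        \<and> sublevel f ((1 - \<eta>) / (1 + \<eta>) * u) \<subseteq> region deficit t
        \<and> (\<forall>x\<in>region f t \<union> region deficit t. \<bar>deficit x - f x\<bar> \<le> \<eta> * f x \<and> deficit x \<le> c)))"
proof -
  obtain u' where u': "0 < u'" "\<And>x. x \<in> unit_cube \<Longrightarrow> f x \<le> u' \<Longrightarrow> \<bar>deficit x - f x\<bar> \<le> \<eta> * f x"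
    using deficit_near_f[OF \<eta>(1)] by blast
  \<comment> \<open>Below \<open>c / 2\<close> the bound $\varphi\le(1+\eta)f\le2f$ gives a deficit of at most \<open>c\<close>.\<close>
  define u0 where "u0 = min u' (min u1 (c / 2))"
  have u0: "0 < u0" "u0 \<le> u'" "u0 \<le> u1" "2 * u0 \<le> c"
    using u' u1_pos c by (auto simp: u0_def)
  have near: "\<bar>deficit x - f x\<bar> \<le> \<eta> * f x" if "x \<in> sublevel f u0" for x
    using u'(2) u0 that by (auto simp: sublevel_def)
  obtain t' where t': "0 < t'" "t' < 1" "\<And>t. 0 \<le> t \<Longrightarrow> t \<le> t' \<Longrightarrow>
      region f t \<subseteq> sublevel f u0 \<and> region deficit t \<subseteq> sublevel f u0"
    using regions_shrink[OF u0(1)] by blast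
  define t0 where "t0 = min t' (vol f u0 / 2)"
  have t0: "0 < t0" "t0 < 1" "t0 \<le> t'" "t0 < vol f u0"
    using t' depth.vol_pos[OF u0(1)] by (auto simp: t0_def min_def)
  show ?thesis
  proof (rule exI[of _ t0], intro conjI allI impI t0(1,2))
    fix t assume t: "0 < t \<and> t \<le> t0"
    then have t1: "0 < t" "0 \<le> t" "t \<le> 1" "t \<le> t'" "t < vol f u0" using t0 by auto
    obtain u where u: "0 < u" "u < u0" "vol f u = t" "region f t = sublevel f u"
      using region_f_small[OF t1(1,5,3)] by blast
    have sub: "region f t \<subseteq> sublevel f u0" "region deficit t \<subseteq> sublevel f u0"
      using t'(3)[OF t1(2,4)] by auto
    have close: "\<bar>deficit x - f x\<bar> \<le> \<eta> * f x" "deficit x \<le> c"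
      if "x \<in> region f t \<union> region deficit t" for x
    proof -
      have x: "x \<in> sublevel f u0" using that sub by blast
      show n: "\<bar>deficit x - f x\<bar> \<le> \<eta> * f x" by (rule near[OF x])
      have "\<eta> * f x \<le> 1 * f x" using \<eta> f_nonneg by (intro mult_right_mono) auto
      then show "deficit x \<le> c" using n x u0 by (auto simp: sublevel_def)
    qed
    let ?If = "\<lambda>A. LINT x:A|lborel. f x" and ?I = "\<lambda>A. LINT x:A|lborel. deficit x"
    note rb = depth.region_borel[OF t1(2,3)] deficit.region_borel[OF t1(2,3)]
    note rc = region_subset_cube[of f t] region_subset_cube[of deficit t]
    have mean_f: "?If (region f t) = \<kappa> * u * t"
      using integral_f_proportional[of u] u u0 by simp
    have "(1 - \<eta>) * ?If (region f t) \<le> (1 - \<eta>) * ?If (region deficit t)"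
      using depth.region_minimises_integral[OF t1(2,3) rb(2) rc(2)] deficit.measure_region t1 \<eta>
      by (intro mult_left_mono) auto
    also have "\<dots> = (LINT x:region deficit t|lborel. (1 - \<eta>) * f x)" by simp
    also have "\<dots> \<le> ?I (region deficit t)"
    proof (intro set_integral_mono set_integrable_mult_right set_integrable_cube[OF f_cont]
        set_integrable_cube[OF deficit_cont] rb rc)
      fix x assume "x \<in> region deficit t"
      then have "f x - deficit x \<le> \<eta> * f x" using close(1)[of x] by auto
      then show "(1 - \<eta>) * f x \<le> deficit x" by (simp add: algebra_simps)
    qed
    finally have lower: "(1 - \<eta>) * \<kappa> * u \<le> mean_deficit deficit t"
      using t1 by (simp add: mean_f mean_deficit_def field_simps)
    have "?I (region f t) \<le> (LINT x:region f t|lborel. (1 + \<eta>) * f x)"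
    proof (intro set_integral_mono set_integrable_mult_right set_integrable_cube[OF f_cont]
        set_integrable_cube[OF deficit_cont] rb rc)
      fix x assume "x \<in> region f t"
      then have "deficit x - f x \<le> \<eta> * f x" using close(1)[of x] by auto
      then show "deficit x \<le> (1 + \<eta>) * f x" by (simp add: algebra_simps)
    qed
    also have "\<dots> = (1 + \<eta>) * (\<kappa> * u * t)" using mean_f by simp
    finally have upper: "mean_deficit f t \<le> (1 + \<eta>) * \<kappa> * u"
      using t1 by (simp add: mean_deficit_def field_simps)
    \<comment> \<open>The region of the deficit is some $\{\varphi\le v\}$ and is contained in $\{f\le v/(1-\eta)\}$. As its
      volume is that of $\{f\le u\}$, this forces $v\ge(1-\eta)u$.\<close>
    have inner: "sublevel f ((1 - \<eta>) / (1 + \<eta>) * u) \<subseteq> region deficit t"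
    proof
      fix x assume x: "x \<in> sublevel f ((1 - \<eta>) / (1 + \<eta>) * u)"
      obtain v where v: "0 \<le> v" "vol deficit v = t" "region deficit t = sublevel deficit v"
        using deficit.region_is_sublevel[OF t1(2,3)] by blast
      have "u \<le> v / (1 - \<eta>)"
      proof (rule ccontr)
        assume lt: "\<not> u \<le> v / (1 - \<eta>)"
        have "region deficit t \<subseteq> sublevel f (v / (1 - \<eta>))"
        proof
          fix y assume y: "y \<in> region deficit t"
          then have "f y - deficit y \<le> \<eta> * f y" "deficit y \<le> v"
            using close(1)[of y] v(3) by (auto simp: sublevel_def)
          then have "(1 - \<eta>) * f y \<le> v" by (simp add: algebra_simps)
          then have "f y \<le> v / (1 - \<eta>)" using \<eta> by (simp add: field_simps)
          then show "y \<in> sublevel f (v / (1 - \<eta>))" using y rc by (auto simp: sublevel_def)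
        qed
        then have "measure lborel (region deficit t) \<le> vol f (v / (1 - \<eta>))"
          unfolding vol_def by (intro measure_mono_cube sublevel_subset_cube rb) auto
        also have "\<dots> < vol f u"
          using lt u u0 v(1) \<eta> by (intro vol_f_strict_mono) auto
        finally show False using u deficit.measure_region[OF t1(2,3)] by simp
      qed
      then have uv: "(1 - \<eta>) * u \<le> v" using \<eta> by (simp add: field_simps)
      have "(1 - \<eta>) / (1 + \<eta>) * u \<le> 1 * u" using \<eta> u by (intro mult_right_mono) auto
      then have "x \<in> sublevel f u0" using x u sublevel_mono[of "(1 - \<eta>) / (1 + \<eta>) * u" u0 f] by auto
      from near[OF this] have "deficit x \<le> (1 + \<eta>) * f x" by (simp add: algebra_simps abs_le_iff)
      also have "\<dots> \<le> (1 + \<eta>) * ((1 - \<eta>) / (1 + \<eta>) * u)"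
        using x \<eta> by (intro mult_left_mono) (auto simp: sublevel_def)
      also have "\<dots> = (1 - \<eta>) * u" using \<eta> by simp
      finally show "x \<in> region deficit t"
        using uv x v(3) by (auto simp: sublevel_def)
    qed
    show "\<exists>u. 0 < u \<and> u \<le> u1 \<and> vol f u = t \<and> region f t = sublevel f u
        \<and> (1 - \<eta>) * \<kappa> * u \<le> mean_deficit deficit t
        \<and> mean_deficit f t \<le> (1 + \<eta>) * \<kappa> * u
        \<and> sublevel f ((1 - \<eta>) / (1 + \<eta>) * u) \<subseteq> region deficit t
        \<and> (\<forall>x\<in>region f t \<union> region deficit t. \<bar>deficit x - f x\<bar> \<le> \<eta> * f x \<and> deficit x \<le> c)"
      using u u0(3) lower upper inner close by (intro exI[of _ u] conjI ballI) auto
  qed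
qed

lemma mean_deficit_f_small:
  assumes "0 < b"
  shows "\<exists>t0. 0 < t0 \<and> t0 < 1 \<and> mean_deficit f t0 < b"
proof -
  have "0 < (1/2 :: real)" "(1/2 :: real) < 1" "0 < b / 2" using assms by auto
  from small_scale[OF this] obtain t where
      t: "0 < t" "t < 1" "\<forall>x\<in>region f t \<union> region deficit t. deficit x \<le> b / 2"
    by (metis order_refl)
  then have "(LINT x:region f t|lborel. deficit x) \<le> b / 2 * measure lborel (region f t)"
    by (intro integral_le_const_cube[OF deficit_cont] region_subset_cube) auto
  then have "mean_deficit f t \<le> b / 2"
    using t by (simp add: mean_deficit_def depth.measure_region divide_le_eq)
  then show ?thesis using t assms by (intro exI[of _ t]) auto
qed

text \<open>The mean deficit over $\{f\le u\}$ is at most $(1+\eta)\kappa u$, and points outside have deficit at least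
$(1-\eta)u$. As $\kappa<1$, a small $\eta$ makes the second number larger, so adding points raises the mean.\<close>

lemma mean_deficit_f_strict_mono_near_0:
  "\<exists>d. 0 < d \<and> d < 1 \<and> (\<forall>s t. 0 < s \<and> s < t \<and> t \<le> d \<longrightarrow> mean_deficit f s < mean_deficit f t)"
proof -
  \<comment> \<open>Half of the largest value with $(1+\eta)\kappa\le1-\eta$.\<close>
  define \<eta> where "\<eta> = (1 - \<kappa>) / (2 * (1 + \<kappa>))"
  have \<eta>: "0 < \<eta>" "\<eta> < 1" "(1 + \<eta>) * \<kappa> < 1 - \<eta>"
  proof -
    show e0: "0 < \<eta>" and "\<eta> < 1" using \<kappa>_bounds by (simp_all add: \<eta>_def field_simps)
    have "\<eta> * (1 + \<kappa>) = (1 - \<kappa>) / 2" using \<kappa>_bounds by (simp add: \<eta>_def field_simps)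
    then show "(1 + \<eta>) * \<kappa> < 1 - \<eta>" using \<kappa>_bounds by (simp add: algebra_simps)
  qed
  obtain d where d: "0 < d" "d < 1" and small: "\<And>t. 0 < t \<Longrightarrow> t \<le> d \<Longrightarrow>
     \<exists>u. 0 < u \<and> region f t = sublevel f u \<and> mean_deficit f t \<le> (1 + \<eta>) * \<kappa> * u
        \<and> (\<forall>x\<in>region f t. \<bar>deficit x - f x\<bar> \<le> \<eta> * f x)"
    using small_scale[OF \<eta>(1,2) zero_less_one] by (auto simp: Ball_def) (metis Un_iff)
  have "mean_deficit f s < mean_deficit f t" if st: "0 < s" "s < t" "t \<le> d" for s t
  proof -
    let ?I = "\<lambda>A. LINT x:A|lborel. deficit x"
    obtain u where u: "0 < u" "region f s = sublevel f u" "mean_deficit f s \<le> (1 + \<eta>) * \<kappa> * u"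
      using small[of s] st by auto
    have near: "\<And>x. x \<in> region f t \<Longrightarrow> \<bar>deficit x - f x\<bar> \<le> \<eta> * f x"
      using small[of t] st by auto
    have rb: "region f s \<in> sets borel" "region f t \<in> sets borel" using st d by auto
    have split: "?I (region f t) = ?I (region f s) + ?I (region f t - region f s)"
      using st by (intro integral_split_cube[OF deficit_cont] rb region_mono region_subset_cube) simp
    have "(1 - \<eta>) * u * measure lborel (region f t - region f s) \<le> ?I (region f t - region f s)"
    proof (rule integral_ge_const_cube[OF deficit_cont])
      fix x assume x: "x \<in> region f t - region f s"
      then have "u \<le> f x" using u(2) region_subset_cube[of f t] by (auto simp: sublevel_def)
      then have "(1 - \<eta>) * u \<le> (1 - \<eta>) * f x" using \<eta> by (intro mult_left_mono) auto
      also have "\<dots> \<le> deficit x" using near[of x] x by (auto simp: algebra_simps abs_le_iff)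
      finally show "(1 - \<eta>) * u \<le> deficit x" .
    qed (use rb region_subset_cube[of f t] in auto)
    then have "(1 - \<eta>) * u * (t - s) \<le> ?I (region f t - region f s)"
      using st d by (simp add: depth.measure_region_Diff)
    moreover have "mean_deficit f s * (t - s) < (1 - \<eta>) * u * (t - s)"
    proof (rule mult_strict_right_mono)
      have "(1 + \<eta>) * \<kappa> * u < (1 - \<eta>) * u" using \<eta> u by (intro mult_strict_right_mono) auto
      then show "mean_deficit f s < (1 - \<eta>) * u" using u by linarith
    qed (use st in simp)
    moreover have "?I (region f s) = mean_deficit f s * s" using st by (simp add: mean_deficit_def)
    ultimately have "mean_deficit f s * t < ?I (region f t)"
      unfolding split by (simp add: algebra_simps)
    then show ?thesis using st by (simp add: mean_deficit_def[of f t] less_divide_eq)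
  qed
  with d show ?thesis by blast
qed

subsection \<open>Crossing levels\<close>

text \<open>A single passage of the mean deficit through the level $b$, from below to above. In the model it says that
the expected proportion of observations in the region of volume $r$ is above the line $r/\alpha$ for $r<t$
and below it for $r>t$.\<close>

definition crosses :: "(real ^ 'k \<Rightarrow> real) \<Rightarrow> real \<Rightarrow> real \<Rightarrow> bool" where
  "crosses \<psi> b t \<longleftrightarrow> 0 < t \<and> t < 1 \<and> mean_deficit \<psi> t = b \<and>
     (\<forall>s. 0 < s \<and> s < t \<longrightarrow> mean_deficit \<psi> s < b) \<and> (\<forall>s. t < s \<and> s \<le> 1 \<longrightarrow> b < mean_deficit \<psi> s)"

lemma crosses_deficit_exists:
  assumes b: "0 < b" "b < mean_deficit deficit 1"
  shows "\<exists>t. crosses deficit b t"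
proof -
  obtain t0 where t0: "0 < t0" "t0 < 1" "mean_deficit f t0 < b"
    using mean_deficit_f_small[OF b(1)] by blast
  then have lt: "mean_deficit deficit t0 < b" using mean_deficit_le[of t0] by simp
  have "\<exists>t\<ge>t0. t \<le> 1 \<and> mean_deficit deficit t = b"
    using lt b t0
    by (intro IVT' continuous_on_subset[OF mean_deficit_continuous[OF deficit.depth_function_axioms]]) auto
  then obtain t where t: "t0 \<le> t" "t \<le> 1" "mean_deficit deficit t = b" by blast
  then have "0 < t" "t < 1" using t0 b by (auto simp: less_le)
  then have "crosses deficit b t"
    using mean_deficit_deficit_strict_mono t(3) by (auto simp: crosses_def)
  then show ?thesis by blast
qed

text \<open>Up to $d$ the mean deficit is strictly increasing. Beyond $d$ it is at least the mean deficit over the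
regions of the deficit itself, which is at least its value \<open>b0\<close> at $d$.\<close>

lemma crosses_f_exists: "\<exists>b0>0. \<forall>b. 0 < b \<and> b < b0 \<longrightarrow> (\<exists>t. crosses f b t)"
proof -
  obtain d where d: "0 < d" "d < 1"
      "\<And>s t. 0 < s \<Longrightarrow> s < t \<Longrightarrow> t \<le> d \<Longrightarrow> mean_deficit f s < mean_deficit f t"
    using mean_deficit_f_strict_mono_near_0 by blast
  have nonneg: "0 \<le> mean_deficit deficit t" if "0 < t" "t \<le> 1" for t
  proof -
    have "0 * measure lborel (region deficit t) \<le> (LINT x:region deficit t|lborel. deficit x)"
      using that region_subset_cube[of deficit t]
      by (intro integral_ge_const_cube[OF deficit_cont] deficit.nonneg) auto
    then show ?thesis using that by (simp add: mean_deficit_def)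
  qed
  define b0 where "b0 = mean_deficit deficit d"
  have "0 < b0"
    using nonneg[of "d / 2"] mean_deficit_deficit_strict_mono[of "d / 2" d] d by (simp add: b0_def)
  moreover have "\<exists>t. crosses f b t" if b: "0 < b" "b < b0" for b
  proof -
    have far: "b < mean_deficit f s" if "d \<le> s" "s \<le> 1" for s
    proof -
      have "b0 \<le> mean_deficit deficit s"
        using mean_deficit_deficit_strict_mono[of d s] d that by (cases "d = s") (auto simp: b0_def)
      then show ?thesis using b mean_deficit_le[of s] d that by simp
    qed
    obtain t0 where t0: "0 < t0" "t0 < 1" "mean_deficit f t0 < b"
      using mean_deficit_f_small[OF b(1)] by blast
    have "t0 < d" using far[of t0] t0 by (cases "t0 < d") auto
    have "\<exists>t\<ge>t0. t \<le> d \<and> mean_deficit f t = b"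
      using t0 \<open>t0 < d\<close> d far[of d]
      by (intro IVT' continuous_on_subset[OF mean_deficit_continuous[OF depth.depth_function_axioms]]) auto
    then obtain t where t: "t0 \<le> t" "t \<le> d" "mean_deficit f t = b" by blast
    have "b < mean_deficit f s" if "t < s" "s \<le> 1" for s
      using d(3)[of t s] far[of s] t t0 that by (cases "s \<le> d") auto
    then have "crosses f b t"
      using d t t0 by (auto simp: crosses_def)
    then show ?thesis by blast
  qed
  ultimately show ?thesis by blast
qed

lemma crosses_deficit_small:
  assumes "0 < d"
  shows "\<exists>b0>0. \<forall>b s. b < b0 \<and> crosses deficit b s \<longrightarrow> s < d"
proof -
  define e where "e = min d (1/2)"
  have e: "0 < e" "e < 1" "e \<le> d" using assms by (auto simp: e_def)
  have "0 * measure lborel (region deficit (e / 2)) \<le> (LINT x:region deficit (e / 2)|lborel. deficit x)"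
    using e region_subset_cube[of deficit "e / 2"]
    by (intro integral_ge_const_cube[OF deficit_cont] deficit.nonneg) auto
  then have "0 \<le> mean_deficit deficit (e / 2)" using e by (simp add: mean_deficit_def)
  then have pos: "0 < mean_deficit deficit e"
    using mean_deficit_deficit_strict_mono[of "e / 2" e] e by simp
  have "s < d" if "b < mean_deficit deficit e" "crosses deficit b s" for b s
  proof (rule ccontr)
    assume "\<not> s < d"
    then have "e \<le> s" using e by simp
    then have "mean_deficit deficit e \<le> mean_deficit deficit s"
      using mean_deficit_deficit_strict_mono[of e s] e that by (cases "e = s") (auto simp: crosses_def)
    then show False using that by (simp add: crosses_def)
  qed
  with pos show ?thesis by blast
qed

lemma crosses_f_le_crosses_deficit:
  assumes "crosses deficit b s" "crosses f b t"
  shows "t \<le> s"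
proof (rule ccontr)
  assume "\<not> t \<le> s"
  then have "b < mean_deficit deficit t" using assms by (auto simp: crosses_def)
  also have "\<dots> \<le> mean_deficit f t" using assms by (intro mean_deficit_le) (auto simp: crosses_def)
  finally show False using assms by (simp add: crosses_def)
qed

text \<open>Let $u$ and $w$ be the levels of $f$ with volumes $t$ and $s$. Equality of the two mean deficits gives
$(1-\eta)\kappa w\le(1+\eta)\kappa u$, hence $qw\le u$ with $q=(1-\eta)/(1+\eta)$, and lowering a level by
the factor $q$ costs at most a factor $q^m>\rho$ of volume. The intersection contains $\{f\le qu\}$.\<close>

lemma regions_asymptotically_equal:
  assumes \<rho>: "0 < \<rho>" "\<rho> < 1"
  shows "\<exists>b0>0. \<forall>b s t. b < b0 \<and> crosses deficit b s \<and> crosses f b t \<longrightarrow>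
      \<rho> * t \<le> measure lborel (region deficit s \<inter> region f t) \<and> \<rho> * s \<le> t \<and>
      (\<forall>x\<in>region deficit s \<union> region f t. \<rho> * g 0 \<le> g x)"
proof -
  have "((\<lambda>\<eta>. ((1 - \<eta>) / (1 + \<eta>)) powr m) \<longlongrightarrow> 1) (at_right 0)"
    by (auto intro!: tendsto_eq_intros)
  from order_tendstoD(1)[OF this \<rho>(2)] eventually_at_right_real[OF zero_less_one]
  have "\<forall>\<^sub>F \<eta> in at_right 0. \<rho> < ((1 - \<eta>) / (1 + \<eta>)) powr m \<and> 0 < \<eta> \<and> \<eta> < 1"
    by eventually_elim auto
  then obtain \<eta> where \<eta>: "0 < \<eta>" "\<eta> < 1" "\<rho> < ((1 - \<eta>) / (1 + \<eta>)) powr m"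
    using eventually_happens'[OF trivial_limit_at_right_real] by blast
  define q where "q = (1 - \<eta>) / (1 + \<eta>)"
  have q: "0 < q" "q \<le> 1" "\<rho> < q powr m" using \<eta> by (auto simp: q_def)
  obtain t0 where t0: "0 < t0" "t0 < 1" and small: "\<And>t. 0 < t \<Longrightarrow> t \<le> t0 \<Longrightarrow>
     (\<exists>u. 0 < u \<and> u \<le> u1 \<and> vol f u = t \<and> region f t = sublevel f u
        \<and> (1 - \<eta>) * \<kappa> * u \<le> mean_deficit deficit t
        \<and> mean_deficit f t \<le> (1 + \<eta>) * \<kappa> * u
        \<and> sublevel f (q * u) \<subseteq> region deficit t
        \<and> (\<forall>x\<in>region f t \<union> region deficit t. \<bar>deficit x - f x\<bar> \<le> \<eta> * f x \<and> deficit x \<le> 1 - \<rho>))"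
    using small_scale[OF \<eta>(1,2), of "1 - \<rho>"] \<rho> unfolding q_def by auto
  obtain b0 where b0: "0 < b0" "\<And>b s. b < b0 \<Longrightarrow> crosses deficit b s \<Longrightarrow> s < t0"
    using crosses_deficit_small[OF t0(1)] by blast
  have "\<rho> * t \<le> measure lborel (region deficit s \<inter> region f t) \<and> \<rho> * s \<le> t \<and>
      (\<forall>x\<in>region deficit s \<union> region f t. \<rho> * g 0 \<le> g x)"
    if b: "b < b0" and cs: "crosses deficit b s" and ct: "crosses f b t" for b s t
  proof (intro conjI)
    have ts: "t \<le> s" by (rule crosses_f_le_crosses_deficit[OF cs ct])
    have t: "0 < t" "t \<le> t0" "0 < s" "s \<le> t0" "mean_deficit deficit s = mean_deficit f t"
      using b0(2)[OF b cs] cs ct ts by (auto simp: crosses_def)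
    obtain u where u: "0 < u" "u \<le> u1" "vol f u = t" "region f t = sublevel f u"
        "mean_deficit f t \<le> (1 + \<eta>) * \<kappa> * u" "sublevel f (q * u) \<subseteq> region deficit t"
        "\<And>x. x \<in> region f t \<Longrightarrow> deficit x \<le> 1 - \<rho>"
      using small[of t] t by blast
    obtain w where w: "0 < w" "w \<le> u1" "vol f w = s" "region f s = sublevel f w"
        "(1 - \<eta>) * \<kappa> * w \<le> mean_deficit deficit s"
        "\<And>x. x \<in> region deficit s \<Longrightarrow> deficit x \<le> 1 - \<rho>"
      using small[of s] t by blast
    have "\<kappa> * ((1 - \<eta>) * w) \<le> \<kappa> * ((1 + \<eta>) * u)" using t(5) u(5) w(5) by (simp add: mult_ac)
    then have "(1 - \<eta>) * w \<le> (1 + \<eta>) * u" using \<kappa>_bounds by simp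
    then have "q * w \<le> u" using \<eta> by (simp add: q_def field_simps)
    have "\<rho> * s \<le> q powr m * s" using q t by (intro mult_right_mono) auto
    also have "\<dots> \<le> vol f (q * w)" using vol_f_shrink[OF q(1,2)] w by blast
    also have "\<dots> \<le> t" using vol_f_mono[OF \<open>q * w \<le> u\<close>] u by simp
    finally show "\<rho> * s \<le> t" .
    have "\<rho> * t \<le> q powr m * t" using q t by (intro mult_right_mono) auto
    also have "\<dots> \<le> vol f (q * u)" using vol_f_shrink[OF q(1,2)] u by blast
    also have "\<dots> \<le> measure lborel (region deficit s \<inter> region f t)"
      unfolding vol_def
    proof (rule measure_mono_cube)
      have "q * u \<le> 1 * u" using q u by (intro mult_right_mono) auto
      then show "sublevel f (q * u) \<subseteq> region deficit s \<inter> region f t"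
        using u(4,6) region_mono[OF ts, of deficit] sublevel_mono[of "q * u" u f] by auto
      show "region deficit s \<inter> region f t \<in> sets borel"
        using t t0 by (intro sets.Int deficit.region_borel depth.region_borel) auto
    qed (use region_subset_cube[of f t] in auto)
    finally show "\<rho> * t \<le> measure lborel (region deficit s \<inter> region f t)" .
    show "\<forall>x\<in>region deficit s \<union> region f t. \<rho> * g 0 \<le> g x"
    proof
      fix x assume "x \<in> region deficit s \<union> region f t"
      then have "deficit x \<le> 1 - \<rho>" using u(7) w(6) by blast
      then have "\<rho> * g 0 \<le> (1 - deficit x) * g 0" using g0_pos by (intro mult_right_mono) auto
      then show "\<rho> * g 0 \<le> g x" using g_eq_deficit[of x] by (simp add: mult.commute)
    qed
  qed
  with b0(1) show ?thesis by blast
qed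

end

section \<open>Rejections in the random effects model\<close>

locale peaked_effects = random_effects M a g \<theta> \<xi> + peaked_density g \<epsilon> \<gamma>
  for M :: "'w measure" and a :: real and g :: "real ^ 'k \<Rightarrow> real"
    and \<theta> :: "nat \<Rightarrow> 'w \<Rightarrow> bool" and \<xi> :: "nat \<Rightarrow> 'w \<Rightarrow> real ^ 'k"
    and \<epsilon> :: real and \<gamma> :: "real ^ 'k"
begin

text \<open>The probability that an observation has status \<open>b\<close> and lies in \<open>A\<close>; see \<open>prob_eq_mass\<close>.\<close>

definition mass :: "bool \<Rightarrow> (real ^ 'k) set \<Rightarrow> real" where
  "mass b A = (if b then a * (LINT x:A|lborel. g x) else (1 - a) * measure lborel A)"

text \<open>The largest value of the density of \<open>mass b\<close>, attained at the origin.\<close>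

definition peak :: "bool \<Rightarrow> real" where
  "peak b = (if b then a * g 0 else 1 - a)"

lemma peak_pos: "0 < peak b"
  using a_range g0_pos by (simp add: peak_def)

lemma g_le: "x \<in> unit_cube \<Longrightarrow> g x \<le> g 0"
  using g_less[of x] by (cases "x = 0") auto

lemma prob_eq_mass:
  assumes "A \<in> sets borel" "A \<subseteq> unit_cube"
  shows "prob {\<omega> \<in> space M. \<theta> i \<omega> = b \<and> \<xi> i \<omega> \<in> A} = mass b A"
  using prob_null_region[OF assms, of i]
    prob_alt_region[OF assms g_nonneg set_integrable_cube[OF g_cont assms], of i]
  by (cases b) (simp_all add: mass_def)

lemma frequency_tendsto:
  assumes "A \<in> sets borel" "A \<subseteq> unit_cube"
  shows "((\<lambda>(n, \<omega>). real (card (hits b A n \<omega>)) / real n) \<longlongrightarrow> mass b A) (whp M)"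
  by (rule hits_frequency_tendsto[OF assms(1) prob_eq_mass[OF assms]])

lemma mass_upper:
  assumes "A \<in> sets borel" "A \<subseteq> unit_cube"
  shows "mass b A \<le> peak b * measure lborel A"
proof -
  have "(LINT x:A|lborel. g x) \<le> g 0 * measure lborel A"
    using assms(2) by (intro integral_le_const_cube[OF g_cont assms] g_le) auto
  then show ?thesis using a_range by (simp add: mass_def peak_def)
qed

lemma mass_lower:
  assumes "A \<in> sets borel" "A \<subseteq> unit_cube" "\<rho> \<le> 1" "\<And>x. x \<in> A \<Longrightarrow> \<rho> * g 0 \<le> g x"
  shows "\<rho> * peak b * measure lborel A \<le> mass b A"
proof -
  have "\<rho> * g 0 * measure lborel A \<le> (LINT x:A|lborel. g x)"
    by (intro integral_ge_const_cube[OF g_cont assms(1,2)] assms(4))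
  then have "a * (\<rho> * g 0 * measure lborel A) \<le> a * (LINT x:A|lborel. g x)"
    using a_range by (intro mult_left_mono) auto
  moreover have "\<rho> * ((1 - a) * measure lborel A) \<le> 1 * ((1 - a) * measure lborel A)"
    using a_range assms(3) by (intro mult_right_mono) auto
  ultimately show ?thesis by (simp add: mass_def peak_def mult_ac)
qed

lemma mass_diff:
  assumes "A \<in> sets borel" "B \<in> sets borel" "A \<subseteq> B" "B \<subseteq> unit_cube"
  shows "mass b A \<le> mass b B" "mass b B \<le> mass b A + peak b * (measure lborel B - measure lborel A)"
proof -
  have D: "B - A \<in> sets borel" "B - A \<subseteq> unit_cube" using assms by auto
  have split: "mass b B = mass b A + mass b (B - A)"
    unfolding mass_def integral_split_cube[OF g_cont assms] measure_Diff_cube[OF assms]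
    by (simp add: algebra_simps)
  have "0 * peak b * measure lborel (B - A) \<le> mass b (B - A)"
    using D(2) by (intro mass_lower[OF D]) (auto intro: g_nonneg)
  then show "mass b A \<le> mass b B" using split by simp
  show "mass b B \<le> mass b A + peak b * (measure lborel B - measure lborel A)"
    using mass_upper[OF D, of b] split measure_Diff_cube[OF assms] by simp
qed

subsection \<open>Proportion of observations in a region\<close>

text \<open>The mean deficit at which the expected proportion of observations in a region of volume $t$ equals
$t/\alpha$.\<close>

definition level :: "real \<Rightarrow> real" where
  "level \<alpha> = (1 / alpha_star a g - 1 / \<alpha>) / (a * g 0)"

definition coverage :: "(real ^ 'k \<Rightarrow> real) \<Rightarrow> real \<Rightarrow> real" where
  "coverage \<psi> t = mass True (region \<psi> t) + mass False (region \<psi> t)"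

text \<open>The expected proportion is $(1-a)t+ag(0)(t-\int\varphi)$, and $1/\alpha_*=1-a+ag(0)$.\<close>

lemma coverage_minus_line:
  assumes "depth_function \<psi> V" "0 < t" "t \<le> 1"
  shows "coverage \<psi> t - t / \<alpha> = t * (a * g 0) * (level \<alpha> - mean_deficit \<psi> t)"
proof -
  interpret \<psi>: depth_function \<psi> V by fact
  have rb: "region \<psi> t \<in> sets borel" "region \<psi> t \<subseteq> unit_cube"
    using assms region_subset_cube by auto
  have "(LINT x:region \<psi> t|lborel. deficit x) = (LINT x:region \<psi> t|lborel. 1 - g x / g 0)"
    by (simp add: deficit_def)
  also have "\<dots> = (LINT x:region \<psi> t|lborel. 1) - (LINT x:region \<psi> t|lborel. g x / g 0)"
    using rb by (intro set_integral_diff set_integrable_const_cube set_integrable_divide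
        set_integrable_cube[OF g_cont])
  also have "\<dots> = t - (LINT x:region \<psi> t|lborel. g x) / g 0"
    using rb assms \<psi>.measure_region[of t] by (simp add: set_lebesgue_integral_def)
  finally have int_g: "(LINT x:region \<psi> t|lborel. g x) = g 0 * (t - t * mean_deficit \<psi> t)"
    using g0_pos assms by (simp add: mean_deficit_def field_simps)
  have "1 / alpha_star a g = 1 - a + a * g 0" by (simp add: alpha_star_def)
  then have "a * g 0 * level \<alpha> = 1 - a + a * g 0 - 1 / \<alpha>"
    using a_range g0_pos by (simp add: level_def)
  then have "t * (a * g 0) * (level \<alpha> - mean_deficit \<psi> t)
      = t * (1 - a + a * g 0 - 1 / \<alpha>) - t * (a * g 0) * mean_deficit \<psi> t"
    by (simp only: right_diff_distrib mult.assoc)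
  moreover have "coverage \<psi> t = a * (g 0 * (t - t * mean_deficit \<psi> t)) + (1 - a) * t"
    using assms \<psi>.measure_region[of t] by (simp add: coverage_def mass_def int_g)
  ultimately show ?thesis by (simp add: algebra_simps)
qed

definition observed :: "(real ^ 'k) set \<Rightarrow> nat \<Rightarrow> 'w \<Rightarrow> nat set" where
  "observed A n \<omega> = {i. i < n \<and> \<xi> i \<omega> \<in> A}"

lemma card_observed: "card (observed A n \<omega>) = card (hits True A n \<omega>) + card (hits False A n \<omega>)"
proof -
  have "observed A n \<omega> = hits True A n \<omega> \<union> hits False A n \<omega>"
    by (auto simp: observed_def hits_def)
  moreover have "hits True A n \<omega> \<inter> hits False A n \<omega> = {}" by (auto simp: hits_def)
  ultimately show ?thesis by (simp add: card_Un_disjoint)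
qed

lemma observed_tendsto_coverage:
  assumes "depth_function \<psi> V" "0 \<le> t" "t \<le> 1"
  shows "((\<lambda>(n, \<omega>). real (card (observed (region \<psi> t) n \<omega>)) / real n) \<longlongrightarrow> coverage \<psi> t) (whp M)"
proof -
  have rb: "region \<psi> t \<in> sets borel" "region \<psi> t \<subseteq> unit_cube"
    using depth_function.region_borel[OF assms] region_subset_cube by auto
  show ?thesis
    using tendsto_add[OF frequency_tendsto[OF rb, of True] frequency_tendsto[OF rb, of False]]
    by (simp add: card_observed coverage_def split_def add_divide_distrib)
qed

lemma coverage_Lipschitz:
  assumes "depth_function \<psi> V" "0 \<le> s" "s \<le> t" "t \<le> 1"
  shows "coverage \<psi> t \<le> coverage \<psi> s + (1 - a + a * g 0) * (t - s)"
proof -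
  interpret \<psi>: depth_function \<psi> V by fact
  have m: "mass b (region \<psi> t) \<le> mass b (region \<psi> s) + peak b * (t - s)" for b
    using mass_diff(2)[OF \<psi>.region_borel \<psi>.region_borel region_mono region_subset_cube, of s t b] assms
    by (simp add: \<psi>.measure_region)
  show ?thesis using m[of True] m[of False] by (simp add: coverage_def peak_def algebra_simps)
qed

subsection \<open>Localisation of the rejection region\<close>

definition rejected :: "(real ^ 'k \<Rightarrow> real) \<Rightarrow> real \<Rightarrow> nat \<Rightarrow> 'w \<Rightarrow> nat set" where
  "rejected \<psi> \<alpha> n \<omega> = reject_BH \<alpha> n (\<lambda>i. score \<psi> (\<xi> i \<omega>))"

lemma score_le_iff:
  assumes "\<omega> \<in> space M"
  shows "score \<psi> (\<xi> i \<omega>) \<le> t \<longleftrightarrow> \<xi> i \<omega> \<in> region \<psi> t"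
  using in_cube[OF assms] by (simp add: region_def)

lemma score_le_observed:
  assumes "\<omega> \<in> space M"
  shows "{i. i < n \<and> score \<psi> (\<xi> i \<omega>) \<le> t} = observed (region \<psi> t) n \<omega>"
  by (simp add: observed_def score_le_iff[OF assms])

lemma rejected_superset_whp:
  assumes \<psi>: "depth_function \<psi> V" and cr: "crosses \<psi> (level \<alpha>) t" and s: "0 < s" "s < t"
  shows "\<forall>\<^sub>F x in whp M. observed (region \<psi> s) (fst x) (snd x) \<subseteq> rejected \<psi> \<alpha> (fst x) (snd x)"
proof -
  have s1: "s \<le> 1" "0 \<le> s" using s cr by (auto simp: crosses_def)
  have "0 < s * (a * g 0) * (level \<alpha> - mean_deficit \<psi> s)"
    using s cr a_range g0_pos by (auto simp: crosses_def)
  then have "s / \<alpha> < coverage \<psi> s"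
    using coverage_minus_line[OF \<psi> s(1) s1(1), of \<alpha>] by simp
  from order_tendstoD(1)[OF observed_tendsto_coverage[OF \<psi> s1(2,1)] this] eventually_whp_space
  show ?thesis
  proof eventually_elim
    case (elim x)
    then have "s / \<alpha> \<le> real (card {i. i < fst x \<and> score \<psi> (\<xi> i (snd x)) \<le> s}) / real (fst x)"
      by (simp add: split_def score_le_observed)
    from reject_BH_superset[OF _ this] s1 elim show ?case
      by (simp add: rejected_def split_def score_le_observed)
  qed
qed

text \<open>The observed proportion must stay below the line $r/\alpha$ for all $r\in[s,1]$ at once. The gap between
the line and the expected proportion has a positive minimum $\mu$ there. On a grid so fine that the
expected proportion grows by less than $\mu$ per step, the observed proportion at a grid point is
eventually below the line at the preceding one, and monotonicity covers the points in between.\<close>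

lemma rejected_subset_whp:
  assumes \<psi>: "depth_function \<psi> V" and \<alpha>: "0 < \<alpha>" and cr: "crosses \<psi> (level \<alpha>) t" and s: "t < s" "s < 1"
  shows "\<forall>\<^sub>F x in whp M. rejected \<psi> \<alpha> (fst x) (snd x) \<subseteq> observed (region \<psi> s) (fst x) (snd x)"
proof -
  have s0: "0 < s" using s cr by (simp add: crosses_def)
  define gap where "gap r = r * (a * g 0) * (mean_deficit \<psi> r - level \<alpha>)" for r
  have gap: "coverage \<psi> r = r / \<alpha> - gap r" if "s \<le> r" "r \<le> 1" for r
    using coverage_minus_line[OF \<psi>, of r \<alpha>] that s0 by (simp add: gap_def algebra_simps)
  have "continuous_on {s..1} gap"
    unfolding gap_def using s0
    by (intro continuous_intros continuous_on_subset[OF mean_deficit_continuous[OF \<psi>]]) auto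
  then obtain r0 where r0: "r0 \<in> {s..1}" "\<And>r. r \<in> {s..1} \<Longrightarrow> gap r0 \<le> gap r"
    using continuous_attains_inf[of "{s..1}" gap] s by auto
  define \<mu> where "\<mu> = gap r0"
  have "0 < \<mu>" unfolding \<mu>_def gap_def
    using r0(1) s s0 cr a_range g0_pos by (auto simp: crosses_def intro!: mult_pos_pos)
  define L where "L = 1 - a + a * g 0"
  have "0 < L" using a_range g0_pos by (simp add: L_def add_pos_pos)
  obtain N :: nat where N: "L / \<mu> < N" using reals_Archimedean2 by blast
  have "0 < L / \<mu>" using \<open>0 < L\<close> \<open>0 < \<mu>\<close> by simp
  then have N0: "0 < N" using N by (cases "N = 0") auto
  define p where "p j = s + (1 - s) * (j / N)" for j :: real
  have p_range: "s \<le> p j" "p j \<le> 1" if "0 \<le> j" "j \<le> N" for j :: real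
  proof -
    show "s \<le> p j" using that s by (simp add: p_def)
    have "(1 - s) * (j / N) \<le> (1 - s) * 1"
      using that s N0 by (intro mult_left_mono) auto
    then show "p j \<le> 1" by (simp add: p_def)
  qed
  have p_step: "coverage \<psi> (p (real j + 1)) < p j / \<alpha>" if "j < N" for j :: nat
  proof -
    have j: "s \<le> p j" "p j \<le> 1" "p (real j + 1) \<le> 1" "p j \<le> p (real j + 1)"
      using p_range[of j] p_range[of "real j + 1"] that s N0
      by (auto simp: p_def intro!: mult_left_mono divide_right_mono)
    have "p (real j + 1) - p j = (1 - s) / N" using N0 by (simp add: p_def field_simps)
    moreover have "L * ((1 - s) / N) \<le> L * (1 / N)"
      using \<open>0 < L\<close> s s0 by (intro mult_left_mono divide_right_mono) auto
    moreover have "L * (1 / N) < \<mu>"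
      using N N0 \<open>0 < \<mu>\<close> by (simp add: field_simps)
    moreover have "coverage \<psi> (p (real j + 1)) \<le> coverage \<psi> (p j) + L * (p (real j + 1) - p j)"
      unfolding L_def using j s0 by (intro coverage_Lipschitz[OF \<psi>]) auto
    moreover have "coverage \<psi> (p j) \<le> p j / \<alpha> - \<mu>"
      using gap[OF j(1,2)] r0(2)[of "p j"] j by (simp add: \<mu>_def)
    ultimately show ?thesis by simp
  qed
  have "\<forall>\<^sub>F x in whp M. \<forall>j\<in>{..<N}.
      real (card (observed (region \<psi> (p (real j + 1))) (fst x) (snd x))) / real (fst x) < p j / \<alpha>"
  proof (intro eventually_ball_finite ballI finite_lessThan)
    fix j assume "j \<in> {..<N}"
    then have j: "j < N" by simp
    have "0 \<le> p (real j + 1)" "p (real j + 1) \<le> 1" using p_range[of "real j + 1"] s0 j by auto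
    from order_tendstoD(2)[OF observed_tendsto_coverage[OF \<psi> this] p_step[OF j]]
    show "\<forall>\<^sub>F x in whp M.
      real (card (observed (region \<psi> (p (real j + 1))) (fst x) (snd x))) / real (fst x) < p j / \<alpha>"
      by (simp add: split_def)
  qed
  moreover have "\<forall>\<^sub>F x in whp M. 1 / real (fst x) < s / \<alpha>"
  proof -
    have "\<forall>\<^sub>F n in sequentially. 1 / real n < s / \<alpha>"
      using order_tendstoD(2)[OF lim_1_over_n, of "s / \<alpha>"] s0 \<alpha> by simp
    from eventually_whp_of_sequentially[OF this] show ?thesis by (simp add: split_def)
  qed
  moreover note eventually_whp_space
  ultimately show ?thesis
  proof eventually_elim
    case (elim x)
    obtain n \<omega> where x: "x = (n, \<omega>)" by fastforce
    have \<omega>: "\<omega> \<in> space M" using elim(3) by (simp add: x)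
    have "reject_BH \<alpha> n (\<lambda>i. score \<psi> (\<xi> i \<omega>)) \<subseteq> {i. i < n \<and> score \<psi> (\<xi> i \<omega>) \<le> s}"
    proof (rule reject_BH_subset)
      fix r assume r: "s < r" "r \<le> 1"
      define z where "z = (r - s) / (1 - s) * N"
      have "(r - s) / (1 - s) * N \<le> 1 * real N" using r s by (intro mult_right_mono) auto
      then have z: "0 < z" "z \<le> N" using r s N0 by (simp_all add: z_def)
      have pz: "p z = r" using r s N0 by (simp add: p_def z_def)
      define j where "j = nat (\<lceil>z\<rceil> - 1)"
      have ceil: "real j < z" "z \<le> real j + 1" "j < N"
      proof -
        have "0 < \<lceil>z\<rceil>" using z by simp
        then have j: "real j = of_int \<lceil>z\<rceil> - 1" by (simp add: j_def)
        show "real j < z" "z \<le> real j + 1" unfolding j by linarith+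
        then show "j < N" using z by simp
      qed
      have "p z \<le> p (real j + 1)" "p j \<le> p z"
        using ceil s N0 by (auto simp: p_def intro!: mult_left_mono divide_right_mono)
      then have "card (observed (region \<psi> r) n \<omega>) \<le> card (observed (region \<psi> (p (real j + 1))) n \<omega>)"
        using region_mono[of r "p (real j + 1)" \<psi>] unfolding pz
        by (intro card_mono) (auto simp: observed_def)
      then have "real (card (observed (region \<psi> r) n \<omega>)) / n
          \<le> real (card (observed (region \<psi> (p (real j + 1))) n \<omega>)) / n"
        by (intro divide_right_mono) auto
      also have "\<dots> < p j / \<alpha>" using elim(1) ceil(3) by (simp add: x)
      also have "\<dots> \<le> r / \<alpha>" using \<open>p j \<le> p z\<close> \<alpha> pz by (simp add: divide_right_mono)
      finally have "real (card (observed (region \<psi> r) n \<omega>)) / n < r / \<alpha>" .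
      moreover have "1 / real n < r / \<alpha>"
      proof -
        have "s / \<alpha> < r / \<alpha>" using r \<alpha> by (simp add: divide_strict_right_mono)
        then show ?thesis using elim(2) by (simp add: x)
      qed
      ultimately show "real (max (card {i. i < n \<and> score \<psi> (\<xi> i \<omega>) \<le> r}) 1) / n < r / \<alpha>"
        unfolding score_le_observed[OF \<omega>] by (simp add: max_def)
    qed
    then show ?case by (simp add: x rejected_def score_le_observed[OF \<omega>])
  qed
qed

subsection \<open>Limits of rejection counts\<close>

text \<open>The hypotheses of status \<open>b\<close> that two procedures both reject; taking the same procedure twice gives the
rejections of one.\<close>

definition joint :: "bool \<Rightarrow> (real ^ 'k \<Rightarrow> real) \<Rightarrow> (real ^ 'k \<Rightarrow> real) \<Rightarrow> real \<Rightarrow> nat \<Rightarrow> 'w \<Rightarrow> nat set" where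
  "joint b \<psi> \<phi> \<alpha> n \<omega> = {i \<in> rejected \<psi> \<alpha> n \<omega> \<inter> rejected \<phi> \<alpha> n \<omega>. \<theta> i \<omega> = b}"

lemma rejected_lessThan: "rejected \<psi> \<alpha> n \<omega> \<subseteq> {..<n}"
  by (auto simp: rejected_def reject_BH_def)

lemma finite_rejected[simp]: "finite (rejected \<psi> \<alpha> n \<omega>)"
  by (rule finite_subset[OF rejected_lessThan]) simp

lemma measure_Int_regions_Lipschitz:
  assumes \<psi>: "depth_function \<psi> V" and \<phi>: "depth_function \<phi> W"
    and "0 \<le> s" "s \<le> s'" "s' \<le> 1" "0 \<le> t" "t \<le> t'" "t' \<le> 1"
  shows "measure lborel (region \<psi> s' \<inter> region \<phi> t')
    \<le> measure lborel (region \<psi> s \<inter> region \<phi> t) + (s' - s) + (t' - t)"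
proof -
  interpret \<psi>: depth_function \<psi> V by fact
  interpret \<phi>: depth_function \<phi> W by fact
  have rb: "region \<psi> s \<in> sets borel" "region \<psi> s' \<in> sets borel"
      "region \<phi> t \<in> sets borel" "region \<phi> t' \<in> sets borel"
    using assms(3-) by auto
  let ?A = "region \<psi> s \<inter> region \<phi> t" and ?B = "region \<psi> s' - region \<psi> s" and ?C = "region \<phi> t' - region \<phi> t"
  have "measure lborel (region \<psi> s' \<inter> region \<phi> t') \<le> measure lborel (?A \<union> ?B \<union> ?C)"
    using rb region_subset_cube[of \<psi> s'] region_subset_cube[of \<phi> t'] region_subset_cube[of \<psi> s]
    by (intro measure_mono_cube) auto
  also have "\<dots> \<le> measure lborel (?A \<union> ?B) + measure lborel ?C"
    using rb by (intro measure_Un_le) auto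
  also have "measure lborel (?A \<union> ?B) \<le> measure lborel ?A + measure lborel ?B"
    using rb by (intro measure_Un_le) auto
  finally show ?thesis
    using \<psi>.measure_region_Diff[OF assms(3-5)] \<phi>.measure_region_Diff[OF assms(6-8)] by simp
qed

text \<open>Up to small probability the rejected sets lie between the observations in regions of volumes $s\pm d$ and
$t\pm d$, and the masses of these regions depend on $d$ in a Lipschitz manner.\<close>

lemma joint_frequency_tendsto:
  assumes \<psi>: "depth_function \<psi> V" and \<phi>: "depth_function \<phi> W" and \<alpha>: "0 < \<alpha>"
    and cs: "crosses \<psi> (level \<alpha>) s" and ct: "crosses \<phi> (level \<alpha>) t"
  shows "((\<lambda>(n, \<omega>). real (card (joint b \<psi> \<phi> \<alpha> n \<omega>)) / real n)
    \<longlongrightarrow> mass b (region \<psi> s \<inter> region \<phi> t)) (whp M)"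
proof -
  interpret \<psi>: depth_function \<psi> V by fact
  interpret \<phi>: depth_function \<phi> W by fact
  define R where "R d = region \<psi> (s + d) \<inter> region \<phi> (t + d)" for d
  have st: "0 < s" "s < 1" "0 < t" "t < 1" using cs ct by (auto simp: crosses_def)
  have R: "R d \<in> sets borel" "R d \<subseteq> unit_cube" if "-s \<le> d" "-t \<le> d" "d \<le> 1 - s" "d \<le> 1 - t" for d
    using that region_subset_cube unfolding R_def by (auto intro!: sets.Int)
  have freq: "((\<lambda>(n, \<omega>). real (card (hits b (R d) n \<omega>)) / real n) \<longlongrightarrow> mass b (R d)) (whp M)"
    if "-s \<le> d" "-t \<le> d" "d \<le> 1 - s" "d \<le> 1 - t" for d
    by (rule frequency_tendsto[OF R[OF that]])
  have step: "mass b (R d') \<le> mass b (R d) + peak b * (2 * (d' - d))"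
    if "d \<le> d'" "-s \<le> d" "-t \<le> d" "d' \<le> 1 - s" "d' \<le> 1 - t" for d d'
  proof -
    have sub: "R d \<subseteq> R d'"
      unfolding R_def using that(1) by (intro Int_mono region_mono) auto
    have "mass b (R d') \<le> mass b (R d) + peak b * (measure lborel (R d') - measure lborel (R d))"
      using that by (intro mass_diff(2) sub R) auto
    also have "measure lborel (R d') \<le> measure lborel (R d) + ((s + d') - (s + d)) + ((t + d') - (t + d))"
      unfolding R_def using that by (intro measure_Int_regions_Lipschitz[OF \<psi> \<phi>]) auto
    then have "peak b * (measure lborel (R d') - measure lborel (R d)) \<le> peak b * (2 * (d' - d))"
      using peak_pos[of b] by (intro mult_left_mono) auto
    finally show ?thesis by simp
  qed
  show ?thesis
  proof (rule order_tendstoI)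
    fix y assume y: "y < mass b (region \<psi> s \<inter> region \<phi> t)"
    define e where "e = (mass b (R 0) - y) / (4 * peak b)"
    have e: "0 < e" using y peak_pos[of b] by (simp add: e_def R_def)
    define d where "d = min e (min (s / 2) (t / 2))"
    have d: "0 < d" "d < s" "d < t" "d \<le> e" using e st by (auto simp: d_def min_def)
    have "mass b (R 0) \<le> mass b (R (- d)) + peak b * (2 * (0 - (- d)))"
      using d st by (intro step) auto
    also have "peak b * (2 * (0 - (- d))) \<le> peak b * (2 * e)"
      using d peak_pos[of b] by (intro mult_left_mono) auto
    also have "peak b * (2 * e) < mass b (R 0) - y"
      using y peak_pos[of b] by (simp add: e_def R_def)
    finally have "y < mass b (R (- d))" by simp
    from order_tendstoD(1)[OF freq this] d st
    have "\<forall>\<^sub>F (n, \<omega>) in whp M. y < real (card (hits b (R (- d)) n \<omega>)) / real n"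
      by (simp add: split_def)
    moreover have "\<forall>\<^sub>F x in whp M. observed (region \<psi> (s - d)) (fst x) (snd x) \<subseteq> rejected \<psi> \<alpha> (fst x) (snd x)"
      using d by (intro rejected_superset_whp[OF \<psi> cs]) auto
    moreover have "\<forall>\<^sub>F x in whp M. observed (region \<phi> (t - d)) (fst x) (snd x) \<subseteq> rejected \<phi> \<alpha> (fst x) (snd x)"
      using d by (intro rejected_superset_whp[OF \<phi> ct]) auto
    ultimately show "\<forall>\<^sub>F x in whp M. y < (case x of (n, \<omega>) \<Rightarrow> real (card (joint b \<psi> \<phi> \<alpha> n \<omega>)) / real n)"
    proof eventually_elim
      case (elim x)
      obtain n \<omega> where x: "x = (n, \<omega>)" by fastforce
      have "hits b (R (- d)) n \<omega> \<subseteq> joint b \<psi> \<phi> \<alpha> n \<omega>"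
        using elim(2,3) by (auto simp: x hits_def observed_def joint_def R_def)
      then have "card (hits b (R (- d)) n \<omega>) \<le> card (joint b \<psi> \<phi> \<alpha> n \<omega>)"
        by (intro card_mono) (auto simp: joint_def)
      then have "real (card (hits b (R (- d)) n \<omega>)) / n \<le> real (card (joint b \<psi> \<phi> \<alpha> n \<omega>)) / n"
        by (intro divide_right_mono) auto
      with elim(1) show ?case by (simp add: x)
    qed
  next
    fix y assume y: "mass b (region \<psi> s \<inter> region \<phi> t) < y"
    define e where "e = (y - mass b (R 0)) / (4 * peak b)"
    have e: "0 < e" using y peak_pos[of b] by (simp add: e_def R_def)
    define d where "d = min e (min ((1 - s) / 2) ((1 - t) / 2))"
    have d: "0 < d" "d < 1 - s" "d < 1 - t" "d \<le> e" using e st by (auto simp: d_def min_def field_simps)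
    have "mass b (R d) \<le> mass b (R 0) + peak b * (2 * (d - 0))"
      using d st by (intro step) auto
    also have "peak b * (2 * (d - 0)) \<le> peak b * (2 * e)"
      using d peak_pos[of b] by (intro mult_left_mono) auto
    also have "peak b * (2 * e) < y - mass b (R 0)"
      using y peak_pos[of b] by (simp add: e_def R_def)
    finally have "mass b (R d) < y" by simp
    from order_tendstoD(2)[OF freq this] d st
    have "\<forall>\<^sub>F (n, \<omega>) in whp M. real (card (hits b (R d) n \<omega>)) / real n < y"
      by (simp add: split_def)
    moreover have "\<forall>\<^sub>F x in whp M. rejected \<psi> \<alpha> (fst x) (snd x) \<subseteq> observed (region \<psi> (s + d)) (fst x) (snd x)"
      using d by (intro rejected_subset_whp[OF \<psi> \<alpha> cs]) auto
    moreover have "\<forall>\<^sub>F x in whp M. rejected \<phi> \<alpha> (fst x) (snd x) \<subseteq> observed (region \<phi> (t + d)) (fst x) (snd x)"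
      using d by (intro rejected_subset_whp[OF \<phi> \<alpha> ct]) auto
    ultimately show "\<forall>\<^sub>F x in whp M. (case x of (n, \<omega>) \<Rightarrow> real (card (joint b \<psi> \<phi> \<alpha> n \<omega>)) / real n) < y"
    proof eventually_elim
      case (elim x)
      obtain n \<omega> where x: "x = (n, \<omega>)" by fastforce
      have "joint b \<psi> \<phi> \<alpha> n \<omega> \<subseteq> hits b (R d) n \<omega>"
        using elim(2,3) by (auto simp: x hits_def observed_def joint_def R_def)
      then have "card (joint b \<psi> \<phi> \<alpha> n \<omega>) \<le> card (hits b (R d) n \<omega>)"
        by (intro card_mono) auto
      then have "real (card (joint b \<psi> \<phi> \<alpha> n \<omega>)) / n \<le> real (card (hits b (R d) n \<omega>)) / n"
        by (intro divide_right_mono) auto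
      with elim(1) show ?case by (simp add: x)
    qed
  qed
qed

subsection \<open>Measurability\<close>

lemma card_measurable:
  assumes "\<And>i. Measurable.pred M (P i)"
  shows "(\<lambda>\<omega>. real (card {i. i < (n::nat) \<and> P i \<omega>})) \<in> borel_measurable M"
proof -
  note assms[measurable]
  have "real (card {i. i < n \<and> P i \<omega>}) = (\<Sum>i<n. if P i \<omega> then 1 else 0)" for \<omega>
  proof -
    have "(\<Sum>i<n. if P i \<omega> then 1 else 0) = real (card {i \<in> {..<n}. P i \<omega>})"
      by (subst sum.inter_filter[symmetric]) auto
    then show ?thesis by simp
  qed
  then show ?thesis by simp
qed

lemma rejected_measurable:
  assumes \<psi>: "depth_function \<psi> V" and \<alpha>: "0 < \<alpha>" "\<alpha> < 1"
  shows "Measurable.pred M (\<lambda>\<omega>. i \<in> rejected \<psi> \<alpha> n \<omega>)"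
proof -
  interpret \<psi>: depth_function \<psi> V by fact
  let ?R = "\<lambda>m. region \<psi> (\<alpha> * real m / n)"
  have R: "?R m \<in> sets borel" if "m \<in> {1..n}" for m
  proof -
    have "\<alpha> * real m \<le> 1 * real n" using that \<alpha> by (intro mult_mono) auto
    then show ?thesis using that \<alpha> by (intro \<psi>.region_borel) auto
  qed
  have pred: "Measurable.pred M (\<lambda>\<omega>. i < n \<and> (\<exists>m\<in>{1..n}. \<xi> i \<omega> \<in> ?R m \<and>
      real m \<le> max (real (card {j. j < n \<and> \<xi> j \<omega> \<in> ?R m})) 1))"
  proof (intro pred_intros_logic pred_intros_finite)
    fix m assume m: "m \<in> {1..n}"
    note R[OF m, measurable]
    have [measurable]: "(\<lambda>\<omega>. real (card {j. j < n \<and> \<xi> j \<omega> \<in> ?R m})) \<in> borel_measurable M"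
      by (rule card_measurable) measurable
    show "Measurable.pred M (\<lambda>\<omega>. \<xi> i \<omega> \<in> ?R m)" by measurable
    show "Measurable.pred M (\<lambda>\<omega>. real m \<le> max (real (card {j. j < n \<and> \<xi> j \<omega> \<in> ?R m})) 1)"
      by measurable
  qed auto
  have iff: "i \<in> rejected \<psi> \<alpha> n \<omega> \<longleftrightarrow> i < n \<and> (\<exists>m\<in>{1..n}. \<xi> i \<omega> \<in> ?R m \<and>
      real m \<le> max (real (card {j. j < n \<and> \<xi> j \<omega> \<in> ?R m})) 1)" if "\<omega> \<in> space M" for \<omega>
    unfolding rejected_def reject_BH_iff[OF \<alpha>] by (simp add: score_le_iff[OF that] of_nat_max)
  show ?thesis
    by (rule iffD2[OF measurable_cong pred]) (rule iff)
qed

definition rej_of :: "bool \<Rightarrow> (real ^ 'k \<Rightarrow> real) \<Rightarrow> real \<Rightarrow> nat \<Rightarrow> 'w \<Rightarrow> nat set" where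
  "rej_of b \<psi> \<alpha> n \<omega> = {i \<in> rejected \<psi> \<alpha> n \<omega>. \<theta> i \<omega> = b}"

lemma joint_eq: "joint b \<psi> \<phi> \<alpha> n \<omega> = rej_of b \<psi> \<alpha> n \<omega> \<inter> rej_of b \<phi> \<alpha> n \<omega>"
  by (auto simp: joint_def rej_of_def)

lemma finite_rej_of[simp]: "finite (rej_of b \<psi> \<alpha> n \<omega>)"
  by (simp add: rej_of_def)

lemma joint_measurable:
  assumes "depth_function \<psi> V" "depth_function \<phi> W" "0 < \<alpha>" "\<alpha> < 1"
  shows "(\<lambda>\<omega>. real (card (rej_of b \<psi> \<alpha> n \<omega> \<inter> rej_of b \<phi> \<alpha> n \<omega>))) \<in> borel_measurable M"
proof -
  note [measurable] = rejected_measurable[OF assms(1,3,4)] rejected_measurable[OF assms(2,3,4)]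
  have "rej_of b \<psi> \<alpha> n \<omega> \<inter> rej_of b \<phi> \<alpha> n \<omega>
      = {i. i < n \<and> (i \<in> rejected \<psi> \<alpha> n \<omega> \<and> i \<in> rejected \<phi> \<alpha> n \<omega> \<and> \<theta> i \<omega> = b)}" for \<omega>
    using rejected_lessThan[of \<psi> \<alpha> n \<omega>] by (auto simp: rej_of_def)
  moreover have "(\<lambda>\<omega>. real (card {i. i < n \<and> (i \<in> rejected \<psi> \<alpha> n \<omega> \<and> i \<in> rejected \<phi> \<alpha> n \<omega> \<and> \<theta> i \<omega> = b)}))
      \<in> borel_measurable M"
    by (rule card_measurable) measurable
  ultimately show ?thesis by simp
qed

lemma rej_of_measurable:
  assumes "depth_function \<psi> V" "0 < \<alpha>" "\<alpha> < 1"
  shows "(\<lambda>\<omega>. real (card (rej_of b \<psi> \<alpha> n \<omega>))) \<in> borel_measurable M"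
  using joint_measurable[OF assms(1,1,2,3), of b n] by simp

lemma rej_of_frequency_tendsto:
  assumes "depth_function \<psi> V" "0 < \<alpha>" "crosses \<psi> (level \<alpha>) s"
  shows "((\<lambda>(n, \<omega>). real (card (rej_of b \<psi> \<alpha> n \<omega>)) / real n) \<longlongrightarrow> mass b (region \<psi> s)) (whp M)"
  using joint_frequency_tendsto[OF assms(1,1,2,3,3), of b] by (simp add: joint_eq)

lemma diff_ratio_eq:
  assumes "finite A" "finite B"
  shows "diff_ratio A B = (real (card A) + real (card B) - 2 * real (card (A \<inter> B))) / real (card (A \<inter> B))"
proof -
  have "sym_diff A B = (A - A \<inter> B) \<union> (B - A \<inter> B)" by auto
  then have "card (sym_diff A B) = card (A - A \<inter> B) + card (B - A \<inter> B)"
    using assms by (simp only:) (intro card_Un_disjoint, auto)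
  also have "\<dots> = (card A - card (A \<inter> B)) + (card B - card (A \<inter> B))"
    using assms by (simp add: card_Diff_subset)
  finally have "real (card (sym_diff A B)) = real (card A) + real (card B) - 2 * real (card (A \<inter> B))"
    using card_mono[OF assms(1), of "A \<inter> B"] card_mono[OF assms(2), of "A \<inter> B"] by simp
  then show ?thesis by (simp add: diff_ratio_def)
qed

text \<open>The limit of \<open>diff_ratio\<close>, from $|A\triangle B|=|A|+|B|-2|A\cap B|$.\<close>

definition overlap_ratio :: "bool \<Rightarrow> (real ^ 'k) set \<Rightarrow> (real ^ 'k) set \<Rightarrow> real" where
  "overlap_ratio b A B = (mass b A + mass b B - 2 * mass b (A \<inter> B)) / mass b (A \<inter> B)"

lemma diff_ratio_tendsto_in_prob:
  assumes \<psi>: "depth_function \<psi> V" and \<phi>: "depth_function \<phi> W" and \<alpha>: "0 < \<alpha>" "\<alpha> < 1"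
    and cs: "crosses \<psi> (level \<alpha>) s" and ct: "crosses \<phi> (level \<alpha>) t"
    and pos: "mass b (region \<psi> s \<inter> region \<phi> t) \<noteq> 0"
  shows "tendsto_in_prob M (\<lambda>n \<omega>. diff_ratio (rej_of b \<psi> \<alpha> n \<omega>) (rej_of b \<phi> \<alpha> n \<omega>))
    (overlap_ratio b (region \<psi> s) (region \<phi> t))"
proof (rule tendsto_in_prob_whp)
  note [measurable] = joint_measurable[OF \<psi> \<phi> \<alpha>] rej_of_measurable[OF \<psi> \<alpha>] rej_of_measurable[OF \<phi> \<alpha>]
  show "(\<lambda>\<omega>. diff_ratio (rej_of b \<psi> \<alpha> n \<omega>) (rej_of b \<phi> \<alpha> n \<omega>)) \<in> borel_measurable M" for n
    unfolding diff_ratio_eq[OF finite_rej_of finite_rej_of] by measurable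
  let ?A = "\<lambda>x. real (card (rej_of b \<psi> \<alpha> (fst x) (snd x))) / real (fst x)"
  let ?B = "\<lambda>x. real (card (rej_of b \<phi> \<alpha> (fst x) (snd x))) / real (fst x)"
  let ?I = "\<lambda>x. real (card (rej_of b \<psi> \<alpha> (fst x) (snd x) \<inter> rej_of b \<phi> \<alpha> (fst x) (snd x))) / real (fst x)"
  have "((\<lambda>x. (?A x + ?B x - 2 * ?I x) / ?I x) \<longlongrightarrow> overlap_ratio b (region \<psi> s) (region \<phi> t)) (whp M)"
    unfolding overlap_ratio_def
    using rej_of_frequency_tendsto[OF \<psi> \<alpha>(1) cs, of b] rej_of_frequency_tendsto[OF \<phi> \<alpha>(1) ct, of b]
      joint_frequency_tendsto[OF \<psi> \<phi> \<alpha>(1) cs ct, of b]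
    by (intro tendsto_divide tendsto_diff tendsto_add tendsto_mult tendsto_const pos)
       (simp_all add: split_def joint_eq)
  moreover have "\<forall>\<^sub>F x in whp M. 0 < fst x"
    using eventually_whp_of_sequentially[OF eventually_gt_at_top[of 0]] by (simp add: split_def)
  then have "\<forall>\<^sub>F x in whp M. (?A x + ?B x - 2 * ?I x) / ?I x
      = (case x of (n, \<omega>) \<Rightarrow> diff_ratio (rej_of b \<psi> \<alpha> n \<omega>) (rej_of b \<phi> \<alpha> n \<omega>))"
  proof eventually_elim
    case (elim x)
    have "(?A x + ?B x - 2 * ?I x) = (real (card (rej_of b \<psi> \<alpha> (fst x) (snd x)))
        + real (card (rej_of b \<phi> \<alpha> (fst x) (snd x)))
        - 2 * real (card (rej_of b \<psi> \<alpha> (fst x) (snd x) \<inter> rej_of b \<phi> \<alpha> (fst x) (snd x)))) / real (fst x)"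
      by (simp add: add_divide_distrib diff_divide_distrib)
    then show ?case using elim by (simp add: split_def diff_ratio_eq)
  qed
  ultimately show "((\<lambda>(n, \<omega>). diff_ratio (rej_of b \<psi> \<alpha> n \<omega>) (rej_of b \<phi> \<alpha> n \<omega>))
      \<longlongrightarrow> overlap_ratio b (region \<psi> s) (region \<phi> t)) (whp M)"
    by (rule Lim_transform_eventually)
qed

lemma power_tendsto:
  assumes \<psi>: "depth_function \<psi> V" and \<alpha>: "0 < \<alpha>" "\<alpha> < 1" and cs: "crosses \<psi> (level \<alpha>) s"
    and rej: "\<And>n \<omega>. \<omega> \<in> space M \<Longrightarrow> rej n (\<lambda>j. \<xi> j \<omega>) = rejected \<psi> \<alpha> n \<omega>"
  shows "avg_power M rej \<theta> \<xi> \<longlonglongrightarrow> mass True (region \<psi> s) / a"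
proof -
  interpret \<psi>: depth_function \<psi> V by fact
  define X where "X n \<omega> = real (card (rej_of True \<psi> \<alpha> n \<omega>)) / max (real (card (hits True unit_cube n \<omega>))) 1" for n \<omega>
  have s: "0 < s" "s < 1" using cs by (auto simp: crosses_def)
  have hits: "hits True unit_cube n \<omega> = {i. i < n \<and> \<theta> i \<omega>}" if "\<omega> \<in> space M" for n \<omega>
    using in_cube[OF that] by (auto simp: hits_def)
  have avg: "avg_power M rej \<theta> \<xi> n = (\<integral>\<omega>. X n \<omega> \<partial>M)" for n
    unfolding avg_power_def
  proof (rule Bochner_Integration.integral_cong[OF refl])
    fix \<omega> assume \<omega>: "\<omega> \<in> space M"
    have "card (rejected \<psi> \<alpha> n \<omega>) = card (rej_of True \<psi> \<alpha> n \<omega> \<union> rej_of False \<psi> \<alpha> n \<omega>)"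
      by (rule arg_cong[of _ _ card]) (auto simp: rej_of_def)
    also have "\<dots> = card (rej_of True \<psi> \<alpha> n \<omega>) + card (rej_of False \<psi> \<alpha> n \<omega>)"
      by (rule card_Un_disjoint) (auto simp: rej_of_def)
    finally have R: "real (card (rejected \<psi> \<alpha> n \<omega>)) - real (card (rej_of False \<psi> \<alpha> n \<omega>))
        = real (card (rej_of True \<psi> \<alpha> n \<omega>))" by simp
    have "n = card ({i. i < n \<and> \<theta> i \<omega>} \<union> {i. i < n \<and> \<not> \<theta> i \<omega>})"
    proof -
      have "{i. i < n \<and> \<theta> i \<omega>} \<union> {i. i < n \<and> \<not> \<theta> i \<omega>} = {..<n}" by auto
      then show ?thesis by simp
    qed
    also have "\<dots> = card {i. i < n \<and> \<theta> i \<omega>} + card {i. i < n \<and> \<not> \<theta> i \<omega>}"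
      by (rule card_Un_disjoint) auto
    finally have "real n = real (card {i. i < n \<and> \<theta> i \<omega>} + card {i. i < n \<and> \<not> \<theta> i \<omega>})"
      by (rule arg_cong)
    then have N: "real n - real (card {i. i < n \<and> \<not> \<theta> i \<omega>}) = real (card {i. i < n \<and> \<theta> i \<omega>})" by simp
    have "true_rej rej \<theta> \<xi> n \<omega> = rej_of False \<psi> \<alpha> n \<omega>"
      using rej[OF \<omega>] by (simp add: true_rej_def rej_of_def)
    then show "(let R = real (card (rej n (\<lambda>j. \<xi> j \<omega>))); V = real (card (true_rej rej \<theta> \<xi> n \<omega>));
        N = real (card {i. i < n \<and> \<not> \<theta> i \<omega>}) in (R - V) / max (real n - N) 1) = X n \<omega>"
      by (simp add: Let_def rej[OF \<omega>] R N X_def hits[OF \<omega>])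
  qed
  have cube_mass: "mass True unit_cube = a"
    using prob_eq_mass[of unit_cube 0 True] prob_false[of 0] in_cube
    by (simp cong: conj_cong)
  have rb: "region \<psi> s \<in> sets borel" using s by auto
  have mass_le: "0 \<le> mass True (region \<psi> s)" "mass True (region \<psi> s) \<le> a"
    using prob_eq_mass[OF rb region_subset_cube, of 0 True] mass_diff(1)[OF rb _ region_subset_cube order_refl, of True]
    unfolding cube_mass by (metis measure_nonneg, simp)
  note [measurable] = rej_of_measurable[OF \<psi> \<alpha>]
  have [measurable]: "(\<lambda>\<omega>. real (card (hits True unit_cube n \<omega>))) \<in> borel_measurable M" for n
    unfolding hits_def by (rule card_measurable) measurable
  have "(\<lambda>n. \<integral>\<omega>. X n \<omega> \<partial>M) \<longlonglongrightarrow> mass True (region \<psi> s) / a"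
  proof (rule integral_tendsto_whp)
    show "X n \<in> borel_measurable M" for n unfolding X_def by measurable
    show "0 \<le> X n \<omega> \<and> X n \<omega> \<le> 1" if "\<omega> \<in> space M" for n \<omega>
    proof -
      have "card (rej_of True \<psi> \<alpha> n \<omega>) \<le> card (hits True unit_cube n \<omega>)"
        using rejected_lessThan[of \<psi> \<alpha> n \<omega>] in_cube[OF that]
        by (intro card_mono) (auto simp: rej_of_def hits_def)
      then show ?thesis by (simp add: X_def)
    qed
    show "0 \<le> mass True (region \<psi> s) / a" "mass True (region \<psi> s) / a \<le> 1"
      using mass_le a_range by auto
    let ?A = "\<lambda>x. real (card (rej_of True \<psi> \<alpha> (fst x) (snd x))) / real (fst x)"
    let ?H = "\<lambda>x. real (card (hits True unit_cube (fst x) (snd x))) / real (fst x)"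
    have H: "(?H \<longlongrightarrow> a) (whp M)"
      using frequency_tendsto[of unit_cube True] by (simp add: split_def cube_mass)
    have inv: "((\<lambda>x. 1 / real (fst x)) \<longlongrightarrow> 0) (whp M)"
      using tendsto_whp_of_sequentially[OF lim_1_over_n] by (simp add: split_def)
    have "((\<lambda>x. ?A x / max (?H x) (1 / real (fst x))) \<longlongrightarrow> mass True (region \<psi> s) / max a 0) (whp M)"
      using rej_of_frequency_tendsto[OF \<psi> \<alpha>(1) cs, of True] a_range
      by (intro tendsto_divide tendsto_max H inv) (auto simp: split_def)
    then have "((\<lambda>x. ?A x / max (?H x) (1 / real (fst x))) \<longlongrightarrow> mass True (region \<psi> s) / a) (whp M)"
      using a_range by (simp add: max_def)
    moreover have "\<forall>\<^sub>F x in whp M. 0 < fst x"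
      using eventually_whp_of_sequentially[OF eventually_gt_at_top[of 0]] by (simp add: split_def)
    then have "\<forall>\<^sub>F x in whp M. ?A x / max (?H x) (1 / real (fst x)) = (case x of (n, \<omega>) \<Rightarrow> X n \<omega>)"
    proof eventually_elim
      case (elim x)
      then have "max (?H x) (1 / real (fst x)) = max (real (card (hits True unit_cube (fst x) (snd x)))) 1 / real (fst x)"
        by (simp add: max_def divide_le_cancel)
      then show ?case using elim by (simp add: X_def split_def)
    qed
    ultimately show "((\<lambda>(n, \<omega>). X n \<omega>) \<longlongrightarrow> mass True (region \<psi> s) / a) (whp M)"
      by (rule Lim_transform_eventually)
  qed
  moreover have "avg_power M rej \<theta> \<xi> = (\<lambda>n. \<integral>\<omega>. X n \<omega> \<partial>M)" by (rule ext) (rule avg)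
  ultimately show ?thesis by simp
qed

subsection \<open>The two procedures as step-up rules on scores\<close>

lemma reject_o_eq:
  assumes "\<omega> \<in> space M"
  shows "reject_o g \<alpha> n (\<lambda>j. \<xi> j \<omega>) = rejected deficit \<alpha> n \<omega>"
proof -
  have D: "{i. i < n \<and> \<xi> i \<omega> \<in> D_o g t} = {i. i < n \<and> score deficit (\<xi> i \<omega>) \<le> t}"
    if "t \<in> {0..1}" for t
    using that D_o_eq_region[of t] by (simp add: score_le_iff[OF assms])
  then have "threshold \<alpha> n (\<lambda>t. {i. i < n \<and> \<xi> i \<omega> \<in> D_o g t})
      = threshold \<alpha> n (\<lambda>t. {i. i < n \<and> score deficit (\<xi> i \<omega>) \<le> t})"
    unfolding threshold_def by (intro arg_cong[of _ _ Sup] Collect_cong conj_cong) simp_all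
  then show ?thesis
    unfolding reject_o_def Let_def rejected_def reject_BH_def
    using D[OF threshold_bounds] by simp
qed

lemma reject_eq: "reject \<epsilon> \<gamma> \<alpha> n (\<lambda>j. \<xi> j \<omega>) = rejected f \<alpha> n \<omega>"
  by (simp add: reject_def rejected_def score_def vol_def sublevel_def h_gamma_def f_def)

subsection \<open>The critical level\<close>

lemma alpha_star_pos: "0 < alpha_star a g"
  using a_range g0_pos by (simp add: alpha_star_def add_pos_pos)

lemma mean_deficit_1: "mean_deficit deficit 1 = 1 - 1 / g 0"
proof -
  have "measure lborel (unit_cube :: (real ^ 'k) set) = 1"
    by (simp add: measure_def emeasure_unit_cube)
  have "region deficit 1 = unit_cube"
  proof -
    have "score deficit x \<le> 1" if "x \<in> unit_cube" for x
      using deficit.vol_mono[OF deficit.bound[OF that]] deficit.vol_V by (simp add: score_def)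
    then show ?thesis by (auto simp: region_def)
  qed
  moreover have g_int: "set_integrable lborel unit_cube g"
    by (rule set_integrable_cube[OF g_cont]) auto
  have "(LINT x:unit_cube|lborel. g x) = 1"
    using set_borel_integral_eq_integral(2)[OF g_int] g_integral by (simp add: integral_unique)
  moreover have "(LINT x:unit_cube|lborel. 1 - g x / g 0)
      = (LINT x:(unit_cube :: (real ^ 'k) set)|lborel. 1) - (LINT x:unit_cube|lborel. g x / g 0)"
    by (intro set_integral_diff set_integrable_divide g_int set_integrable_const_cube) auto
  moreover have "(LINT x:(unit_cube :: (real ^ 'k) set)|lborel. 1) = (1 :: real)"
    by (simp add: set_lebesgue_integral_def measure_def emeasure_unit_cube)
  ultimately show ?thesis by (simp add: mean_deficit_def deficit_def)
qed

text \<open>A density on a cube of volume $1$ with a strict maximum exceeds $1$ there; equivalently the mean deficit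
over the cube is positive.\<close>

lemma g0_gt_1: "1 < g 0"
proof -
  have "0 * measure lborel (region deficit (1/2)) \<le> (LINT x:region deficit (1/2)|lborel. deficit x)"
    using region_subset_cube[of deficit "1/2"]
    by (intro integral_ge_const_cube[OF deficit_cont] deficit.nonneg) auto
  then have "0 \<le> mean_deficit deficit (1/2)" by (simp add: mean_deficit_def)
  also have "\<dots> < mean_deficit deficit 1" by (rule mean_deficit_deficit_strict_mono) auto
  finally show ?thesis using g0_pos by (simp add: mean_deficit_1)
qed

lemma alpha_star_less_1: "alpha_star a g < 1"
proof -
  have "a * 1 < a * g 0" using a_range g0_gt_1 by (intro mult_strict_left_mono) auto
  then have "1 < 1 - a + a * g 0" by linarith
  then show ?thesis by (simp add: alpha_star_def)
qed

lemma level_range: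
  assumes "alpha_star a g < \<alpha>" "\<alpha> < 1"
  shows "0 < level \<alpha>" "level \<alpha> < mean_deficit deficit 1"
proof -
  have \<alpha>: "0 < \<alpha>" using alpha_star_pos assms by simp
  have "1 / \<alpha> < 1 / alpha_star a g"
    using assms alpha_star_pos by (intro divide_strict_left_mono) auto
  then show "0 < level \<alpha>" using a_range g0_pos by (simp add: level_def)
  have "1 < 1 / \<alpha>" using assms \<alpha> by simp
  then have "1 / alpha_star a g - 1 / \<alpha> < a * g 0 - a" by (simp add: alpha_star_def)
  then have "level \<alpha> < (a * g 0 - a) / (a * g 0)"
    unfolding level_def using a_range g0_pos by (intro divide_strict_right_mono) auto
  also have "\<dots> = mean_deficit deficit 1" using a_range g0_pos by (simp add: mean_deficit_1 diff_divide_distrib)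
  finally show "level \<alpha> < mean_deficit deficit 1" .
qed

lemma level_tendsto_0: "(level \<longlongrightarrow> 0) (at_right (alpha_star a g))"
  unfolding level_def[abs_def] using alpha_star_pos a_range g0_pos
  by (auto intro!: tendsto_eq_intros)

text \<open>The limiting thresholds of the two procedures. The second one is a crossing only for $\alpha$ near
$\alpha_*$; see \<open>t_h_crosses\<close>.\<close>

definition s_o :: "real \<Rightarrow> real" where
  "s_o \<alpha> = (SOME s. crosses deficit (level \<alpha>) s)"

definition t_h :: "real \<Rightarrow> real" where
  "t_h \<alpha> = (SOME t. crosses f (level \<alpha>) t)"

lemma s_o_crosses:
  assumes "alpha_star a g < \<alpha>" "\<alpha> < 1"
  shows "crosses deficit (level \<alpha>) (s_o \<alpha>)"
  unfolding s_o_def by (rule someI_ex) (rule crosses_deficit_exists[OF level_range[OF assms]])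

lemma eventually_at_critical:
  "\<forall>\<^sub>F \<alpha> in at_right (alpha_star a g). alpha_star a g < \<alpha> \<and> \<alpha> < 1"
  using eventually_at_right_real[OF alpha_star_less_1] by eventually_elim simp

lemma t_h_crosses:
  "\<forall>\<^sub>F \<alpha> in at_right (alpha_star a g). crosses f (level \<alpha>) (t_h \<alpha>)"
proof -
  obtain b0 where b0: "0 < b0" "\<And>b. 0 < b \<Longrightarrow> b < b0 \<Longrightarrow> \<exists>t. crosses f b t"
    using crosses_f_exists by blast
  show ?thesis
    using order_tendstoD(2)[OF level_tendsto_0 b0(1)] eventually_at_critical
  proof eventually_elim
    case (elim \<alpha>)
    then have "\<exists>t. crosses f (level \<alpha>) t" by (intro b0(2) level_range) auto
    then show ?case unfolding t_h_def by (rule someI_ex)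
  qed
qed

definition A_o :: "real \<Rightarrow> (real ^ 'k) set" where
  "A_o \<alpha> = region deficit (s_o \<alpha>)"

definition A_h :: "real \<Rightarrow> (real ^ 'k) set" where
  "A_h \<alpha> = region f (t_h \<alpha>)"

text \<open>On the two crossing regions $\rho g(0)\le g\le g(0)$, so every mass equals the volume times \<open>peak b\<close> up to
a factor in $[\rho,1]$. Together with $t\le s\le t/\rho$ and a volume of at least $\rho t$ for the
intersection this bounds all the ratios.\<close>

lemma critical_masses:
  assumes \<rho>: "0 < \<rho>" "\<rho> < 1"
  shows "\<forall>\<^sub>F \<alpha> in at_right (alpha_star a g). \<forall>b.
     0 < mass b (A_o \<alpha> \<inter> A_h \<alpha>) \<and>
     0 \<le> overlap_ratio b (A_o \<alpha>) (A_h \<alpha>) \<and>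
     overlap_ratio b (A_o \<alpha>) (A_h \<alpha>) \<le> (1 / \<rho> + 1) / \<rho>\<^sup>2 - 2 \<and>
     \<rho> \<le> mass b (A_o \<alpha>) / mass b (A_h \<alpha>) \<and> mass b (A_o \<alpha>) / mass b (A_h \<alpha>) \<le> 1 / \<rho>\<^sup>2"
proof -
  obtain b0 where b0: "0 < b0" and eq: "\<And>b s t. b < b0 \<Longrightarrow> crosses deficit b s \<Longrightarrow> crosses f b t \<Longrightarrow>
      \<rho> * t \<le> measure lborel (region deficit s \<inter> region f t) \<and> \<rho> * s \<le> t \<and>
      (\<forall>x\<in>region deficit s \<union> region f t. \<rho> * g 0 \<le> g x)"
    using regions_asymptotically_equal[OF \<rho>] by blast
  show ?thesis
    using order_tendstoD(2)[OF level_tendsto_0 b0] eventually_at_critical t_h_crosses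
  proof eventually_elim
    case (elim \<alpha>)
    define s t where "s = s_o \<alpha>" and "t = t_h \<alpha>"
    have cs: "crosses deficit (level \<alpha>) s" using s_o_crosses elim by (simp add: s_def)
    have ct: "crosses f (level \<alpha>) t" using elim by (simp add: t_def)
    have st: "0 < t" "t \<le> s" "s \<le> 1" "0 \<le> t" "t \<le> 1" "0 \<le> s"
      using cs ct crosses_f_le_crosses_deficit[OF cs ct] by (auto simp: crosses_def)
    let ?A = "region deficit s" and ?B = "region f t"
    have A: "?A \<in> sets borel" "?A \<subseteq> unit_cube" using st region_subset_cube by auto
    have B: "?B \<in> sets borel" "?B \<subseteq> unit_cube" using st region_subset_cube by auto
    have I: "?A \<inter> ?B \<in> sets borel" "?A \<inter> ?B \<subseteq> unit_cube" using A B by auto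
    have ov: "\<rho> * t \<le> measure lborel (?A \<inter> ?B)" and ts: "\<rho> * s \<le> t"
      and g: "\<And>x. x \<in> ?A \<union> ?B \<Longrightarrow> \<rho> * g 0 \<le> g x"
      using eq[OF elim(1) cs ct] by auto
    have main: "0 < mass b (?A \<inter> ?B) \<and> 0 \<le> overlap_ratio b ?A ?B \<and>
       overlap_ratio b ?A ?B \<le> (1 / \<rho> + 1) / \<rho>\<^sup>2 - 2 \<and>
       \<rho> \<le> mass b ?A / mass b ?B \<and> mass b ?A / mass b ?B \<le> 1 / \<rho>\<^sup>2" for b
    proof -
      let ?c = "peak b"
      let ?mA = "mass b ?A" and ?mB = "mass b ?B" and ?mI = "mass b (?A \<inter> ?B)"
      have c: "0 < ?c" by (rule peak_pos)
      have IA: "?mI \<le> ?mA" and IB: "?mI \<le> ?mB"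
        using mass_diff(1)[OF I(1) A(1) _ A(2)] mass_diff(1)[OF I(1) B(1) _ B(2)] by auto
      have upA: "?mA \<le> ?c * s" using mass_upper[OF A, of b] st by (simp add: deficit.measure_region)
      have upB: "?mB \<le> ?c * t" using mass_upper[OF B, of b] st by (simp add: depth.measure_region)
      have loA: "\<rho> * (?c * s) \<le> ?mA"
        using mass_lower[OF A, of \<rho> b] \<rho> g st by (simp add: deficit.measure_region mult.assoc)
      have loB: "\<rho> * (?c * t) \<le> ?mB"
        using mass_lower[OF B, of \<rho> b] \<rho> g st by (simp add: depth.measure_region mult.assoc)
      have loI: "\<rho>\<^sup>2 * (?c * t) \<le> ?mI"
      proof -
        have "\<rho> * ?c * (\<rho> * t) \<le> \<rho> * ?c * measure lborel (?A \<inter> ?B)"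
          using ov \<rho> c by (intro mult_left_mono) auto
        also have "\<dots> \<le> ?mI" using \<rho> g by (intro mass_lower[OF I]) auto
        finally show ?thesis by (simp add: power2_eq_square mult_ac)
      qed
      have T: "0 < ?c * t" using c st by simp
      then have posI: "0 < ?mI" using loI \<rho> by (intro less_le_trans[OF _ loI]) simp
      have posB: "0 < ?mB" using posI IB by simp
      have s_le: "?c * s \<le> ?c * t / \<rho>"
        using ts \<rho> c by (simp add: field_simps)
      have "?mA + ?mB \<le> (1 / \<rho> + 1) * (?c * t)" using upA upB s_le by (simp add: algebra_simps)
      also have "\<dots> \<le> (1 / \<rho> + 1) * (?mI / \<rho>\<^sup>2)"
        using loI \<rho> by (intro mult_left_mono) (auto simp: field_simps)
      finally have "(?mA + ?mB) / ?mI \<le> (1 / \<rho> + 1) / \<rho>\<^sup>2"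
        using posI by (simp add: divide_le_eq)
      then have up: "overlap_ratio b ?A ?B \<le> (1 / \<rho> + 1) / \<rho>\<^sup>2 - 2"
        using posI by (simp add: overlap_ratio_def diff_divide_distrib)
      have lo: "0 \<le> overlap_ratio b ?A ?B"
        unfolding overlap_ratio_def using posI IA IB by (intro divide_nonneg_pos) auto
      have "?c * t \<le> ?c * s" using st c by (intro mult_left_mono) auto
      then have "\<rho> * ?mB \<le> \<rho> * (?c * s)" using upB \<rho> by (intro mult_left_mono) auto
      then have "\<rho> \<le> ?mA / ?mB" using loA posB by (simp add: le_divide_eq)
      moreover have "?mA / ?mB \<le> 1 / \<rho>\<^sup>2"
      proof -
        have "?c * t \<le> ?mB / \<rho>" using loB \<rho> by (simp add: field_simps)
        then have "?c * t / \<rho> \<le> ?mB / \<rho> / \<rho>" using \<rho> by (intro divide_right_mono) auto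
        then have "?mA \<le> ?mB / \<rho>\<^sup>2" using upA s_le by (simp add: power2_eq_square)
        then show ?thesis using posB by (simp add: divide_le_eq)
      qed
      ultimately show ?thesis using posI lo up by blast
    qed
    then show ?case by (simp add: A_o_def A_h_def s_def t_def)
  qed
qed

lemma overlap_ratio_tendsto_0:
  "((\<lambda>\<alpha>. overlap_ratio b (A_o \<alpha>) (A_h \<alpha>)) \<longlongrightarrow> 0) (at_right (alpha_star a g))"
proof (rule tendstoI)
  fix e :: real assume e: "0 < e"
  have "((\<lambda>\<rho>. (1 / \<rho> + 1) / \<rho>\<^sup>2 - 2 :: real) \<longlongrightarrow> 0) (at_left 1)"
    by (auto intro!: tendsto_eq_intros)
  from order_tendstoD(2)[OF this e] eventually_at_left_real[OF zero_less_one]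
  have "\<forall>\<^sub>F \<rho> in at_left 1. (1 / \<rho> + 1) / \<rho>\<^sup>2 - 2 < e \<and> 0 < \<rho> \<and> \<rho> < 1"
    by eventually_elim auto
  then obtain \<rho> where \<rho>: "0 < \<rho>" "\<rho> < 1" "(1 / \<rho> + 1) / \<rho>\<^sup>2 - 2 < e"
    using eventually_happens'[OF trivial_limit_at_left_real] by blast
  show "\<forall>\<^sub>F \<alpha> in at_right (alpha_star a g). dist (overlap_ratio b (A_o \<alpha>) (A_h \<alpha>)) 0 < e"
    using critical_masses[OF \<rho>(1,2)]
  proof eventually_elim
    case (elim \<alpha>)
    then have "0 \<le> overlap_ratio b (A_o \<alpha>) (A_h \<alpha>)"
        "overlap_ratio b (A_o \<alpha>) (A_h \<alpha>) \<le> (1 / \<rho> + 1) / \<rho>\<^sup>2 - 2" by blast+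
    then show ?case using \<rho>(3) by (simp add: dist_real_def)
  qed
qed

lemma mass_ratio_tendsto_1:
  "((\<lambda>\<alpha>. mass b (A_o \<alpha>) / mass b (A_h \<alpha>)) \<longlongrightarrow> 1) (at_right (alpha_star a g))"
proof (rule tendstoI)
  fix e :: real assume e: "0 < e"
  have "((\<lambda>\<rho>. 1 / \<rho>\<^sup>2 :: real) \<longlongrightarrow> 1) (at_left 1)"
    by (auto intro!: tendsto_eq_intros)
  from order_tendstoD(2)[OF this, of "1 + e"] e eventually_at_left_real[of "max 0 (1 - e)" 1]
  have "\<forall>\<^sub>F \<rho> in at_left 1. 1 / \<rho>\<^sup>2 < 1 + e" "\<forall>\<^sub>F \<rho> in at_left 1. \<rho> \<in> {max 0 (1 - e)<..<1}"
    by simp_all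
  then have "\<forall>\<^sub>F \<rho> in at_left 1. 1 / \<rho>\<^sup>2 < 1 + e \<and> 0 < \<rho> \<and> \<rho> < 1 \<and> 1 - e < \<rho>"
    by eventually_elim auto
  then obtain \<rho> where \<rho>: "0 < \<rho>" "\<rho> < 1" "1 / \<rho>\<^sup>2 < 1 + e" "1 - e < \<rho>"
    using eventually_happens'[OF trivial_limit_at_left_real] by blast
  show "\<forall>\<^sub>F \<alpha> in at_right (alpha_star a g). dist (mass b (A_o \<alpha>) / mass b (A_h \<alpha>)) 1 < e"
    using critical_masses[OF \<rho>(1,2)]
  proof eventually_elim
    case (elim \<alpha>)
    then have "\<rho> \<le> mass b (A_o \<alpha>) / mass b (A_h \<alpha>)" "mass b (A_o \<alpha>) / mass b (A_h \<alpha>) \<le> 1 / \<rho>\<^sup>2"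
      by blast+
    then show ?case using \<rho> by (simp add: dist_real_def abs_less_iff)
  qed
qed

lemma rej_of_reject:
  assumes "\<omega> \<in> space M"
  shows "false_rej (reject_o g \<alpha>) \<theta> \<xi> n \<omega> = rej_of True deficit \<alpha> n \<omega>"
    and "true_rej (reject_o g \<alpha>) \<theta> \<xi> n \<omega> = rej_of False deficit \<alpha> n \<omega>"
    and "false_rej (reject \<epsilon> \<gamma> \<alpha>) \<theta> \<xi> n \<omega> = rej_of True f \<alpha> n \<omega>"
    and "true_rej (reject \<epsilon> \<gamma> \<alpha>) \<theta> \<xi> n \<omega> = rej_of False f \<alpha> n \<omega>"
  by (simp_all add: false_rej_def true_rej_def rej_of_def reject_o_eq[OF assms] reject_eq)

lemma tendsto_in_prob_cong:
  assumes "\<And>n \<omega>. \<omega> \<in> space M \<Longrightarrow> X n \<omega> = Y n \<omega>"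
  shows "tendsto_in_prob M X c \<longleftrightarrow> tendsto_in_prob M Y c"
proof -
  have "X n \<in> borel_measurable M \<longleftrightarrow> Y n \<in> borel_measurable M" for n
    using assms by (intro measurable_cong)
  moreover have "{\<omega> \<in> space M. \<bar>X n \<omega> - c\<bar> > e} = {\<omega> \<in> space M. \<bar>Y n \<omega> - c\<bar> > e}" for n e
    using assms by auto
  ultimately show ?thesis by (simp add: tendsto_in_prob_def)
qed

lemma power_o_tendsto:
  assumes "alpha_star a g < \<alpha>" "\<alpha> < 1"
  shows "avg_power M (reject_o g \<alpha>) \<theta> \<xi> \<longlonglongrightarrow> mass True (A_o \<alpha>) / a"
  unfolding A_o_def using assms alpha_star_pos
  by (intro power_tendsto[OF deficit.depth_function_axioms _ _ s_o_crosses reject_o_eq]) auto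

lemma limits_at_critical:
  "\<forall>\<^sub>F \<alpha> in at_right (alpha_star a g). \<alpha> < 1 \<and>
     avg_power M (reject \<epsilon> \<gamma> \<alpha>) \<theta> \<xi> \<longlonglongrightarrow> mass True (A_h \<alpha>) / a \<and>
     tendsto_in_prob M
       (\<lambda>n \<omega>. diff_ratio (false_rej (reject_o g \<alpha>) \<theta> \<xi> n \<omega>) (false_rej (reject \<epsilon> \<gamma> \<alpha>) \<theta> \<xi> n \<omega>))
       (overlap_ratio True (A_o \<alpha>) (A_h \<alpha>)) \<and>
     tendsto_in_prob M
       (\<lambda>n \<omega>. diff_ratio (true_rej (reject_o g \<alpha>) \<theta> \<xi> n \<omega>) (true_rej (reject \<epsilon> \<gamma> \<alpha>) \<theta> \<xi> n \<omega>))
       (overlap_ratio False (A_o \<alpha>) (A_h \<alpha>))"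
proof -
  have "(0 :: real) < 1/2" "(1/2 :: real) < 1" by simp_all
  from critical_masses[OF this] eventually_at_critical t_h_crosses
  show ?thesis
  proof eventually_elim
    case (elim \<alpha>)
    then have \<alpha>: "0 < \<alpha>" "\<alpha> < 1" using alpha_star_pos by auto
    have cs: "crosses deficit (level \<alpha>) (s_o \<alpha>)" using elim s_o_crosses by blast
    have pos: "mass b (region deficit (s_o \<alpha>) \<inter> region f (t_h \<alpha>)) \<noteq> 0" for b
      using elim(1) unfolding A_o_def A_h_def by (metis less_irrefl)
    have "avg_power M (reject \<epsilon> \<gamma> \<alpha>) \<theta> \<xi> \<longlonglongrightarrow> mass True (A_h \<alpha>) / a"
      unfolding A_h_def
      by (rule power_tendsto[OF depth.depth_function_axioms \<alpha> elim(3) reject_eq])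
    moreover note lim = diff_ratio_tendsto_in_prob[OF deficit.depth_function_axioms
        depth.depth_function_axioms \<alpha> cs elim(3) pos, folded A_o_def A_h_def]
    have "tendsto_in_prob M
       (\<lambda>n \<omega>. diff_ratio (false_rej (reject_o g \<alpha>) \<theta> \<xi> n \<omega>) (false_rej (reject \<epsilon> \<gamma> \<alpha>) \<theta> \<xi> n \<omega>))
       (overlap_ratio True (A_o \<alpha>) (A_h \<alpha>))"
      by (rule iffD2[OF tendsto_in_prob_cong lim]) (simp add: rej_of_reject)
    moreover have "tendsto_in_prob M
       (\<lambda>n \<omega>. diff_ratio (true_rej (reject_o g \<alpha>) \<theta> \<xi> n \<omega>) (true_rej (reject \<epsilon> \<gamma> \<alpha>) \<theta> \<xi> n \<omega>))
       (overlap_ratio False (A_o \<alpha>) (A_h \<alpha>))"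
      by (rule iffD2[OF tendsto_in_prob_cong lim]) (simp add: rej_of_reject)
    ultimately show ?case using \<alpha> by blast
  qed
qed

end

theorem proposition4p2:
  fixes M :: "'w measure" and a \<epsilon> :: real
    and g :: "real ^ 'k \<Rightarrow> real" and \<gamma> :: "real ^ 'k"
    and \<theta> :: "nat \<Rightarrow> 'w \<Rightarrow> bool" and \<xi> :: "nat \<Rightarrow> 'w \<Rightarrow> real ^ 'k"
  assumes "random_effects M a g \<theta> \<xi>"
    and "standing_assumptions g \<epsilon> \<gamma>"
  shows "\<exists>Pow_o Pow r_D r_V :: real \<Rightarrow> real.
     (\<forall>\<alpha>. alpha_star a g < \<alpha> \<and> \<alpha> < 1 \<longrightarrow>
        avg_power M (reject_o g \<alpha>) \<theta> \<xi> \<longlonglongrightarrow> Pow_o \<alpha>) \<and>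
     (\<forall>\<^sub>F \<alpha> in at_right (alpha_star a g). \<alpha> < 1 \<and>
        avg_power M (reject \<epsilon> \<gamma> \<alpha>) \<theta> \<xi> \<longlonglongrightarrow> Pow \<alpha> \<and>
        tendsto_in_prob M
          (\<lambda>n \<omega>. diff_ratio (false_rej (reject_o g \<alpha>) \<theta> \<xi> n \<omega>) (false_rej (reject \<epsilon> \<gamma> \<alpha>) \<theta> \<xi> n \<omega>))
          (r_D \<alpha>) \<and>
        tendsto_in_prob M
          (\<lambda>n \<omega>. diff_ratio (true_rej (reject_o g \<alpha>) \<theta> \<xi> n \<omega>) (true_rej (reject \<epsilon> \<gamma> \<alpha>) \<theta> \<xi> n \<omega>))
          (r_V \<alpha>)) \<and>
     ((\<lambda>\<alpha>. Pow_o \<alpha> / Pow \<alpha>) \<longlongrightarrow> 1) (at_right (alpha_star a g)) \<and>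
     (r_D \<longlongrightarrow> 0) (at_right (alpha_star a g)) \<and>
     (r_V \<longlongrightarrow> 0) (at_right (alpha_star a g))"
proof -
  interpret random_effects M a g \<theta> \<xi> by fact
  interpret peaked_effects M a g \<theta> \<xi> \<epsilon> \<gamma>
    by unfold_locales (rule assms(2))
  have "((\<lambda>\<alpha>. (mass True (A_o \<alpha>) / a) / (mass True (A_h \<alpha>) / a)) \<longlongrightarrow> 1) (at_right (alpha_star a g))"
    using mass_ratio_tendsto_1[of True] a_range by simp
  then show ?thesis
    using limits_at_critical overlap_ratio_tendsto_0 power_o_tendsto
    by (intro exI[of _ "\<lambda>\<alpha>. mass True (A_o \<alpha>) / a"] exI[of _ "\<lambda>\<alpha>. mass True (A_h \<alpha>) / a"]
        exI[of _ "\<lambda>\<alpha>. overlap_ratio True (A_o \<alpha>) (A_h \<alpha>)"]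
        exI[of _ "\<lambda>\<alpha>. overlap_ratio False (A_o \<alpha>) (A_h \<alpha>)"] conjI) simp_all
qed

end
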